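(* Let $\Omega\subset\mathbb{R}^N$ ($N\ge 2$) be a bounded domain with Lipschitz boundary, let $p,q\in C(\overline\Omega)$ with $p(x),q(x)>1$ on $\overline\Omega$ and $p^-\le p(x)\le p^+<q^-\le q(x)\le q^+<N$, and let $\mu\in L^\infty(\Omega)$ with $\mu\ge 0$. Assume that $f:\Omega\times\mathbb R\to\mathbb R$ is a Carathéodory function and that there are real $\bar c_1,\bar c_2\ge0$ and $s\in C(\overline\Omega)$ with $1<s(x)<p^*(x)$ for all $x\in\overline\Omega$ such that $|f(x,t)|\le\bar c_1+\bar c_2|t|^{s(x)-1}$ for all $(x,t)\in\Omega\times\mathbb R$. Let $F(x,t)=\int_0^tf(x,\tau)\,d\tau$ and $\mathcal J:W_0^{1,\mathcal H}(\Omega)\to\mathbb R$, $\mathcal J(u)=\int_\Omega F(x,u)\,dx$. Then $\mathcal J$ is a continuously Gâteaux differentiable functional whose Gâteaux derivative $\mathcal J':W_0^{1,\mathcal H}(\Omega)\to W_0^{1,\mathcal H}(\Omega)^*$, given by $$\langle\mathcal J'(u),\varphi\rangle=\int_\Omega f(x,u)\varphi\,dx,\qquad\forall u,\varphi\in W_0^{1,\mathcal H}(\Omega),$$ is compact.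
   Context: For $h\in C(\overline\Omega)$: $h^-=\min_{\overline\Omega}h$, $h^+=\max_{\overline\Omega}h$. Since $p^+<N$, $p^*(x)=\frac{Np(x)}{N-p(x)}$. Musielak–Orlicz spaces: $\mathcal H(x,t)=t^{p(x)}+\mu(x)t^{q(x)}$, $\rho_{\mathcal H}(u)=\int_\Omega\mathcal H(x,|u|)\,dx$; $L^{\mathcal H}(\Omega)$ is the space of measurable $u:\Omega\to\mathbb R$ with $\rho_{\mathcal H}(u)<\infty$ and norm $\|u\|_{\mathcal H}=\inf\{\zeta>0:\rho_{\mathcal H}(u/\zeta)\le1\}$; $W^{1,\mathcal H}(\Omega)=\{u\in L^{\mathcal H}(\Omega):|\nabla u|\in L^{\mathcal H}(\Omega)\}$ with norm $\|\nabla u\|_{\mathcal H}+\|u\|_{\mathcal H}$ (where $\|\nabla u\|_{\mathcal H}=\|\,|\nabla u|\,\|_{\mathcal H}$); $W_0^{1,\mathcal H}(\Omega)$ is the closure of $C_0^\infty(\Omega)$ in $W^{1,\mathcal H}(\Omega)$, equipped with the equivalent norm $\|u\|_{1,\mathcal H,0}=\|\nabla u\|_{\mathcal H}$; $W_0^{1,\mathcal H}(\Omega)^*$ is its dual and $\langle\cdot,\cdot\rangle$ the duality pairing. *)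

theory Defs
  imports "HOL-Analysis.Analysis"
begin

section \<open>Spaces of functions with a seminorm\<close>

text \<open>
  As usual in measure theory, elements of function spaces are represented by functions rather than
  by classes modulo equality almost everywhere, so the norms below are formally seminorms: they
  vanish exactly on the functions that are zero almost everywhere on the domain.  All notions
  in this section are meant for such a linear space \<open>V\<close> of functions with a seminorm \<open>n\<close>.
\<close>

definition norm_topology :: "'v::minus set \<Rightarrow> ('v \<Rightarrow> real) \<Rightarrow> 'v topology" where
  "norm_topology V n =
     topology (\<lambda>U. U \<subseteq> V \<and> (\<forall>u\<in>U. \<exists>r>0. \<forall>v\<in>V. n (v - u) < r \<longrightarrow> v \<in> U))"

lemma openin_norm_topology:
  "openin (norm_topology V n) U \<longleftrightarrow>
     U \<subseteq> V \<and> (\<forall>u\<in>U. \<exists>r>0. \<forall>v\<in>V. n (v - u) < r \<longrightarrow> v \<in> U)"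
proof -
  have "istopology (\<lambda>U. U \<subseteq> V \<and> (\<forall>u\<in>U. \<exists>r>0. \<forall>v\<in>V. n (v - u) < r \<longrightarrow> v \<in> U))"
    unfolding istopology_def
  proof (intro conjI allI impI; (elim conjE)?)
    fix S T
    assume S: "S \<subseteq> V" "\<forall>u\<in>S. \<exists>r>0. \<forall>v\<in>V. n (v - u) < r \<longrightarrow> v \<in> S"
      and T: "T \<subseteq> V" "\<forall>u\<in>T. \<exists>r>0. \<forall>v\<in>V. n (v - u) < r \<longrightarrow> v \<in> T"
    show "S \<inter> T \<subseteq> V" using S by blast
    show "\<forall>u\<in>S \<inter> T. \<exists>r>0. \<forall>v\<in>V. n (v - u) < r \<longrightarrow> v \<in> S \<inter> T"
    proof
      fix u assume "u \<in> S \<inter> T"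
      then obtain r r' where "r > 0" "\<forall>v\<in>V. n (v - u) < r \<longrightarrow> v \<in> S"
        "r' > 0" "\<forall>v\<in>V. n (v - u) < r' \<longrightarrow> v \<in> T"
        using S(2) T(2) by blast
      then show "\<exists>r>0. \<forall>v\<in>V. n (v - u) < r \<longrightarrow> v \<in> S \<inter> T"
        by (intro exI[of _ "min r r'"]) auto
    qed
  next
    fix K assume K: "\<forall>U\<in>K. U \<subseteq> V \<and> (\<forall>u\<in>U. \<exists>r>0. \<forall>v\<in>V. n (v - u) < r \<longrightarrow> v \<in> U)"
    then show "\<Union> K \<subseteq> V" by blast
    from K show "\<forall>u\<in>\<Union> K. \<exists>r>0. \<forall>v\<in>V. n (v - u) < r \<longrightarrow> v \<in> \<Union> K"
      by (meson UnionE UnionI)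
  qed
  then show ?thesis
    unfolding norm_topology_def by (simp add: topology_inverse')
qed

text \<open>
  Functionals on \<open>V\<close> are extended by \<open>0\<close> outside \<open>V\<close>, so that two elements of the dual space
  are equal as soon as they agree on \<open>V\<close>.
\<close>

definition dual_space :: "('a \<Rightarrow> real) set \<Rightarrow> (('a \<Rightarrow> real) \<Rightarrow> real) \<Rightarrow> (('a \<Rightarrow> real) \<Rightarrow> real) set" where
  "dual_space V n = {T.
     (\<forall>u\<in>V. \<forall>v\<in>V. T (\<lambda>x. u x + v x) = T u + T v) \<and>
     (\<forall>c. \<forall>u\<in>V. T (\<lambda>x. c * u x) = c * T u) \<and>
     (\<exists>C. \<forall>u\<in>V. \<bar>T u\<bar> \<le> C * n u) \<and>
     (\<forall>u. u \<notin> V \<longrightarrow> T u = 0)}"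

definition dual_norm :: "('a \<Rightarrow> real) set \<Rightarrow> (('a \<Rightarrow> real) \<Rightarrow> real) \<Rightarrow> (('a \<Rightarrow> real) \<Rightarrow> real) \<Rightarrow> real" where
  "dual_norm V n T = (SUP u\<in>{u\<in>V. n u \<le> 1}. \<bar>T u\<bar>)"

abbreviation dual_topology ::
  "('a \<Rightarrow> real) set \<Rightarrow> (('a \<Rightarrow> real) \<Rightarrow> real) \<Rightarrow> (('a \<Rightarrow> real) \<Rightarrow> real) topology" where
  "dual_topology V n \<equiv> norm_topology (dual_space V n) (dual_norm V n)"

definition has_gateaux_derivative ::
  "('a \<Rightarrow> real) set \<Rightarrow> (('a \<Rightarrow> real) \<Rightarrow> real) \<Rightarrow> (('a \<Rightarrow> real) \<Rightarrow> real) \<Rightarrow> (('a \<Rightarrow> real) \<Rightarrow> real)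
     \<Rightarrow> ('a \<Rightarrow> real) \<Rightarrow> bool" where
  "has_gateaux_derivative V n J T u \<longleftrightarrow>
     T \<in> dual_space V n \<and>
     (\<forall>\<phi>\<in>V. ((\<lambda>t. (J (\<lambda>x. u x + t * \<phi> x) - J u) / t) \<longlongrightarrow> T \<phi>) (at 0))"

definition continuously_gateaux_differentiable ::
  "('a \<Rightarrow> real) set \<Rightarrow> (('a \<Rightarrow> real) \<Rightarrow> real) \<Rightarrow> (('a \<Rightarrow> real) \<Rightarrow> real)
     \<Rightarrow> (('a \<Rightarrow> real) \<Rightarrow> ('a \<Rightarrow> real) \<Rightarrow> real) \<Rightarrow> bool" where
  "continuously_gateaux_differentiable V n J J' \<longleftrightarrow>
     (\<forall>u\<in>V. has_gateaux_derivative V n J (J' u) u) \<and>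
     continuous_map (norm_topology V n) (dual_topology V n) J'"

definition compact_to_dual ::
  "('a \<Rightarrow> real) set \<Rightarrow> (('a \<Rightarrow> real) \<Rightarrow> real) \<Rightarrow> (('a \<Rightarrow> real) \<Rightarrow> ('a \<Rightarrow> real) \<Rightarrow> real) \<Rightarrow> bool" where
  "compact_to_dual V n A \<longleftrightarrow>
     continuous_map (norm_topology V n) (dual_topology V n) A \<and>
     (\<forall>B\<subseteq>V. (\<exists>C. \<forall>u\<in>B. n u \<le> C) \<longrightarrow>
        compactin (dual_topology V n) (dual_topology V n closure_of (A ` B)))"


section \<open>Domains, test functions and weak gradients\<close>

text \<open>
  Near each boundary point, in coordinates whose last axis has direction \<open>\<nu>\<close>, the domain is the
  region below the graph of a Lipschitz function \<open>\<gamma>\<close> on the hyperplane orthogonal to \<open>\<nu>\<close>.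
\<close>

definition lipschitz_boundary :: "'a::euclidean_space set \<Rightarrow> bool" where
  "lipschitz_boundary \<Omega> \<longleftrightarrow>
     (\<forall>z\<in>frontier \<Omega>. \<exists>\<nu> r L \<gamma>. norm \<nu> = 1 \<and> r > 0 \<and>
        L-lipschitz_on {y. y \<bullet> \<nu> = 0} (\<gamma> :: 'a \<Rightarrow> real) \<and>
        \<Omega> \<inter> ball z r = {x \<in> ball z r. x \<bullet> \<nu> < \<gamma> (x - (x \<bullet> \<nu>) *\<^sub>R \<nu>)})"

definition bounded_lipschitz_domain :: "'a::euclidean_space set \<Rightarrow> bool" where
  "bounded_lipschitz_domain \<Omega> \<longleftrightarrow>
     open \<Omega> \<and> connected \<Omega> \<and> \<Omega> \<noteq> {} \<and> bounded \<Omega> \<and> lipschitz_boundary \<Omega>"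

primrec k_times_cont_diff :: "nat \<Rightarrow> ('a::euclidean_space \<Rightarrow> real) \<Rightarrow> bool" where
  "k_times_cont_diff 0 \<phi> \<longleftrightarrow> continuous_on UNIV \<phi>"
| "k_times_cont_diff (Suc k) \<phi> \<longleftrightarrow>
     (\<forall>x. \<phi> differentiable (at x)) \<and>
     (\<forall>i\<in>Basis. k_times_cont_diff k (\<lambda>x. frechet_derivative \<phi> (at x) i))"

text \<open>Test functions on \<open>\<Omega>\<close> are extended by \<open>0\<close> to the whole space.\<close>

definition test_functions :: "'a::euclidean_space set \<Rightarrow> ('a \<Rightarrow> real) set" where
  "test_functions \<Omega> = {\<phi>. (\<forall>k. k_times_cont_diff k \<phi>) \<and>
     compact (closure {x. \<phi> x \<noteq> 0}) \<and> closure {x. \<phi> x \<noteq> 0} \<subseteq> \<Omega>}"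

definition is_weak_gradient ::
  "'a::euclidean_space set \<Rightarrow> ('a \<Rightarrow> real) \<Rightarrow> ('a \<Rightarrow> 'a) \<Rightarrow> bool" where
  "is_weak_gradient \<Omega> u g \<longleftrightarrow>
     (\<forall>K\<subseteq>\<Omega>. compact K \<longrightarrow> set_integrable lebesgue K u \<and> set_integrable lebesgue K g) \<and>
     (\<forall>\<phi>\<in>test_functions \<Omega>. \<forall>i\<in>Basis.
        (LINT x:\<Omega>|lebesgue. u x * frechet_derivative \<phi> (at x) i) =
        - (LINT x:\<Omega>|lebesgue. (g x \<bullet> i) * \<phi> x))"

text \<open>Weak gradients are unique up to a null set, which the norms below do not see.\<close>

definition weak_gradient :: "'a::euclidean_space set \<Rightarrow> ('a \<Rightarrow> real) \<Rightarrow> 'a \<Rightarrow> 'a" where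
  "weak_gradient \<Omega> u = (SOME g. is_weak_gradient \<Omega> u g)"


section \<open>Musielak--Orlicz--Sobolev spaces of double phase type\<close>

definition dphase :: "('a \<Rightarrow> real) \<Rightarrow> ('a \<Rightarrow> real) \<Rightarrow> ('a \<Rightarrow> real) \<Rightarrow> 'a \<Rightarrow> real \<Rightarrow> real" where
  "dphase p q \<mu> x t = t powr p x + \<mu> x * t powr q x"

definition modular :: "'a::euclidean_space set \<Rightarrow> ('a \<Rightarrow> real \<Rightarrow> real) \<Rightarrow> ('a \<Rightarrow> real) \<Rightarrow> ennreal" where
  "modular \<Omega> H u = (\<integral>\<^sup>+ x. ennreal (H x \<bar>u x\<bar>) \<partial>lebesgue_on \<Omega>)"

definition L_space :: "'a::euclidean_space set \<Rightarrow> ('a \<Rightarrow> real \<Rightarrow> real) \<Rightarrow> ('a \<Rightarrow> real) set" where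
  "L_space \<Omega> H = {u. u \<in> borel_measurable (lebesgue_on \<Omega>) \<and> modular \<Omega> H u < \<infinity>}"

definition luxemburg_norm :: "'a::euclidean_space set \<Rightarrow> ('a \<Rightarrow> real \<Rightarrow> real) \<Rightarrow> ('a \<Rightarrow> real) \<Rightarrow> real" where
  "luxemburg_norm \<Omega> H u = Inf {\<zeta>. \<zeta> > 0 \<and> modular \<Omega> H (\<lambda>x. u x / \<zeta>) \<le> 1}"

definition W_space :: "'a::euclidean_space set \<Rightarrow> ('a \<Rightarrow> real \<Rightarrow> real) \<Rightarrow> ('a \<Rightarrow> real) set" where
  "W_space \<Omega> H = {u \<in> L_space \<Omega> H. \<exists>g. is_weak_gradient \<Omega> u g \<and> (\<lambda>x. norm (g x)) \<in> L_space \<Omega> H}"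

definition grad_norm :: "'a::euclidean_space set \<Rightarrow> ('a \<Rightarrow> real \<Rightarrow> real) \<Rightarrow> ('a \<Rightarrow> real) \<Rightarrow> real" where
  "grad_norm \<Omega> H u = luxemburg_norm \<Omega> H (\<lambda>x. norm (weak_gradient \<Omega> u x))"

definition W_norm :: "'a::euclidean_space set \<Rightarrow> ('a \<Rightarrow> real \<Rightarrow> real) \<Rightarrow> ('a \<Rightarrow> real) \<Rightarrow> real" where
  "W_norm \<Omega> H u = grad_norm \<Omega> H u + luxemburg_norm \<Omega> H u"

definition W0_space :: "'a::euclidean_space set \<Rightarrow> ('a \<Rightarrow> real \<Rightarrow> real) \<Rightarrow> ('a \<Rightarrow> real) set" where
  "W0_space \<Omega> H = norm_topology (W_space \<Omega> H) (W_norm \<Omega> H) closure_of (test_functions \<Omega>)"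


section \<open>The nonlinearity and its functional\<close>

definition min_on :: "'a::euclidean_space set \<Rightarrow> ('a \<Rightarrow> real) \<Rightarrow> real" where
  "min_on \<Omega> h = (INF x\<in>closure \<Omega>. h x)"

definition max_on :: "'a::euclidean_space set \<Rightarrow> ('a \<Rightarrow> real) \<Rightarrow> real" where
  "max_on \<Omega> h = (SUP x\<in>closure \<Omega>. h x)"

definition critical_exponent :: "nat \<Rightarrow> ('a \<Rightarrow> real) \<Rightarrow> 'a \<Rightarrow> real" where
  "critical_exponent N p x = real N * p x / (real N - p x)"

definition nonneg_L_infinity :: "'a::euclidean_space set \<Rightarrow> ('a \<Rightarrow> real) \<Rightarrow> bool" where
  "nonneg_L_infinity \<Omega> \<mu> \<longleftrightarrow> \<mu> \<in> borel_measurable (lebesgue_on \<Omega>) \<and>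
     (\<exists>C. AE x in lebesgue_on \<Omega>. 0 \<le> \<mu> x \<and> \<mu> x \<le> C)"

definition caratheodory :: "'a::euclidean_space set \<Rightarrow> ('a \<Rightarrow> real \<Rightarrow> real) \<Rightarrow> bool" where
  "caratheodory \<Omega> f \<longleftrightarrow>
     (\<forall>t. (\<lambda>x. f x t) \<in> borel_measurable (lebesgue_on \<Omega>)) \<and>
     (AE x in lebesgue_on \<Omega>. continuous_on UNIV (f x))"

definition primitive :: "('a \<Rightarrow> real \<Rightarrow> real) \<Rightarrow> 'a \<Rightarrow> real \<Rightarrow> real" where
  "primitive f x t = (LBINT \<tau>=ereal 0..ereal t. f x \<tau>)"

definition energy :: "'a::euclidean_space set \<Rightarrow> ('a \<Rightarrow> real \<Rightarrow> real) \<Rightarrow> ('a \<Rightarrow> real) \<Rightarrow> real" where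
  "energy \<Omega> f u = (LINT x:\<Omega>|lebesgue. primitive f x (u x))"

definition energy_derivative ::
  "'a::euclidean_space set \<Rightarrow> ('a \<Rightarrow> real) set \<Rightarrow> ('a \<Rightarrow> real \<Rightarrow> real) \<Rightarrow> ('a \<Rightarrow> real) \<Rightarrow> ('a \<Rightarrow> real) \<Rightarrow> real" where
  "energy_derivative \<Omega> V f u \<phi> =
     (if \<phi> \<in> V then LINT x:\<Omega>|lebesgue. f x (u x) * \<phi> x else 0)"

end

theory Submission
  imports Defs "HOL-Complex_Analysis.Great_Picard"
begin

text \<open>
  The embedding of \<open>W\<^sub>0\<close> into functions with finite modular \<open>\<integral> |u|\<^bsup>t(x)\<^esup>\<close>, for an exponent
  \<open>t = s + \<epsilon>\<close> that is still below the critical one, gives everything.  It says two things: on a bounded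
  set of \<open>W\<^sub>0\<close> these modulars are bounded (\<open>V_embedding\<close>), and a bounded sequence has a subsequence that
  converges almost everywhere (\<open>V_AE_compact\<close>).  Since \<open>f(x, \<cdot>)\<close> grows like a power \<open>s(x) - 1\<close>, the surplus
  \<open>\<epsilon>\<close> makes the products \<open>f(x, u) \<phi>\<close> uniformly integrable.  Hence almost everywhere convergence
  \<open>u\<^sub>k \<rightarrow> v\<close> with bounded modulars forces \<open>\<integral> (f(x, u\<^sub>k) - f(x, v)) \<phi> \<rightarrow> 0\<close> uniformly for \<open>\<phi>\<close> in the unit
  ball, which is convergence \<open>J'(u\<^sub>k) \<rightarrow> J'(v)\<close> in the dual norm (\<open>J'_tendsto_if_AE_tendsto\<close>).  Compactness
  of \<open>J'\<close> is this statement for bounded sequences, continuity is this statement for convergent ones, and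
  the Gateaux derivative is computed by dominated convergence.  The limit \<open>v\<close> need not belong to
  \<open>W\<^sub>0\<close>: its modular is finite by Fatou's lemma, and that already makes \<open>J'(v)\<close> a bounded functional.

  The embedding is proved for test functions first.  For a smooth \<open>u\<close>, the
  difference between \<open>u(x)\<close> and its average over a cube of side \<open>h\<close> at \<open>x\<close> is controlled by integrals of
  \<open>|\<nabla>u|\<close> along segments from \<open>x\<close> of relative length \<open>h\<close>; this \<open>segment_potential\<close> replaces the Riesz potential.
  If \<open>|\<nabla>u|\<^sup>r\<close> is integrable with \<open>r < N\<close>, the part of the potential beyond distance \<open>h\<close> is at most of
  order \<open>h powr (1 - N / r)\<close> everywhere, and the part within distance \<open>h\<close> is small in
  mean.  So \<open>|u|\<close> exceeds a multiple of \<open>h powr (1 - N / r)\<close> only on a set of measure \<open>O(h\<^sup>N)\<close>.  This is the weak-type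
  estimate at the critical exponent (\<open>superlevel_set_bound\<close>), and summing over dyadic \<open>h\<close> bounds \<open>\<integral> |u|\<^sup>\<sigma>\<close> for
  every subcritical \<open>\<sigma>\<close> (\<open>subcritical_sobolev_inequality\<close>).  The estimate is local, so continuous
  exponents are handled by freezing them: on a small ball \<open>p\<close> is replaced by a constant slightly below
  it and \<open>t\<close> by a constant slightly above it, and finitely many such balls cover the closure of the domain.
  Almost everywhere convergence comes from cube averages again: at a fixed scale they form an
  equi-Lipschitz family, and they approximate the functions in \<open>L\<^sup>1\<close> at a rate given by the \<open>L\<^sup>1\<close> norm
  of the gradient (\<open>L1_Cauchy_subsequence\<close>).

  Passing from test functions to their closure \<open>W\<^sub>0\<close> requires that the weak gradient, which is chosen by Hilbert's
  operator, is unique almost everywhere and agrees with the classical gradient on test functions.  Uniqueness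
  is the fundamental lemma of the calculus of variations, so explicit smooth bump functions open the development.
\<close>

section \<open>Test functions approximating the indicator of a box\<close>

lemma k_times_cont_diff_SucD:
  "k_times_cont_diff (Suc k) \<phi> \<Longrightarrow> k_times_cont_diff k \<phi>"
proof (induction k arbitrary: \<phi>)
  case 0
  then show ?case
    by (auto intro!: differentiable_imp_continuous_on simp: differentiable_on_def differentiable_at_withinI)
qed auto

lemma k_times_cont_diff_cmult:
  "k_times_cont_diff k \<phi> \<Longrightarrow> k_times_cont_diff k (\<lambda>x. c * \<phi> x)"
proof (induction k arbitrary: \<phi>)
  case 0 then show ?case by (auto intro!: continuous_intros)
next
  case (Suc k)
  have D: "((\<lambda>x. c * \<phi> x) has_derivative (\<lambda>h. c * frechet_derivative \<phi> (at x) h)) (at x)" for x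
    using Suc.prems by (auto intro!: has_derivative_mult_right simp: frechet_derivative_works[symmetric])
  show ?case
    unfolding k_times_cont_diff.simps frechet_derivative_at[OF D, symmetric]
    using Suc D by (auto simp: differentiable_def)
qed

lemma k_times_cont_diff_add:
  "k_times_cont_diff k \<phi> \<Longrightarrow> k_times_cont_diff k \<psi> \<Longrightarrow> k_times_cont_diff k (\<lambda>x. \<phi> x + \<psi> x)"
proof (induction k arbitrary: \<phi> \<psi>)
  case 0 then show ?case by (auto intro!: continuous_intros)
next
  case (Suc k)
  have D: "((\<lambda>x. \<phi> x + \<psi> x) has_derivative
      (\<lambda>h. frechet_derivative \<phi> (at x) h + frechet_derivative \<psi> (at x) h)) (at x)" for x
    using Suc.prems by (auto intro!: has_derivative_add simp: frechet_derivative_works[symmetric])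
  show ?case
    unfolding k_times_cont_diff.simps frechet_derivative_at[OF D, symmetric]
    using Suc D by (auto simp: differentiable_def)
qed

lemma k_times_cont_diff_mult:
  "k_times_cont_diff k \<phi> \<Longrightarrow> k_times_cont_diff k \<psi> \<Longrightarrow> k_times_cont_diff k (\<lambda>x. \<phi> x * \<psi> x)"
proof (induction k arbitrary: \<phi> \<psi>)
  case 0 then show ?case by (auto intro!: continuous_intros)
next
  case (Suc k)
  have D: "((\<lambda>x. \<phi> x * \<psi> x) has_derivative
      (\<lambda>h. \<phi> x * frechet_derivative \<psi> (at x) h + frechet_derivative \<phi> (at x) h * \<psi> x)) (at x)" for x
    using Suc.prems by (auto intro!: has_derivative_mult simp: frechet_derivative_works[symmetric])
  show ?case
    unfolding k_times_cont_diff.simps frechet_derivative_at[OF D, symmetric]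
    using Suc D k_times_cont_diff_SucD[OF Suc.prems(1)] k_times_cont_diff_SucD[OF Suc.prems(2)]
    by (auto simp: differentiable_def intro!: k_times_cont_diff_add)
qed

lemma k_times_cont_diff_const: "k_times_cont_diff k (\<lambda>x. c)"
  by (induction k arbitrary: c) auto

lemma k_times_cont_diff_prod:
  assumes "finite I" "\<And>i. i \<in> I \<Longrightarrow> k_times_cont_diff k (\<phi> i)"
  shows "k_times_cont_diff k (\<lambda>x. \<Prod>i\<in>I. \<phi> i x)"
  using assms
  by (induction I rule: finite_induct) (auto intro: k_times_cont_diff_const k_times_cont_diff_mult)

text \<open>
  The family is closed under differentiation up to linear combinations, which reduces smoothness of
  the flat function \<open>flat 0\<close> to differentiability of every member.
\<close>

definition flat :: "nat \<Rightarrow> real \<Rightarrow> real" where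
  "flat n t = (if t > 0 then inverse t ^ n * exp (- inverse t) else 0)"

lemma flat_over_arg_tendsto_0: "((\<lambda>t. flat n t / t) \<longlongrightarrow> 0) (at 0)"
proof (rule filterlim_split_at)
  show "((\<lambda>t. flat n t / t) \<longlongrightarrow> 0) (at_left 0)"
    by (rule tendsto_eventually, rule eventually_at_leftI[of "-1"]) (auto simp: flat_def)
  have "((\<lambda>t::real. inverse t ^ Suc n / exp (inverse t)) \<longlongrightarrow> 0) (at_right 0)"
    by (rule filterlim_compose[OF tendsto_power_div_exp_0 filterlim_inverse_at_top_right])
  then show "((\<lambda>t. flat n t / t) \<longlongrightarrow> 0) (at_right 0)"
    by (rule Lim_transform_eventually, intro eventually_at_rightI[of 0 1])
       (auto simp: flat_def exp_minus divide_inverse)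
qed

lemma flat_has_derivative:
  "(flat n has_real_derivative flat (n + 2) t - real n * flat (Suc n) t) (at t)"
proof -
  consider "t < 0" | "t = 0" | "t > 0" by linarith
  then show ?thesis
  proof cases
    case 1
    have "((\<lambda>_. 0) has_real_derivative 0) (at t)" by simp
    then have "(flat n has_real_derivative 0) (at t)"
      by (rule has_field_derivative_transform_within_open[where S = "{..<0}"]) (use 1 in \<open>auto simp: flat_def\<close>)
    then show ?thesis using 1 by (simp add: flat_def)
  next
    case 2
    then show ?thesis
      using flat_over_arg_tendsto_0[of n] by (simp add: has_field_derivative_iff flat_def)
  next
    case 3
    have "((\<lambda>t. inverse t ^ n * exp (- inverse t)) has_real_derivative
        flat (n + 2) t - real n * flat (Suc n) t) (at t)"
      using 3
      apply (auto intro!: derivative_eq_intros simp: flat_def power2_eq_square algebra_simps)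
      apply (cases n; simp add: power2_eq_square field_simps)
      done
    then show ?thesis
      by (rule has_field_derivative_transform_within_open[where S = "{0<..}"]) (use 3 in \<open>auto simp: flat_def\<close>)
  qed
qed

lemma k_times_cont_diff_flat: "k_times_cont_diff k (\<lambda>x. flat n (c * (x \<bullet> i) + d))"
proof (induction k arbitrary: n)
  case 0
  have "continuous_on UNIV (flat n)"
    using flat_has_derivative[of n] by (intro DERIV_continuous_on) (auto intro: DERIV_subset)
  then show ?case
    by (auto intro!: continuous_intros continuous_on_compose2[of UNIV "flat n"])
next
  case (Suc k)
  have D: "((\<lambda>x. flat n (c * (x \<bullet> i) + d)) has_derivative
      (\<lambda>h. (flat (n + 2) (c * (x \<bullet> i) + d) - real n * flat (Suc n) (c * (x \<bullet> i) + d)) * (c * (h \<bullet> i)))) (at x)" for x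
    by (rule has_derivative_eq_rhs,
        rule has_derivative_compose[where g = "flat n", OF _ flat_has_derivative[THEN has_field_derivative_imp_has_derivative]])
       (auto intro!: derivative_eq_intros)
  have E: "(\<lambda>x. (flat (n + 2) (c * (x \<bullet> i) + d) - real n * flat (Suc n) (c * (x \<bullet> i) + d)) * (c * (h \<bullet> i))) =
     (\<lambda>x. (c * (h \<bullet> i)) * flat (n + 2) (c * (x \<bullet> i) + d) + (- real n * (c * (h \<bullet> i))) * flat (Suc n) (c * (x \<bullet> i) + d))" for h
    by (auto simp: algebra_simps)
  show ?case
    unfolding k_times_cont_diff.simps frechet_derivative_at[OF D, symmetric] E
    by (intro conjI allI ballI k_times_cont_diff_add k_times_cont_diff_cmult Suc)
       (use D in \<open>auto simp: differentiable_def\<close>)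
qed

text \<open>
  One flat factor for each face of the box; the slope \<open>m\<close> makes the product approach the indicator.
\<close>

definition box_bump :: "'a::euclidean_space \<Rightarrow> 'a \<Rightarrow> nat \<Rightarrow> 'a \<Rightarrow> real" where
  "box_bump a b m x = (\<Prod>i\<in>Basis. flat 0 (real m * (x \<bullet> i - a \<bullet> i)) * flat 0 (real m * (b \<bullet> i - x \<bullet> i)))"

lemma flat_0_bounds: "0 \<le> flat 0 t" "flat 0 t \<le> 1"
  by (auto simp: flat_def)

lemma box_bump_bounds: "0 \<le> box_bump a b m x" "box_bump a b m x \<le> 1"
  unfolding box_bump_def
  by (auto intro!: prod_nonneg prod_le_1 mult_le_one simp: flat_0_bounds)

lemma box_bump_outside: "x \<notin> box a b \<Longrightarrow> box_bump a b m x = 0"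
  by (force simp: box_bump_def box_def flat_def zero_less_mult_iff not_less prod_zero_iff)

lemma box_bump_tendsto_indicator: "(\<lambda>m. box_bump a b m x) \<longlonglongrightarrow> indicator (box a b) x"
proof (cases "x \<in> box a b")
  case True
  have "(\<lambda>m. flat 0 (real m * t)) \<longlonglongrightarrow> 1" if "t > 0" for t
  proof -
    have "(\<lambda>m. exp (- inverse (real m * t))) \<longlonglongrightarrow> exp (- 0)"
      by (intro tendsto_intros tendsto_inverse_0_at_top filterlim_at_top_mult_tendsto_pos[OF tendsto_const])
         (use that filterlim_real_sequentially in \<open>auto simp: mult.commute intro: filterlim_tendsto_pos_mult_at_top[OF tendsto_const]\<close>)
    then have "(\<lambda>m. exp (- inverse (real m * t))) \<longlonglongrightarrow> 1" by simp
    then show ?thesis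
      by (rule Lim_transform_eventually)
         (use that in \<open>auto simp: flat_def intro!: eventually_mono[OF eventually_gt_at_top[of 0]]\<close>)
  qed
  note lim = this
  have "(\<lambda>m. box_bump a b m x) \<longlonglongrightarrow> (\<Prod>i\<in>(Basis :: 'a set). 1 * 1)"
    unfolding box_bump_def by (intro tendsto_prod tendsto_mult lim) (use True in \<open>auto simp: box_def\<close>)
  then show ?thesis using True by simp
qed (simp add: box_bump_outside)

lemma box_bump_test_function:
  assumes "cbox a b \<subseteq> \<Omega>"
  shows "box_bump a b m \<in> test_functions \<Omega>"
proof -
  have "k_times_cont_diff k (box_bump a b m)" for k
  proof -
    have eq: "box_bump a b m = (\<lambda>x. \<Prod>i\<in>Basis. flat 0 (real m * (x \<bullet> i) + (- real m * (a \<bullet> i))) *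
        flat 0 ((- real m) * (x \<bullet> i) + real m * (b \<bullet> i)))"
      by (auto simp: box_bump_def algebra_simps)
    show ?thesis
      unfolding eq
      by (intro k_times_cont_diff_prod k_times_cont_diff_mult k_times_cont_diff_flat finite_Basis)
  qed
  moreover have "closure {x. box_bump a b m x \<noteq> 0} \<subseteq> cbox a b"
    using box_bump_outside box_subset_cbox by (intro closure_minimal closed_cbox) blast
  ultimately show ?thesis
    using assms compact_closure bounded_subset[OF bounded_cbox] closure_subset
    by (auto simp: test_functions_def) blast
qed

section \<open>Weak gradients\<close>

text \<open>
  The bumps of the box are admissible test functions and converge boundedly to its indicator.
\<close>

lemma integral_cbox_eq_0_if_test_integrals_eq_0:
  fixes h :: "'a::euclidean_space \<Rightarrow> real"
  assumes int: "set_integrable lebesgue (cbox a b) h" and sub: "cbox a b \<subseteq> \<Omega>"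
    and zero: "\<And>\<phi>. \<phi> \<in> test_functions \<Omega> \<Longrightarrow> (LINT x:\<Omega>|lebesgue. h x * \<phi> x) = 0"
  shows "integral (cbox a b) h = 0"
proof -
  have bump_borel: "box_bump a b m \<in> borel_measurable lebesgue" for m
    using box_bump_test_function[OF sub, of m]
    by (auto simp: test_functions_def intro!: measurable_completion borel_measurable_continuous_onI
        dest!: spec[of _ 0])
  have box: "set_integrable lebesgue (box a b) h"
    by (rule set_integrable_subset[OF int]) (auto simp: box_subset_cbox)
  have "(\<lambda>m. LINT x|lebesgue. (indicator (cbox a b) x *\<^sub>R h x) * box_bump a b m x) \<longlonglongrightarrow>
      (LINT x|lebesgue. (indicator (cbox a b) x *\<^sub>R h x) * indicator (box a b) x)"
  proof (rule integral_dominated_convergence[where w = "\<lambda>x. norm (indicator (cbox a b) x *\<^sub>R h x)"])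
    show "integrable lebesgue (\<lambda>x. norm (indicator (cbox a b) x *\<^sub>R h x))"
      using int unfolding set_integrable_def by (rule integrable_norm)
    have m: "(\<lambda>x. indicator (cbox a b) x *\<^sub>R h x) \<in> borel_measurable lebesgue"
      using int unfolding set_integrable_def by (rule borel_measurable_integrable)
    show "(\<lambda>x. (indicator (cbox a b) x *\<^sub>R h x) * indicator (box a b) x) \<in> borel_measurable lebesgue"
      by (intro borel_measurable_times m borel_measurable_indicator) auto
    show "(\<lambda>x. (indicator (cbox a b) x *\<^sub>R h x) * box_bump a b i x) \<in> borel_measurable lebesgue" for i
      by (intro borel_measurable_times m bump_borel)
    show "AE x in lebesgue. (\<lambda>i. indicat_real (cbox a b) x *\<^sub>R h x * box_bump a b i x)
         \<longlonglongrightarrow> indicat_real (cbox a b) x *\<^sub>R h x * indicat_real (box a b) x"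
      by (intro AE_I2 tendsto_intros box_bump_tendsto_indicator)
    show "AE x in lebesgue. norm (indicat_real (cbox a b) x *\<^sub>R h x * box_bump a b i x)
         \<le> norm (indicat_real (cbox a b) x *\<^sub>R h x)" for i
      by (intro AE_I2) (auto simp: indicator_def abs_mult abs_of_nonneg box_bump_bounds intro!: mult_left_le)
  qed
  moreover have "(LINT x|lebesgue. (indicator (cbox a b) x *\<^sub>R h x) * box_bump a b m x) = 0" for m
  proof -
    have "(LINT x|lebesgue. (indicator (cbox a b) x *\<^sub>R h x) * box_bump a b m x) =
        (LINT x:\<Omega>|lebesgue. h x * box_bump a b m x)"
      unfolding set_lebesgue_integral_def
      by (rule Bochner_Integration.integral_cong)
         (use sub box_subset_cbox[of a b] box_bump_outside[of _ a b m] in \<open>auto simp: indicator_def\<close>)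
    then show ?thesis using zero box_bump_test_function[OF sub] by simp
  qed
  ultimately have "(LINT x|lebesgue. (indicator (cbox a b) x *\<^sub>R h x) * indicator (box a b) x) = 0"
    by (simp add: LIMSEQ_const_iff)
  also have "(LINT x|lebesgue. (indicator (cbox a b) x *\<^sub>R h x) * indicator (box a b) x) =
      (LINT x:box a b|lebesgue. h x)"
    unfolding set_lebesgue_integral_def
    by (rule Bochner_Integration.integral_cong) (use box_subset_cbox[of a b] in \<open>auto simp: indicator_def\<close>)
  also have "\<dots> = integral (box a b) h"
    by (rule set_lebesgue_integral_eq_integral[OF box])
  finally show ?thesis by (simp add: integral_open_interval)
qed

text \<open>
  The fundamental lemma of the calculus of variations.  All integrals of \<open>h\<close> over small cubes vanish, so
  Lebesgue's differentiation theorem recovers the value \<open>0\<close> at almost every point.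
\<close>

lemma AE_eq_0_if_test_integrals_eq_0:
  fixes h :: "'a::euclidean_space \<Rightarrow> real"
  assumes "open \<Omega>"
    and int: "\<And>K. compact K \<Longrightarrow> K \<subseteq> \<Omega> \<Longrightarrow> set_integrable lebesgue K h"
    and zero: "\<And>\<phi>. \<phi> \<in> test_functions \<Omega> \<Longrightarrow> (LINT x:\<Omega>|lebesgue. h x * \<phi> x) = 0"
  shows "AE x in lebesgue_on \<Omega>. h x = 0"
proof -
  have box: "AE x in lebesgue. x \<in> cbox c d \<longrightarrow> h x = 0" if cd: "cbox c d \<subseteq> \<Omega>" for c d
  proof -
    \<comment> \<open>Differentiation needs integrability on every box, so \<open>h\<close> is cut off to a box inside the domain.\<close>
    let ?h = "\<lambda>x. if x \<in> cbox c d then h x else 0"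
    have sub_int: "set_integrable lebesgue (cbox a b \<inter> cbox c d) h" for a b
      by (rule set_integrable_subset[OF int[OF compact_cbox cd]]) auto
    have zero': "integral (cbox a b) ?h = 0" for a b
    proof -
      obtain a' b' where ab: "cbox a b \<inter> cbox c d = cbox a' b'"
        unfolding Int_interval by blast
      have "integral (cbox a b) ?h = integral (cbox a b \<inter> cbox c d) h"
        using integral_restrict_Int[of "cbox a b" "cbox c d" h] by (simp add: Int_commute)
      also have "\<dots> = 0"
        unfolding ab using sub_int[of a b] ab cd zero
        by (intro integral_cbox_eq_0_if_test_integrals_eq_0[where \<Omega> = \<Omega>]) auto
      finally show ?thesis .
    qed
    have "?h integrable_on cbox a b" for a b
      using set_lebesgue_integral_eq_integral(1)[OF sub_int[of a b]]
        integrable_restrict_Int[of "cbox c d" h "cbox a b"] by (simp add: Int_commute)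
    then obtain N where N: "negligible N"
      "\<And>x e. \<lbrakk>x \<notin> N; 0 < e\<rbrakk> \<Longrightarrow> \<exists>\<delta>>0. \<forall>t. 0 < t \<and> t < \<delta> \<longrightarrow>
        norm (integral (cbox x (x + t *\<^sub>R One)) ?h /\<^sub>R t ^ DIM('a) - ?h x) < e"
      by (rule integrable_ccontinuous_explicit) blast
    have "?h x = 0" if "x \<notin> N" for x
    proof (rule ccontr)
      assume nz: "?h x \<noteq> 0"
      then have "0 < norm (?h x)" by simp
      from N(2)[OF that this] obtain \<delta> where \<delta>: "\<delta> > 0" "\<And>t. 0 < t \<and> t < \<delta> \<Longrightarrow>
          norm (integral (cbox x (x + t *\<^sub>R One)) ?h /\<^sub>R t ^ DIM('a) - ?h x) < norm (?h x)"
        by blast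
      show False using \<delta>(2)[of "\<delta> / 2"] \<delta>(1) unfolding zero' by simp
    qed
    then have "h x = 0" if "x \<notin> N" "x \<in> cbox c d" for x using that by metis
    then show ?thesis
      using N(1) by (intro AE_I'[of N]) (auto simp: negligible_iff_null_sets)
  qed
  obtain \<D> where \<D>: "countable \<D>" "\<Union>\<D> = \<Omega>"
    "\<And>X. X \<in> \<D> \<Longrightarrow> \<exists>a b. X = cbox a b"
    using open_countable_Union_open_cbox[OF assms(1)] by metis
  have "AE x in lebesgue. \<forall>X\<in>\<D>. x \<in> X \<longrightarrow> h x = 0"
    unfolding AE_ball_countable[OF \<D>(1)] using \<D>(2,3) box by blast
  then have "AE x in lebesgue. x \<in> \<Omega> \<longrightarrow> h x = 0"
    using \<D>(2) by (auto elim!: eventually_mono)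
  then show ?thesis
    using assms(1) by (subst AE_restrict_space_iff) (auto simp: borel_open)
qed

definition classical_gradient :: "('a::euclidean_space \<Rightarrow> real) \<Rightarrow> 'a \<Rightarrow> 'a" where
  "classical_gradient \<phi> x = (\<Sum>i\<in>Basis. frechet_derivative \<phi> (at x) i *\<^sub>R i)"

lemma classical_gradient_inner_Basis:
  "i \<in> Basis \<Longrightarrow> classical_gradient \<phi> x \<bullet> i = frechet_derivative \<phi> (at x) i"
  by (simp add: classical_gradient_def inner_sum_left inner_Basis if_distrib sum.delta cong: if_cong)

context
  fixes \<phi> :: "'a::euclidean_space \<Rightarrow> real" and \<Omega>
  assumes test: "\<phi> \<in> test_functions \<Omega>"
begin

lemma test_function_has_derivative: "(\<phi> has_derivative (\<lambda>h. classical_gradient \<phi> x \<bullet> h)) (at x)"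
proof -
  have D: "(\<phi> has_derivative frechet_derivative \<phi> (at x)) (at x)"
    using test by (auto simp: test_functions_def frechet_derivative_works[symmetric] dest: spec[of _ 1])
  then interpret linear "frechet_derivative \<phi> (at x)"
    by (rule has_derivative_linear)
  have "frechet_derivative \<phi> (at x) h = classical_gradient \<phi> x \<bullet> h" for h
  proof -
    have "frechet_derivative \<phi> (at x) h = frechet_derivative \<phi> (at x) (\<Sum>i\<in>Basis. (h \<bullet> i) *\<^sub>R i)"
      by (simp add: euclidean_representation)
    also have "\<dots> = (\<Sum>i\<in>Basis. (h \<bullet> i) * frechet_derivative \<phi> (at x) i)"
      by (simp add: sum scaleR)
    also have "\<dots> = classical_gradient \<phi> x \<bullet> h"
      by (simp add: classical_gradient_def inner_sum_left inner_sum_right inner_commute mult.commute)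
    finally show ?thesis .
  qed
  then show ?thesis using D by (metis (no_types, lifting) has_derivative_eq_rhs ext)
qed

lemma continuous_on_test_function: "continuous_on A \<phi>"
  using test by (auto simp: test_functions_def dest!: spec[of _ 0] intro: continuous_on_subset)

lemma continuous_on_classical_gradient: "continuous_on A (classical_gradient \<phi>)"
proof -
  have "k_times_cont_diff (Suc 0) \<phi>"
    using test unfolding test_functions_def by blast
  then have "\<forall>i\<in>Basis. continuous_on UNIV (\<lambda>x. frechet_derivative \<phi> (at x) i)"
    by simp
  then have "continuous_on UNIV (classical_gradient \<phi>)"
    unfolding classical_gradient_def[abs_def] by (auto intro!: continuous_intros)
  then show ?thesis by (rule continuous_on_subset) auto
qed

lemma test_function_support:
  obtains K where "compact K" "K \<subseteq> \<Omega>" "\<And>x. x \<notin> K \<Longrightarrow> \<phi> x = 0"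
    "\<And>x. x \<notin> K \<Longrightarrow> classical_gradient \<phi> x = 0"
proof
  let ?K = "closure {x. \<phi> x \<noteq> 0}"
  show "compact ?K" "?K \<subseteq> \<Omega>" using test by (auto simp: test_functions_def)
  show zero: "\<phi> x = 0" if "x \<notin> ?K" for x
    using that closure_subset[of "{x. \<phi> x \<noteq> 0}"] by auto
  show "classical_gradient \<phi> x = 0" if x: "x \<notin> ?K" for x
  proof -
    have "open (- ?K)" "x \<in> - ?K" using x by auto
    moreover have "\<phi> y = 0" if "y \<in> - ?K" for y by (rule zero) (use that in blast)
    ultimately have "((\<lambda>_. 0) has_derivative (\<lambda>h. classical_gradient \<phi> x \<bullet> h)) (at x)"
      by (rule has_derivative_transform_within_open[OF test_function_has_derivative])
    then have "(\<lambda>h. classical_gradient \<phi> x \<bullet> h) = (\<lambda>_. 0)"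
      by (rule has_derivative_unique[OF _ has_derivative_const])
    from fun_cong[OF this, of "classical_gradient \<phi> x"] show ?thesis by simp
  qed
qed

lemma test_function_eq_0: "x \<notin> \<Omega> \<Longrightarrow> \<phi> x = 0"
  and classical_gradient_eq_0: "x \<notin> \<Omega> \<Longrightarrow> classical_gradient \<phi> x = 0"
  by (rule test_function_support; blast)+

end

lemma test_functions_add:
  assumes "\<phi> \<in> test_functions \<Omega>" "\<psi> \<in> test_functions \<Omega>"
  shows "(\<lambda>x. \<phi> x + \<psi> x) \<in> test_functions \<Omega>"
proof -
  have "closure {x. \<phi> x + \<psi> x \<noteq> 0} \<subseteq> closure ({x. \<phi> x \<noteq> 0} \<union> {x. \<psi> x \<noteq> 0})"
    by (rule closure_mono) auto
  then have sub: "closure {x. \<phi> x + \<psi> x \<noteq> 0} \<subseteq> closure {x. \<phi> x \<noteq> 0} \<union> closure {x. \<psi> x \<noteq> 0}"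
    by (simp add: closure_Un)
  moreover have "compact (closure {x. \<phi> x + \<psi> x \<noteq> 0})"
  proof -
    have "{x. \<phi> x + \<psi> x \<noteq> 0} \<subseteq> {x. \<phi> x \<noteq> 0} \<union> {x. \<psi> x \<noteq> 0}" by auto
    then have "bounded {x. \<phi> x + \<psi> x \<noteq> 0}"
      by (rule bounded_subset[rotated]) (use assms in \<open>auto simp: test_functions_def\<close>)
    then show ?thesis by simp
  qed
  ultimately show ?thesis
    using assms by (auto simp: test_functions_def intro: k_times_cont_diff_add)
qed

lemma test_functions_cmult:
  assumes "\<phi> \<in> test_functions \<Omega>"
  shows "(\<lambda>x. c * \<phi> x) \<in> test_functions \<Omega>"
proof -
  have sub: "closure {x. c * \<phi> x \<noteq> 0} \<subseteq> closure {x. \<phi> x \<noteq> 0}"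
    by (rule closure_mono) auto
  moreover have "compact (closure {x. c * \<phi> x \<noteq> 0})"
    using assms bounded_subset[of "{x. \<phi> x \<noteq> 0}" "{x. c * \<phi> x \<noteq> 0}"]
    by (auto simp: test_functions_def)
  ultimately show ?thesis
    using assms by (auto simp: test_functions_def intro: k_times_cont_diff_cmult)
qed

lemma test_functions_mult:
  assumes "\<phi> \<in> test_functions \<Omega>" "\<psi> \<in> test_functions \<Omega>"
  shows "(\<lambda>x. \<phi> x * \<psi> x) \<in> test_functions \<Omega>"
proof -
  have sub: "closure {x. \<phi> x * \<psi> x \<noteq> 0} \<subseteq> closure {x. \<phi> x \<noteq> 0}"
    by (rule closure_mono) auto
  moreover have "compact (closure {x. \<phi> x * \<psi> x \<noteq> 0})"
    using assms bounded_subset[of "{x. \<phi> x \<noteq> 0}" "{x. \<phi> x * \<psi> x \<noteq> 0}"]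
    by (auto simp: test_functions_def)
  ultimately show ?thesis
    using assms by (auto simp: test_functions_def intro: k_times_cont_diff_mult)
qed

text \<open>
  Local integrability suffices against a continuous factor with compact support.
\<close>

lemma set_integrable_mult_continuous:
  fixes u \<psi> :: "'a::euclidean_space \<Rightarrow> real"
  assumes "compact K" "K \<subseteq> \<Omega>" "set_integrable lebesgue K u"
    and "continuous_on UNIV \<psi>" "\<And>x. x \<notin> K \<Longrightarrow> \<psi> x = 0"
  shows "set_integrable lebesgue \<Omega> (\<lambda>x. u x * \<psi> x)"
proof -
  obtain B where B: "\<And>x. x \<in> K \<Longrightarrow> norm (\<psi> x) \<le> B"
    using compact_imp_bounded[OF compact_continuous_image[OF continuous_on_subset[OF assms(4)] assms(1)]]
    by (auto simp: bounded_iff)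
  have [measurable]: "\<psi> \<in> borel_measurable lebesgue"
    using borel_measurable_continuous_onI[OF assms(4)] by (intro measurable_completion) simp
  have "(\<lambda>x. indicator \<Omega> x *\<^sub>R (u x * \<psi> x)) = (\<lambda>x. (indicator K x *\<^sub>R u x) * \<psi> x)"
    using assms(2,5) by (auto simp: indicator_def fun_eq_iff)
  moreover have "integrable lebesgue (\<lambda>x. (indicator K x *\<^sub>R u x) * \<psi> x)"
  proof (rule Bochner_Integration.integrable_bound[where f = "\<lambda>x. B *\<^sub>R (indicator K x *\<^sub>R u x)"])
    show "integrable lebesgue (\<lambda>x. B *\<^sub>R (indicator K x *\<^sub>R u x))"
      using assms(3) unfolding set_integrable_def by (rule integrable_scaleR_right)
    have m: "(\<lambda>x. indicator K x *\<^sub>R u x) \<in> borel_measurable lebesgue"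
      using assms(3) unfolding set_integrable_def by (rule borel_measurable_integrable)
    show "(\<lambda>x. (indicator K x *\<^sub>R u x) * \<psi> x) \<in> borel_measurable lebesgue"
      by (intro borel_measurable_times m) measurable
    show "AE x in lebesgue. norm ((indicator K x *\<^sub>R u x) * \<psi> x) \<le> norm (B *\<^sub>R (indicator K x *\<^sub>R u x))"
    proof (rule AE_I2)
      fix x
      show "norm ((indicator K x *\<^sub>R u x) * \<psi> x) \<le> norm (B *\<^sub>R (indicator K x *\<^sub>R u x))"
        using mult_right_mono[of "\<bar>\<psi> x\<bar>" "\<bar>B\<bar>" "\<bar>u x\<bar>"] B[of x]
        by (cases "x \<in> K") (auto simp: abs_mult mult.commute)
    qed
  qed
  ultimately show ?thesis by (simp add: set_integrable_def)
qed

lemma continuous_imp_set_integrable_compact: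
  fixes h :: "'a::euclidean_space \<Rightarrow> 'b::euclidean_space"
  assumes "compact K" "continuous_on UNIV h"
  shows "set_integrable lebesgue K h"
  using borel_integrable_compact[OF assms(1) continuous_on_subset[OF assms(2) subset_UNIV]]
  by (auto simp: set_integrable_def integrable_completion borel_measurable_integrable)

text \<open>
  Translation invariance makes the integral of every difference quotient vanish, and the quotients
  converge boundedly.
\<close>

lemma integral_partial_derivative_test_function:
  fixes \<phi> :: "'a::euclidean_space \<Rightarrow> real"
  assumes test: "\<phi> \<in> test_functions \<Omega>"
  shows "(LINT x|lborel. classical_gradient \<phi> x \<bullet> v) = 0"
proof -
  obtain K where K: "compact K" "\<And>x. x \<notin> K \<Longrightarrow> \<phi> x = 0" "\<And>x. x \<notin> K \<Longrightarrow> classical_gradient \<phi> x = 0"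
    using test_function_support[OF test] by metis
  obtain R where R: "\<And>x. x \<in> K \<Longrightarrow> norm x \<le> R"
    using compact_imp_bounded[OF K(1)] by (auto simp: bounded_iff)
  obtain B where B: "\<And>x. x \<in> K \<Longrightarrow> norm (classical_gradient \<phi> x) \<le> B"
    using compact_imp_bounded[OF compact_continuous_image[OF continuous_on_classical_gradient[OF test] K(1)]]
    by (auto simp: bounded_iff)
  have B': "norm (classical_gradient \<phi> x) \<le> max B 0" for x
    using B[of x] K(3)[of x] by (cases "x \<in> K") auto
  have [measurable]: "\<phi> \<in> borel_measurable borel" "classical_gradient \<phi> \<in> borel_measurable borel"
    by (auto intro!: borel_measurable_continuous_onI continuous_on_test_function[OF test]
        continuous_on_classical_gradient[OF test])
  define t :: "nat \<Rightarrow> real" where "t m = inverse (real (Suc m))" for m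
  have t: "0 < t m" "t m \<le> 1" "t m \<noteq> 0" for m by (auto simp: t_def field_simps)
  have tlim: "t \<longlonglongrightarrow> 0" unfolding t_def by (rule LIMSEQ_inverse_real_of_nat)
  have int: "integrable lborel \<phi>"
  proof -
    have "(\<lambda>x. indicator K x *\<^sub>R \<phi> x) = \<phi>" using K(2) by (auto simp: indicator_def fun_eq_iff)
    then show ?thesis
      using borel_integrable_compact[OF K(1) continuous_on_test_function[OF test]] by simp
  qed
  have shift: "integrable lborel (\<lambda>x. \<phi> (x + w))" "(LINT x|lborel. \<phi> (x + w)) = (LINT x|lborel. \<phi> x)" for w
  proof -
    have "integrable (distr lborel borel ((+) w)) \<phi>" unfolding lborel_distr_plus by (rule int)
    then show "integrable lborel (\<lambda>x. \<phi> (x + w))"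
      by (subst (asm) integrable_distr_eq) (auto simp: add.commute)
    have "(LINT x|distr lborel borel ((+) w). \<phi> x) = (LINT x|lborel. \<phi> (w + x))"
      by (rule integral_distr) auto
    then show "(LINT x|lborel. \<phi> (x + w)) = (LINT x|lborel. \<phi> x)"
      unfolding lborel_distr_plus by (simp add: add.commute)
  qed
  have bound: "\<bar>\<phi> (x + t m *\<^sub>R v) - \<phi> x\<bar> \<le> t m * norm v * max B 0" for x m
  proof -
    have "norm (\<phi> (x + t m *\<^sub>R v) - \<phi> x) \<le> max B 0 * norm (x + t m *\<^sub>R v - x)"
    proof (rule differentiable_bound[OF convex_UNIV])
      show "(\<phi> has_derivative (\<lambda>h. classical_gradient \<phi> x \<bullet> h)) (at x within UNIV)" for x
        using test_function_has_derivative[OF test] by simp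
      show "onorm (\<lambda>h. classical_gradient \<phi> x \<bullet> h) \<le> max B 0" for x
        using order_trans[OF Cauchy_Schwarz_ineq2 mult_right_mono[OF B' norm_ge_zero]]
        by (intro onorm_bound) auto
    qed auto
    then show ?thesis using t[of m] by (simp add: mult_ac)
  qed
  have "(\<lambda>m. LINT x|lborel. (\<phi> (x + t m *\<^sub>R v) - \<phi> x) / t m) \<longlonglongrightarrow> (LINT x|lborel. classical_gradient \<phi> x \<bullet> v)"
  proof (rule integral_dominated_convergence[where
        w = "\<lambda>x. indicator (cball (0::'a) (R + norm v)) x *\<^sub>R (norm v * max B 0)"])
    show "integrable lborel (\<lambda>x. indicator (cball (0::'a) (R + norm v)) x *\<^sub>R (norm v * max B 0))"
      by (rule borel_integrable_compact) auto
    show "AE x in lborel. (\<lambda>m. (\<phi> (x + t m *\<^sub>R v) - \<phi> x) / t m) \<longlonglongrightarrow> classical_gradient \<phi> x \<bullet> v"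
    proof (rule AE_I2)
      fix x
      have "((\<lambda>s. \<phi> (x + s *\<^sub>R v)) has_derivative (\<lambda>s. classical_gradient \<phi> (x + 0 *\<^sub>R v) \<bullet> (s *\<^sub>R v))) (at 0)"
        by (rule has_derivative_compose[where g = \<phi>, OF _ test_function_has_derivative[OF test]])
           (auto intro!: derivative_eq_intros)
      then have "((\<lambda>s. \<phi> (x + s *\<^sub>R v)) has_real_derivative (classical_gradient \<phi> x \<bullet> v)) (at 0)"
        by (simp add: has_field_derivative_def mult_commute_abs)
      then have "((\<lambda>s. (\<phi> (x + s *\<^sub>R v) - \<phi> x) / s) \<longlongrightarrow> classical_gradient \<phi> x \<bullet> v) (at 0)"
        by (simp add: has_field_derivative_iff)
      then show "(\<lambda>m. (\<phi> (x + t m *\<^sub>R v) - \<phi> x) / t m) \<longlonglongrightarrow> classical_gradient \<phi> x \<bullet> v"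
        by (rule filterlim_compose) (use t(3) tlim in \<open>auto simp: filterlim_at\<close>)
    qed
    show "AE x in lborel. norm ((\<phi> (x + t m *\<^sub>R v) - \<phi> x) / t m)
        \<le> indicator (cball (0::'a) (R + norm v)) x *\<^sub>R (norm v * max B 0)" for m
    proof (rule AE_I2)
      fix x
      show "norm ((\<phi> (x + t m *\<^sub>R v) - \<phi> x) / t m)
        \<le> indicator (cball (0::'a) (R + norm v)) x *\<^sub>R (norm v * max B 0)"
      proof (cases "x \<in> cball (0::'a) (R + norm v)")
        case True
        then show ?thesis using bound[of x m] t[of m] by (simp add: field_simps)
      next
        case False
        have "norm (t m *\<^sub>R v) \<le> norm v" using t[of m] by (simp add: mult_left_le_one_le)
        moreover have "norm x > R + norm v" using False by simp
        moreover have "norm (x + t m *\<^sub>R v) \<ge> norm x - norm (t m *\<^sub>R v)"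
          by (metis norm_diff_ineq)
        ultimately have "norm (x + t m *\<^sub>R v) > R" "norm x > R"
          using norm_ge_zero[of v] by linarith+
        then have "x + t m *\<^sub>R v \<notin> K" "x \<notin> K" using R by (meson not_le)+
        then have "\<phi> (x + t m *\<^sub>R v) = 0" "\<phi> x = 0" using K(2) by blast+
        then show ?thesis using False by simp
      qed
    qed
  qed measurable
  moreover have "(LINT x|lborel. (\<phi> (x + t m *\<^sub>R v) - \<phi> x) / t m) = 0" for m
    using int shift by simp
  ultimately have "(\<lambda>_. 0) \<longlonglongrightarrow> (LINT x|lborel. classical_gradient \<phi> x \<bullet> v)"
    by (simp only:)
  then show ?thesis by (simp add: LIMSEQ_const_iff)
qed

text \<open>
  Integration by parts is the vanishing integral of the derivative of a product of test functions.
\<close>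

lemma classical_gradient_is_weak_gradient:
  fixes \<phi> :: "'a::euclidean_space \<Rightarrow> real"
  assumes test: "\<phi> \<in> test_functions \<Omega>"
  shows "is_weak_gradient \<Omega> \<phi> (classical_gradient \<phi>)"
  unfolding is_weak_gradient_def
proof (intro conjI allI impI ballI)
  fix K :: "'a set" assume "compact K"
  then show "set_integrable lebesgue K \<phi>" "set_integrable lebesgue K (classical_gradient \<phi>)"
    by (auto intro!: continuous_imp_set_integrable_compact continuous_on_test_function[OF test]
        continuous_on_classical_gradient[OF test])
next
  fix \<psi> and i :: 'a assume \<psi>: "\<psi> \<in> test_functions \<Omega>" and i: "i \<in> Basis"
  have prod: "(\<lambda>x. \<phi> x * \<psi> x) \<in> test_functions \<Omega>"
    by (rule test_functions_mult[OF test \<psi>])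
  have D: "classical_gradient (\<lambda>x. \<phi> x * \<psi> x) x \<bullet> i =
      \<phi> x * (classical_gradient \<psi> x \<bullet> i) + (classical_gradient \<phi> x \<bullet> i) * \<psi> x" for x
  proof -
    have "((\<lambda>x. \<phi> x * \<psi> x) has_derivative
        (\<lambda>h. \<phi> x * (classical_gradient \<psi> x \<bullet> h) + (classical_gradient \<phi> x \<bullet> h) * \<psi> x)) (at x)"
      by (intro has_derivative_mult test_function_has_derivative[OF test] test_function_has_derivative[OF \<psi>])
    from has_derivative_unique[OF test_function_has_derivative[OF prod] this]
    show ?thesis by meson
  qed
  obtain K where K: "compact K" "K \<subseteq> \<Omega>" "\<And>x. x \<notin> K \<Longrightarrow> \<psi> x = 0" "\<And>x. x \<notin> K \<Longrightarrow> classical_gradient \<psi> x = 0"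
    using test_function_support[OF \<psi>] by metis
  have int: "set_integrable lebesgue \<Omega> (\<lambda>x. \<phi> x * (classical_gradient \<psi> x \<bullet> i))"
     "set_integrable lebesgue \<Omega> (\<lambda>x. (classical_gradient \<phi> x \<bullet> i) * \<psi> x)"
    by (rule set_integrable_mult_continuous[OF K(1,2)];
        use K in \<open>auto intro!: continuous_imp_set_integrable_compact continuous_intros
          continuous_on_classical_gradient[OF \<psi>] continuous_on_test_function[OF \<psi>]
          continuous_on_classical_gradient[OF test] continuous_on_test_function[OF test]\<close>)+
  have "(LINT x:\<Omega>|lebesgue. \<phi> x * (classical_gradient \<psi> x \<bullet> i)) + (LINT x:\<Omega>|lebesgue. (classical_gradient \<phi> x \<bullet> i) * \<psi> x)
     = (LINT x:\<Omega>|lebesgue. classical_gradient (\<lambda>x. \<phi> x * \<psi> x) x \<bullet> i)"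
    unfolding D using int by (rule set_integral_add(2)[symmetric])
  also have "\<dots> = (LINT x|lebesgue. classical_gradient (\<lambda>x. \<phi> x * \<psi> x) x \<bullet> i)"
    unfolding set_lebesgue_integral_def
    by (rule Bochner_Integration.integral_cong)
       (use classical_gradient_eq_0[OF prod] in \<open>auto simp: indicator_def\<close>)
  also have "\<dots> = (LINT x|lborel. classical_gradient (\<lambda>x. \<phi> x * \<psi> x) x \<bullet> i)"
    by (rule integral_completion)
       (auto intro!: borel_measurable_continuous_onI continuous_intros continuous_on_classical_gradient[OF prod])
  also have "\<dots> = 0" by (rule integral_partial_derivative_test_function[OF prod])
  finally show "(LINT x:\<Omega>|lebesgue. \<phi> x * frechet_derivative \<psi> (at x) i) =
      - (LINT x:\<Omega>|lebesgue. (classical_gradient \<phi> x \<bullet> i) * \<psi> x)"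
    by (simp add: classical_gradient_inner_Basis[OF i])
qed

lemma is_weak_gradient_linear:
  fixes u v :: "'a::euclidean_space \<Rightarrow> real"
  assumes u: "is_weak_gradient \<Omega> u g" and v: "is_weak_gradient \<Omega> v h"
  shows "is_weak_gradient \<Omega> (\<lambda>x. a * u x + b * v x) (\<lambda>x. a *\<^sub>R g x + b *\<^sub>R h x)"
  unfolding is_weak_gradient_def
proof (intro conjI allI impI ballI)
  fix K assume "K \<subseteq> \<Omega>" "compact K"
  then show "set_integrable lebesgue K (\<lambda>x. a * u x + b * v x)"
    "set_integrable lebesgue K (\<lambda>x. a *\<^sub>R g x + b *\<^sub>R h x)"
    using u v unfolding is_weak_gradient_def
    by (auto intro!: set_integral_add set_integrable_scaleR_right set_integrable_mult_right)
next
  fix \<psi> and i :: 'a assume \<psi>: "\<psi> \<in> test_functions \<Omega>" and i: "i \<in> Basis"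
  obtain K where K: "compact K" "K \<subseteq> \<Omega>" "\<And>x. x \<notin> K \<Longrightarrow> \<psi> x = 0" "\<And>x. x \<notin> K \<Longrightarrow> classical_gradient \<psi> x = 0"
    using test_function_support[OF \<psi>] by metis
  have loc: "set_integrable lebesgue K u" "set_integrable lebesgue K v"
     "set_integrable lebesgue K g" "set_integrable lebesgue K h"
    using u v K unfolding is_weak_gradient_def by auto
  have comp: "set_integrable lebesgue K (\<lambda>x. g x \<bullet> i)" "set_integrable lebesgue K (\<lambda>x. h x \<bullet> i)"
    using integrable_inner_left[of i lebesgue "\<lambda>x. indicator K x *\<^sub>R g x"]
      integrable_inner_left[of i lebesgue "\<lambda>x. indicator K x *\<^sub>R h x"] loc(3,4)
    by (simp_all add: set_integrable_def)
  have cont: "continuous_on UNIV (\<lambda>x. frechet_derivative \<psi> (at x) i)"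
    using continuous_on_inner[OF continuous_on_classical_gradient[OF \<psi>] continuous_on_const[of _ i]]
    by (simp add: classical_gradient_inner_Basis[OF i])
  have zero: "frechet_derivative \<psi> (at x) i = 0" if "x \<notin> K" for x
    using K(4)[OF that] classical_gradient_inner_Basis[OF i, of \<psi> x] by simp
  have I: "set_integrable lebesgue \<Omega> (\<lambda>x. w x * frechet_derivative \<psi> (at x) i)"
    if "set_integrable lebesgue K w" for w
    by (rule set_integrable_mult_continuous[OF K(1,2) that cont zero])
  have J: "set_integrable lebesgue \<Omega> (\<lambda>x. w x * \<psi> x)" if "set_integrable lebesgue K w" for w
    by (rule set_integrable_mult_continuous[OF K(1,2) that continuous_on_test_function[OF \<psi>] K(3)])
  have "(LINT x:\<Omega>|lebesgue. (a * u x + b * v x) * frechet_derivative \<psi> (at x) i) =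
      (LINT x:\<Omega>|lebesgue. a * (u x * frechet_derivative \<psi> (at x) i) + b * (v x * frechet_derivative \<psi> (at x) i))"
    by (simp add: algebra_simps)
  also have "\<dots> = a * (LINT x:\<Omega>|lebesgue. u x * frechet_derivative \<psi> (at x) i) +
      b * (LINT x:\<Omega>|lebesgue. v x * frechet_derivative \<psi> (at x) i)"
    using I[OF loc(1)] I[OF loc(2)]
    by (subst set_integral_add(2)) (auto intro!: set_integrable_mult_right)
  also have "\<dots> = - (a * (LINT x:\<Omega>|lebesgue. (g x \<bullet> i) * \<psi> x) + b * (LINT x:\<Omega>|lebesgue. (h x \<bullet> i) * \<psi> x))"
    using u v \<psi> i unfolding is_weak_gradient_def by simp
  also have "\<dots> = - (LINT x:\<Omega>|lebesgue. a * ((g x \<bullet> i) * \<psi> x) + b * ((h x \<bullet> i) * \<psi> x))"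
    using J[OF comp(1)] J[OF comp(2)]
    by (subst set_integral_add(2)) (auto intro!: set_integrable_mult_right)
  finally show "(LINT x:\<Omega>|lebesgue. (a * u x + b * v x) * frechet_derivative \<psi> (at x) i) =
      - (LINT x:\<Omega>|lebesgue. ((a *\<^sub>R g x + b *\<^sub>R h x) \<bullet> i) * \<psi> x)"
    by (simp add: algebra_simps)
qed

text \<open>
  The difference of two weak gradients of \<open>u\<close> is a weak gradient of \<open>0\<close>, so all its test integrals vanish.
\<close>

lemma is_weak_gradient_unique:
  fixes u :: "'a::euclidean_space \<Rightarrow> real"
  assumes "open \<Omega>" and g: "is_weak_gradient \<Omega> u g" and h: "is_weak_gradient \<Omega> u h"
  shows "AE x in lebesgue_on \<Omega>. g x = h x"
proof -
  have "is_weak_gradient \<Omega> (\<lambda>x. 1 * u x + (- 1) * u x) (\<lambda>x. 1 *\<^sub>R g x + (- 1) *\<^sub>R h x)"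
    by (rule is_weak_gradient_linear[OF g h])
  then have d: "is_weak_gradient \<Omega> (\<lambda>x. 0) (\<lambda>x. g x - h x)" by simp
  have "AE x in lebesgue_on \<Omega>. (g x - h x) \<bullet> i = 0" if i: "i \<in> Basis" for i
  proof (rule AE_eq_0_if_test_integrals_eq_0[OF assms(1)])
    show "set_integrable lebesgue K (\<lambda>x. (g x - h x) \<bullet> i)" if "compact K" "K \<subseteq> \<Omega>" for K
      using d that integrable_inner_left[of i lebesgue "\<lambda>x. indicator K x *\<^sub>R (g x - h x)"]
      by (auto simp: is_weak_gradient_def set_integrable_def)
    show "(LINT x:\<Omega>|lebesgue. ((g x - h x) \<bullet> i) * \<phi> x) = 0" if "\<phi> \<in> test_functions \<Omega>" for \<phi>
      using d that i by (force simp: is_weak_gradient_def set_lebesgue_integral_def)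
  qed
  then have "AE x in lebesgue_on \<Omega>. \<forall>i\<in>Basis. (g x - h x) \<bullet> i = 0"
    by (simp add: AE_ball_countable countable_finite)
  then show ?thesis
    by (auto elim!: eventually_mono simp: euclidean_eq_iff[of "g _"] inner_diff_left)
qed

lemma weak_gradient_AE_eq:
  assumes "open \<Omega>" "is_weak_gradient \<Omega> u g"
  shows "AE x in lebesgue_on \<Omega>. weak_gradient \<Omega> u x = g x"
  using is_weak_gradient_unique[OF assms(1) _ assms(2)] someI[of "is_weak_gradient \<Omega> u", OF assms(2)]
  unfolding weak_gradient_def by blast

section \<open>A subcritical Sobolev inequality\<close>

lemma nn_integral_lborel_translate:
  fixes g :: "'a::euclidean_space \<Rightarrow> ennreal"
  assumes [measurable]: "g \<in> borel_measurable borel"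
  shows "(\<integral>\<^sup>+x. g (x + w) \<partial>lborel) = (\<integral>\<^sup>+x. g x \<partial>lborel)"
proof -
  have "(\<integral>\<^sup>+x. g x \<partial>lborel) = (\<integral>\<^sup>+x. g x \<partial>distr lborel borel ((+) w))"
    unfolding lborel_distr_plus ..
  also have "\<dots> = (\<integral>\<^sup>+x. g (w + x) \<partial>lborel)"
    by (rule nn_integral_distr) auto
  finally show ?thesis by (simp add: add.commute)
qed

text \<open>
  The cube at \<open>x\<close> of side \<open>\<tau>\<close> has volume \<open>\<tau>\<^sup>N\<close>: averaging over it costs \<open>\<tau> powr (- N)\<close>.
\<close>

lemma nn_integral_unit_cube_scaled_le:
  fixes g :: "'a::euclidean_space \<Rightarrow> ennreal"
  assumes [measurable]: "g \<in> borel_measurable borel" and "\<tau> > 0"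
  shows "(\<integral>\<^sup>+z. g (x + \<tau> *\<^sub>R z) * indicator (cbox 0 One) z \<partial>lborel)
      \<le> ennreal (\<tau> powr - real DIM('a)) * (\<integral>\<^sup>+y. g y \<partial>lborel)"
proof -
  have p: "\<tau> powr - real DIM('a) * \<tau> ^ DIM('a) = 1"
    using assms(2) by (simp add: powr_minus powr_realpow)
  have "(\<integral>\<^sup>+y. g y \<partial>lborel) = (\<integral>\<^sup>+y. g y \<partial>density (distr lborel borel (\<lambda>z. x + \<tau> *\<^sub>R z)) (\<lambda>_. \<bar>\<tau>\<bar> ^ DIM('a)))"
    using lborel_affine[of \<tau> x] assms(2) by simp
  also have "\<dots> = (\<integral>\<^sup>+y. ennreal (\<tau> ^ DIM('a)) * g y \<partial>distr lborel borel (\<lambda>z. x + \<tau> *\<^sub>R z))"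
    using assms(2) by (subst nn_integral_density) (auto simp: ennreal_power)
  also have "\<dots> = ennreal (\<tau> ^ DIM('a)) * (\<integral>\<^sup>+z. g (x + \<tau> *\<^sub>R z) \<partial>lborel)"
    by (subst nn_integral_distr) (auto simp: nn_integral_cmult)
  finally have "ennreal (\<tau> powr - real DIM('a)) * (\<integral>\<^sup>+y. g y \<partial>lborel) =
      ennreal (\<tau> powr - real DIM('a) * \<tau> ^ DIM('a)) * (\<integral>\<^sup>+z. g (x + \<tau> *\<^sub>R z) \<partial>lborel)"
    using assms(2) by (simp add: ennreal_mult mult.assoc)
  then have eq: "ennreal (\<tau> powr - real DIM('a)) * (\<integral>\<^sup>+y. g y \<partial>lborel) = (\<integral>\<^sup>+z. g (x + \<tau> *\<^sub>R z) \<partial>lborel)"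
    unfolding p by simp
  show ?thesis
    unfolding eq by (intro nn_integral_mono) (auto simp: indicator_def)
qed

lemma emeasure_unit_cube: "emeasure lborel (cbox 0 (One :: 'a::euclidean_space)) = 1"
  by (simp add: emeasure_lborel_cbox_eq)

lemma norm_le_DIM_if_unit_cube:
  fixes z :: "'a::euclidean_space"
  assumes "z \<in> cbox 0 One"
  shows "norm z \<le> real DIM('a)"
proof -
  have "norm z \<le> (\<Sum>i\<in>Basis. \<bar>z \<bullet> i\<bar>)" by (rule norm_le_l1)
  also have "\<dots> \<le> (\<Sum>i\<in>(Basis :: 'a set). 1)"
    using assms by (intro sum_mono) (auto simp: mem_box)
  finally show ?thesis by simp
qed

text \<open>
  Up to constants this is a Riesz potential of order one, truncated to distances between \<open>a\<close> and \<open>b\<close>.  The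
  directions \<open>z\<close> range over a cube of volume \<open>1\<close>, so that averages need no normalization.
\<close>

definition segment_potential :: "real \<Rightarrow> real \<Rightarrow> ('a::euclidean_space \<Rightarrow> ennreal) \<Rightarrow> 'a \<Rightarrow> ennreal" where
  "segment_potential a b g x = (\<integral>\<^sup>+z. (\<integral>\<^sup>+\<tau>. g (x + \<tau> *\<^sub>R z) * indicator {a..b} \<tau> \<partial>lborel)
     * indicator (cbox 0 One) z \<partial>lborel)"

lemma measurable_segment_potential [measurable]:
  fixes g :: "'a::euclidean_space \<Rightarrow> ennreal"
  assumes [measurable]: "g \<in> borel_measurable borel"
  shows "segment_potential a b g \<in> borel_measurable borel"
  unfolding segment_potential_def[abs_def] by measurable

lemma segment_potential_swap:
  fixes g :: "'a::euclidean_space \<Rightarrow> ennreal"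
  assumes [measurable]: "g \<in> borel_measurable borel"
  shows "segment_potential a b g x =
    (\<integral>\<^sup>+\<tau>. (\<integral>\<^sup>+z. g (x + \<tau> *\<^sub>R z) * indicator (cbox 0 One) z \<partial>lborel) * indicator {a..b} \<tau> \<partial>lborel)"
proof -
  have "segment_potential a b g x =
      (\<integral>\<^sup>+z. (\<integral>\<^sup>+\<tau>. g (x + \<tau> *\<^sub>R z) * indicator {a..b} \<tau> * indicator (cbox 0 One) z \<partial>lborel) \<partial>lborel)"
    unfolding segment_potential_def by (simp add: nn_integral_multc)
  also have "\<dots> = (\<integral>\<^sup>+\<tau>. (\<integral>\<^sup>+z. g (x + \<tau> *\<^sub>R z) * indicator {a..b} \<tau> * indicator (cbox 0 One) z \<partial>lborel) \<partial>lborel)"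
    by (rule lborel_pair.Fubini') measurable
  also have "\<dots> = (\<integral>\<^sup>+\<tau>. (\<integral>\<^sup>+z. (g (x + \<tau> *\<^sub>R z) * indicator (cbox 0 One) z) * indicator {a..b} \<tau> \<partial>lborel) \<partial>lborel)"
    by (simp add: mult_ac)
  finally show ?thesis by (simp add: nn_integral_multc)
qed

lemma nn_integral_segment_potential:
  fixes g :: "'a::euclidean_space \<Rightarrow> ennreal"
  assumes [measurable]: "g \<in> borel_measurable borel" and "a \<le> b"
  shows "(\<integral>\<^sup>+x. segment_potential a b g x \<partial>lborel) = ennreal (b - a) * (\<integral>\<^sup>+y. g y \<partial>lborel)"
proof -
  have "(\<integral>\<^sup>+x. segment_potential a b g x \<partial>lborel) =
      (\<integral>\<^sup>+z. (\<integral>\<^sup>+x. (\<integral>\<^sup>+\<tau>. g (x + \<tau> *\<^sub>R z) * indicator {a..b} \<tau> \<partial>lborel) * indicator (cbox 0 One) z \<partial>lborel) \<partial>lborel)"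
    unfolding segment_potential_def by (rule lborel_pair.Fubini') measurable
  also have "\<dots> = (\<integral>\<^sup>+z. (\<integral>\<^sup>+x. (\<integral>\<^sup>+\<tau>. g (x + \<tau> *\<^sub>R z) * indicator {a..b} \<tau> \<partial>lborel) \<partial>lborel) * indicator (cbox 0 One) z \<partial>lborel)"
    by (simp add: nn_integral_multc)
  also have "\<dots> = (\<integral>\<^sup>+z. (ennreal (b - a) * (\<integral>\<^sup>+y. g y \<partial>lborel)) * indicator (cbox 0 (One::'a)) z \<partial>lborel)"
  proof (rule nn_integral_cong)
    fix z :: 'a
    have "(\<integral>\<^sup>+x. (\<integral>\<^sup>+\<tau>. g (x + \<tau> *\<^sub>R z) * indicator {a..b} \<tau> \<partial>lborel) \<partial>lborel) =
        (\<integral>\<^sup>+\<tau>. (\<integral>\<^sup>+x. g (x + \<tau> *\<^sub>R z) * indicator {a..b} \<tau> \<partial>lborel) \<partial>lborel)"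
      by (rule lborel_pair.Fubini') measurable
    also have "\<dots> = (\<integral>\<^sup>+\<tau>. (\<integral>\<^sup>+y. g y \<partial>lborel) * indicator {a..b} \<tau> \<partial>lborel)"
      by (simp add: nn_integral_multc nn_integral_lborel_translate)
    also have "\<dots> = ennreal (b - a) * (\<integral>\<^sup>+y. g y \<partial>lborel)"
      using assms(2) by (simp add: nn_integral_cmult_indicator mult.commute)
    finally show "(\<integral>\<^sup>+x. (\<integral>\<^sup>+\<tau>. g (x + \<tau> *\<^sub>R z) * indicator {a..b} \<tau> \<partial>lborel) \<partial>lborel) * indicator (cbox 0 One) z
       = (ennreal (b - a) * (\<integral>\<^sup>+y. g y \<partial>lborel)) * indicator (cbox 0 One) z"
      by simp
  qed
  also have "\<dots> = ennreal (b - a) * (\<integral>\<^sup>+y. g y \<partial>lborel)"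
    by (subst nn_integral_cmult_indicator) (auto simp: emeasure_unit_cube)
  finally show ?thesis .
qed

lemma abs_diff_le_segment_integral:
  fixes u :: "'a::euclidean_space \<Rightarrow> real"
  assumes deriv: "\<And>x. (u has_derivative (\<lambda>v. D x \<bullet> v)) (at x)"
    and cont: "continuous_on UNIV D" and "a \<le> b"
  shows "ennreal \<bar>u (x + b *\<^sub>R z) - u (x + a *\<^sub>R z)\<bar>
     \<le> ennreal (norm z) * (\<integral>\<^sup>+\<tau>. ennreal (norm (D (x + \<tau> *\<^sub>R z))) * indicator {a..b} \<tau> \<partial>lborel)"
proof -
  have contD: "continuous_on A (\<lambda>\<tau>. D (x + \<tau> *\<^sub>R z))" for A
    by (intro continuous_on_compose2[OF cont] continuous_intros) auto
  have line: "((\<lambda>\<tau>. u (x + \<tau> *\<^sub>R z)) has_vector_derivative (D (x + \<tau> *\<^sub>R z) \<bullet> z)) (at \<tau> within A)" for \<tau> A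
  proof -
    have "((\<lambda>\<tau>. u (x + \<tau> *\<^sub>R z)) has_derivative (\<lambda>s. D (x + \<tau> *\<^sub>R z) \<bullet> (s *\<^sub>R z))) (at \<tau> within A)"
      by (rule has_derivative_compose[where g = u, OF _ deriv]) (auto intro!: derivative_eq_intros)
    then show ?thesis by (simp add: has_vector_derivative_def)
  qed
  have int: "((\<lambda>\<tau>. D (x + \<tau> *\<^sub>R z) \<bullet> z) has_integral (u (x + b *\<^sub>R z) - u (x + a *\<^sub>R z))) {a..b}"
    by (rule fundamental_theorem_of_calculus[OF \<open>a \<le> b\<close>]) (rule line)
  have "(\<lambda>\<tau>. norm z * norm (D (x + \<tau> *\<^sub>R z))) integrable_on {a..b}"
    by (intro integrable_continuous_real continuous_intros contD)
  then obtain I where I: "((\<lambda>\<tau>. norm z * norm (D (x + \<tau> *\<^sub>R z))) has_integral I) {a..b}"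
    by blast
  have "\<bar>D (x + \<tau> *\<^sub>R z) \<bullet> z\<bar> \<le> norm z * norm (D (x + \<tau> *\<^sub>R z))" for \<tau>
    using Cauchy_Schwarz_ineq2[of "D (x + \<tau> *\<^sub>R z)" z] by (simp add: mult.commute)
  then have "\<bar>u (x + b *\<^sub>R z) - u (x + a *\<^sub>R z)\<bar> \<le> I"
    using integral_norm_bound_integral[of "\<lambda>\<tau>. D (x + \<tau> *\<^sub>R z) \<bullet> z" "{a..b}" "\<lambda>\<tau>. norm z * norm (D (x + \<tau> *\<^sub>R z))"]
      int I by (auto simp: has_integral_iff)
  then have "ennreal \<bar>u (x + b *\<^sub>R z) - u (x + a *\<^sub>R z)\<bar> \<le> ennreal I"
    by (rule ennreal_leI)
  also have "\<dots> = (\<integral>\<^sup>+\<tau>. ennreal (norm z * norm (D (x + \<tau> *\<^sub>R z))) * indicator {a..b} \<tau> \<partial>lborel)"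
    by (rule nn_integral_has_integral_lebesgue'[OF _ I, symmetric]) simp
  also have "\<dots> = ennreal (norm z) * (\<integral>\<^sup>+\<tau>. ennreal (norm (D (x + \<tau> *\<^sub>R z))) * indicator {a..b} \<tau> \<partial>lborel)"
  proof -
    have [measurable]: "(\<lambda>\<tau>. norm (D (x + \<tau> *\<^sub>R z))) \<in> borel_measurable borel"
      by (intro borel_measurable_continuous_onI continuous_intros contD)
    show ?thesis
      by (simp add: ennreal_mult mult.assoc nn_integral_cmult)
  qed
  finally show ?thesis .
qed

text \<open>
  The fundamental theorem of calculus on each segment from \<open>x\<close> into the cube of side \<open>b\<close> at \<open>x\<close>; a vector in the
  unit cube has norm at most \<open>N\<close>.
\<close>

lemma nn_integral_increment_le_segment_potential:
  fixes u :: "'a::euclidean_space \<Rightarrow> real"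
  assumes deriv: "\<And>x. (u has_derivative (\<lambda>v. D x \<bullet> v)) (at x)"
    and cont: "continuous_on UNIV D" and "0 \<le> b"
  shows "(\<integral>\<^sup>+z. ennreal \<bar>u (x + b *\<^sub>R z) - u x\<bar> * indicator (cbox 0 One) z \<partial>lborel)
    \<le> ennreal (real DIM('a)) * segment_potential 0 b (\<lambda>y. ennreal (norm (D y))) x"
proof -
  have [measurable]: "D \<in> borel_measurable borel"
    by (rule borel_measurable_continuous_onI[OF cont])
  have "(\<integral>\<^sup>+z. ennreal \<bar>u (x + b *\<^sub>R z) - u x\<bar> * indicator (cbox 0 One) z \<partial>lborel) \<le>
    (\<integral>\<^sup>+z. ennreal (real DIM('a)) * ((\<integral>\<^sup>+\<tau>. ennreal (norm (D (x + \<tau> *\<^sub>R z))) * indicator {0..b} \<tau> \<partial>lborel)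
       * indicator (cbox 0 One) z) \<partial>lborel)"
  proof (rule nn_integral_mono)
    fix z :: 'a
    have "ennreal \<bar>u (x + b *\<^sub>R z) - u x\<bar> \<le> ennreal (real DIM('a)) *
        (\<integral>\<^sup>+\<tau>. ennreal (norm (D (x + \<tau> *\<^sub>R z))) * indicator {0..b} \<tau> \<partial>lborel)" if "z \<in> cbox 0 One"
    proof -
      have "ennreal \<bar>u (x + b *\<^sub>R z) - u x\<bar>
        \<le> ennreal (norm z) * (\<integral>\<^sup>+\<tau>. ennreal (norm (D (x + \<tau> *\<^sub>R z))) * indicator {0..b} \<tau> \<partial>lborel)"
        using abs_diff_le_segment_integral[OF deriv cont assms(3), of x z] by simp
      also have "\<dots> \<le> ennreal (real DIM('a)) * (\<integral>\<^sup>+\<tau>. ennreal (norm (D (x + \<tau> *\<^sub>R z))) * indicator {0..b} \<tau> \<partial>lborel)"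
        by (intro mult_right_mono ennreal_leI norm_le_DIM_if_unit_cube that) simp
      finally show ?thesis .
    qed
    then show "ennreal \<bar>u (x + b *\<^sub>R z) - u x\<bar> * indicator (cbox 0 One) z \<le>
      ennreal (real DIM('a)) * ((\<integral>\<^sup>+\<tau>. ennreal (norm (D (x + \<tau> *\<^sub>R z))) * indicator {0..b} \<tau> \<partial>lborel)
       * indicator (cbox 0 One) z)"
      by (auto simp: indicator_def)
  qed
  also have "\<dots> = ennreal (real DIM('a)) * segment_potential 0 b (\<lambda>y. ennreal (norm (D y))) x"
    unfolding segment_potential_def by (rule nn_integral_cmult) measurable
  finally show ?thesis .
qed

lemma abs_le_average_plus_segment_potential:
  fixes u :: "'a::euclidean_space \<Rightarrow> real"
  assumes deriv: "\<And>x. (u has_derivative (\<lambda>v. D x \<bullet> v)) (at x)"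
    and cont: "continuous_on UNIV D" and "0 < b"
    and B: "(\<integral>\<^sup>+y. ennreal \<bar>u y\<bar> \<partial>lborel) \<le> ennreal B" "0 \<le> B"
  shows "ennreal \<bar>u x\<bar> \<le> ennreal (b powr - real DIM('a) * B) +
     ennreal (real DIM('a)) * segment_potential 0 b (\<lambda>y. ennreal (norm (D y))) x"
proof -
  have "continuous_on UNIV u"
    by (intro continuous_at_imp_continuous_on ballI has_derivative_continuous[OF deriv])
  then have [measurable]: "u \<in> borel_measurable borel"
    by (rule borel_measurable_continuous_onI)
  have "ennreal \<bar>u x\<bar> = (\<integral>\<^sup>+z. ennreal \<bar>u x\<bar> * indicator (cbox 0 (One::'a)) z \<partial>lborel)"
    by (subst nn_integral_cmult_indicator) (auto simp: emeasure_unit_cube)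
  also have "\<dots> \<le> (\<integral>\<^sup>+z. ennreal \<bar>u (x + b *\<^sub>R z)\<bar> * indicator (cbox 0 One) z +
      ennreal \<bar>u (x + b *\<^sub>R z) - u x\<bar> * indicator (cbox 0 One) z \<partial>lborel)"
    by (intro nn_integral_mono) (auto simp: indicator_def ennreal_plus[symmetric] simp del: ennreal_plus intro!: ennreal_leI)
  also have "\<dots> = (\<integral>\<^sup>+z. ennreal \<bar>u (x + b *\<^sub>R z)\<bar> * indicator (cbox 0 One) z \<partial>lborel) +
      (\<integral>\<^sup>+z. ennreal \<bar>u (x + b *\<^sub>R z) - u x\<bar> * indicator (cbox 0 One) z \<partial>lborel)"
    by (rule nn_integral_add) measurable
  also have "\<dots> \<le> ennreal (b powr - real DIM('a) * B) +
     ennreal (real DIM('a)) * segment_potential 0 b (\<lambda>y. ennreal (norm (D y))) x"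
  proof (rule add_mono)
    have "(\<integral>\<^sup>+z. ennreal \<bar>u (x + b *\<^sub>R z)\<bar> * indicator (cbox 0 One) z \<partial>lborel)
        \<le> ennreal (b powr - real DIM('a)) * (\<integral>\<^sup>+y. ennreal \<bar>u y\<bar> \<partial>lborel)"
      by (rule nn_integral_unit_cube_scaled_le[OF _ assms(3)]) measurable
    also have "\<dots> \<le> ennreal (b powr - real DIM('a)) * ennreal B"
      by (intro mult_left_mono B(1)) simp
    finally show "(\<integral>\<^sup>+z. ennreal \<bar>u (x + b *\<^sub>R z)\<bar> * indicator (cbox 0 One) z \<partial>lborel)
        \<le> ennreal (b powr - real DIM('a) * B)"
      using B(2) by (simp add: ennreal_mult)
  qed (rule nn_integral_increment_le_segment_potential[OF deriv cont], use assms(3) in simp)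
  finally show ?thesis .
qed

text \<open>
  A threshold \<open>b\<close> trades a first power for an \<open>r\<close>-th power.  With a good choice of \<open>b\<close> this pointwise
  inequality does the work of the Hoelder inequality.
\<close>

lemma le_add_powr_mult_powr:
  fixes a b r :: real
  assumes "0 \<le> a" "0 < b" "1 \<le> r"
  shows "a \<le> b + b powr (1 - r) * a powr r"
proof (cases "a \<le> b")
  case True
  then show ?thesis by (simp add: add_increasing2)
next
  case False
  then have "a = a powr (1 - r) * a powr r"
    using assms by (simp add: powr_add[symmetric])
  also have "\<dots> \<le> b powr (1 - r) * a powr r"
    using False assms by (intro mult_right_mono powr_mono2') auto
  finally show ?thesis using assms by simp
qed

lemma powr_le_1_add_powr:
  fixes a r s :: real
  assumes "0 \<le> a" "0 < r" "r \<le> s"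
  shows "a powr r \<le> 1 + a powr s"
proof (cases "a \<le> 1")
  case True
  then have "a powr r \<le> 1" using assms by (intro powr_le1) auto
  then show ?thesis by (simp add: add_increasing2)
next
  case False
  then have "a powr r \<le> a powr s" using assms by (intro powr_mono) auto
  then show ?thesis by simp
qed

lemma segment_potential_affine:
  fixes g :: "'a::euclidean_space \<Rightarrow> ennreal"
  assumes [measurable]: "g \<in> borel_measurable borel" and "a \<le> b"
  shows "segment_potential a b (\<lambda>y. c + d * g y) x = ennreal (b - a) * c + d * segment_potential a b g x"
proof -
  have "segment_potential a b (\<lambda>y. c + d * g y) x =
      (\<integral>\<^sup>+z. ((\<integral>\<^sup>+\<tau>. c * indicator {a..b} \<tau> + d * (g (x + \<tau> *\<^sub>R z) * indicator {a..b} \<tau>) \<partial>lborel))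
         * indicator (cbox 0 One) z \<partial>lborel)"
    unfolding segment_potential_def
    by (intro nn_integral_cong arg_cong2[where f = "(*)"] refl) (auto simp: indicator_def)
  also have "\<dots> = (\<integral>\<^sup>+z. (ennreal (b - a) * c) * indicator (cbox 0 (One::'a)) z +
      d * ((\<integral>\<^sup>+\<tau>. g (x + \<tau> *\<^sub>R z) * indicator {a..b} \<tau> \<partial>lborel) * indicator (cbox 0 One) z) \<partial>lborel)"
    using assms(2)
    by (intro nn_integral_cong)
       (simp add: nn_integral_add nn_integral_cmult nn_integral_cmult_indicator distrib_left distrib_right mult_ac)
  also have "\<dots> = (\<integral>\<^sup>+z. (ennreal (b - a) * c) * indicator (cbox 0 (One::'a)) z \<partial>lborel) +
      (\<integral>\<^sup>+z. d * ((\<integral>\<^sup>+\<tau>. g (x + \<tau> *\<^sub>R z) * indicator {a..b} \<tau> \<partial>lborel) * indicator (cbox 0 One) z) \<partial>lborel)"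
    by (rule nn_integral_add) measurable
  also have "\<dots> = ennreal (b - a) * c + d * segment_potential a b g x"
    unfolding segment_potential_def
    by (subst nn_integral_cmult_indicator) (auto simp: emeasure_unit_cube nn_integral_cmult)
  finally show ?thesis .
qed

lemma segment_potential_mono:
  assumes "\<And>\<tau> z. \<tau> \<in> {a..b} \<Longrightarrow> z \<in> cbox 0 One \<Longrightarrow> g (x + \<tau> *\<^sub>R z) \<le> h (x + \<tau> *\<^sub>R z)"
  shows "segment_potential a b g x \<le> segment_potential a b h x"
  unfolding segment_potential_def
proof (rule nn_integral_mono)
  fix z
  have "(\<integral>\<^sup>+\<tau>. g (x + \<tau> *\<^sub>R z) * indicator {a..b} \<tau> \<partial>lborel) \<le> (\<integral>\<^sup>+\<tau>. h (x + \<tau> *\<^sub>R z) * indicator {a..b} \<tau> \<partial>lborel)"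
    if "z \<in> cbox 0 One"
    using assms that by (intro nn_integral_mono) (auto simp: indicator_def)
  then show "(\<integral>\<^sup>+\<tau>. g (x + \<tau> *\<^sub>R z) * indicator {a..b} \<tau> \<partial>lborel) * indicator (cbox 0 One) z
      \<le> (\<integral>\<^sup>+\<tau>. h (x + \<tau> *\<^sub>R z) * indicator {a..b} \<tau> \<partial>lborel) * indicator (cbox 0 One) z"
    by (auto simp: indicator_def)
qed

lemma segment_potential_split:
  fixes g :: "'a::euclidean_space \<Rightarrow> ennreal"
  assumes [measurable]: "g \<in> borel_measurable borel" and "a \<le> c" "c \<le> b"
  shows "segment_potential a b g x \<le> segment_potential a c g x + segment_potential c b g x"
proof -
  have "segment_potential a b g x \<le> (\<integral>\<^sup>+z. (\<integral>\<^sup>+\<tau>. g (x + \<tau> *\<^sub>R z) * indicator {a..c} \<tau>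
        + g (x + \<tau> *\<^sub>R z) * indicator {c..b} \<tau> \<partial>lborel) * indicator (cbox 0 One) z \<partial>lborel)"
    unfolding segment_potential_def
    by (intro nn_integral_mono mult_right_mono) (auto simp: indicator_def)
  also have "\<dots> = segment_potential a c g x + segment_potential c b g x"
    unfolding segment_potential_def by (simp add: nn_integral_add distrib_right)
  finally show ?thesis .
qed

context
  fixes g :: "'a::euclidean_space \<Rightarrow> real" and r \<Gamma> \<alpha> :: real
  assumes g_meas [measurable]: "g \<in> borel_measurable borel" and g_nonneg: "\<And>y. 0 \<le> g y"
    and r: "1 \<le> r" "r < real DIM('a)"
    and \<Gamma>: "(\<integral>\<^sup>+y. ennreal (g y powr r) \<partial>lborel) \<le> ennreal \<Gamma>" "0 \<le> \<Gamma>"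
  defines "\<alpha> \<equiv> real DIM('a) / r - 1"
begin

lemma decay_exponent_pos: "0 < \<alpha>"
  using r by (simp add: \<alpha>_def field_simps)

text \<open>
  Far from its base point the potential is bounded: at distance \<open>\<tau>\<close> the threshold
  \<open>\<tau> powr (- N / r)\<close> balances the two terms that replace \<open>g\<close>, and its integral over
  \<open>\<tau> \<ge> h\<close> is of order \<open>h powr (1 - N / r)\<close> because \<open>r < N\<close>.
\<close>

lemma segment_potential_far_le:
  assumes "0 < h" "h \<le> b"
  shows "segment_potential h b (\<lambda>y. ennreal (g y)) x \<le> ennreal ((1 + \<Gamma>) / \<alpha> * h powr - \<alpha>)"
proof -
  have inner: "(\<integral>\<^sup>+z. ennreal (g (x + \<tau> *\<^sub>R z)) * indicator (cbox 0 One) z \<partial>lborel)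
     \<le> ennreal ((1 + \<Gamma>) * \<tau> powr (- \<alpha> - 1))" if "\<tau> > 0" for \<tau>
  proof -
    define \<beta> where "\<beta> = \<tau> powr (- \<alpha> - 1)"
    have \<beta>: "\<beta> > 0" using that by (simp add: \<beta>_def)
    have balance: "\<beta> powr (1 - r) * \<tau> powr - real DIM('a) = \<beta>"
      using r by (simp add: \<beta>_def \<alpha>_def powr_powr powr_add[symmetric] field_simps)
    have "(\<integral>\<^sup>+z. ennreal (g (x + \<tau> *\<^sub>R z)) * indicator (cbox 0 One) z \<partial>lborel) \<le>
        (\<integral>\<^sup>+z. ennreal \<beta> * indicator (cbox 0 (One::'a)) z +
          ennreal (\<beta> powr (1 - r)) * (ennreal (g (x + \<tau> *\<^sub>R z) powr r) * indicator (cbox 0 One) z) \<partial>lborel)"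
    proof (rule nn_integral_mono)
      fix z :: 'a
      have "ennreal (g (x + \<tau> *\<^sub>R z)) \<le> ennreal (\<beta> + \<beta> powr (1 - r) * g (x + \<tau> *\<^sub>R z) powr r)"
        by (intro ennreal_leI le_add_powr_mult_powr g_nonneg \<beta> r)
      also have "\<dots> = ennreal \<beta> + ennreal (\<beta> powr (1 - r)) * ennreal (g (x + \<tau> *\<^sub>R z) powr r)"
        using \<beta> by (subst ennreal_plus) (auto simp: ennreal_mult)
      finally show "ennreal (g (x + \<tau> *\<^sub>R z)) * indicator (cbox 0 One) z \<le> ennreal \<beta> * indicator (cbox 0 One) z +
          ennreal (\<beta> powr (1 - r)) * (ennreal (g (x + \<tau> *\<^sub>R z) powr r) * indicator (cbox 0 One) z)"
        by (auto simp: indicator_def)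
    qed
    also have "\<dots> = ennreal \<beta> + ennreal (\<beta> powr (1 - r)) *
        (\<integral>\<^sup>+z. ennreal (g (x + \<tau> *\<^sub>R z) powr r) * indicator (cbox 0 One) z \<partial>lborel)"
      by (simp add: nn_integral_add nn_integral_cmult nn_integral_cmult_indicator emeasure_unit_cube)
    also have "\<dots> \<le> ennreal \<beta> + ennreal (\<beta> powr (1 - r)) * (ennreal (\<tau> powr - real DIM('a)) * ennreal \<Gamma>)"
      by (intro add_left_mono mult_left_mono order_trans[OF nn_integral_unit_cube_scaled_le[OF _ that]] \<Gamma>(1)) auto
    also have "\<dots> = ennreal (\<beta> + \<beta> powr (1 - r) * \<tau> powr - real DIM('a) * \<Gamma>)"
      using \<beta> \<Gamma>(2) by (simp add: ennreal_mult ennreal_plus mult.assoc)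
    also have "\<dots> = ennreal ((1 + \<Gamma>) * \<beta>)"
      unfolding balance by (simp add: algebra_simps)
    finally show ?thesis unfolding \<beta>_def .
  qed
  have "segment_potential h b (\<lambda>y. ennreal (g y)) x \<le>
      (\<integral>\<^sup>+\<tau>. ennreal ((1 + \<Gamma>) * \<tau> powr (- \<alpha> - 1)) * indicator {h..b} \<tau> \<partial>lborel)"
    unfolding segment_potential_swap[OF measurable_compose[OF g_meas measurable_ennreal]]
    using inner assms by (intro nn_integral_mono) (auto simp: indicator_def)
  also have "\<dots> = ennreal (- ((1 + \<Gamma>) / \<alpha> * b powr - \<alpha>) - - ((1 + \<Gamma>) / \<alpha> * h powr - \<alpha>))"
  proof (rule nn_integral_FTC_Icc)
    fix \<tau> assume "\<tau> \<in> {h..b}"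
    then have "\<tau> > 0" using assms by auto
    then show "((\<lambda>\<tau>. - ((1 + \<Gamma>) / \<alpha> * \<tau> powr - \<alpha>)) has_real_derivative (1 + \<Gamma>) * \<tau> powr (- \<alpha> - 1)) (at \<tau>)"
      using decay_exponent_pos by (auto intro!: derivative_eq_intros)
    show "0 \<le> (1 + \<Gamma>) * \<tau> powr (- \<alpha> - 1)" using \<Gamma>(2) by simp
  qed (use assms in auto)
  also have "\<dots> \<le> ennreal ((1 + \<Gamma>) / \<alpha> * h powr - \<alpha>)"
    using \<Gamma>(2) decay_exponent_pos by (intro ennreal_leI) simp
  finally show ?thesis .
qed

text \<open>
  Near the base point the constant threshold \<open>h powr (- N / r)\<close> is used; what remains is the potential
  of \<open>g powr r\<close>, whose integral over \<open>x\<close> is \<open>h\<close> times that of \<open>g powr r\<close>.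
\<close>

lemma segment_potential_near_le:
  assumes "0 < h"
  shows "segment_potential 0 h (\<lambda>y. ennreal (g y)) x \<le> ennreal (h powr - \<alpha>) +
    ennreal (h powr (real DIM('a) - 1 - \<alpha>)) * segment_potential 0 h (\<lambda>y. ennreal (g y powr r)) x"
proof -
  define \<beta> where "\<beta> = h powr (- \<alpha> - 1)"
  have \<beta>: "\<beta> > 0" using assms by (simp add: \<beta>_def)
  have "(- \<alpha> - 1) * (1 - r) = real DIM('a) - 1 - \<alpha>"
    using r by (simp add: \<alpha>_def field_simps)
  then have e: "\<beta> powr (1 - r) = h powr (real DIM('a) - 1 - \<alpha>)"
    by (simp only: \<beta>_def powr_powr)
  have "h * \<beta> = h powr 1 * h powr (- \<alpha> - 1)" using assms by (simp add: \<beta>_def)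
  also have "\<dots> = h powr - \<alpha>" unfolding powr_add[symmetric] by simp
  finally have e': "h * \<beta> = h powr - \<alpha>" .
  have "segment_potential 0 h (\<lambda>y. ennreal (g y)) x \<le>
     segment_potential 0 h (\<lambda>y. ennreal \<beta> + ennreal (\<beta> powr (1 - r)) * ennreal (g y powr r)) x"
  proof (rule segment_potential_mono)
    fix \<tau> z
    show "ennreal (g (x + \<tau> *\<^sub>R z)) \<le> ennreal \<beta> + ennreal (\<beta> powr (1 - r)) * ennreal (g (x + \<tau> *\<^sub>R z) powr r)"
      using \<beta> ennreal_leI[OF le_add_powr_mult_powr[OF g_nonneg \<beta> r(1), of "x + \<tau> *\<^sub>R z"]]
      by (subst (asm) ennreal_plus) (auto simp: ennreal_mult)
  qed
  also have "\<dots> = ennreal (h powr - \<alpha>) +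
     ennreal (h powr (real DIM('a) - 1 - \<alpha>)) * segment_potential 0 h (\<lambda>y. ennreal (g y powr r)) x"
    using assms \<beta> by (subst segment_potential_affine) (auto simp: e e'[symmetric] ennreal_mult)
  finally show ?thesis .
qed

text \<open>
  The weak-type bound at the critical exponent: writing \<open>\<lambda>\<close> for the level, the right-hand side is
  a multiple of \<open>\<lambda> powr (- N r / (N - r))\<close>.  The far part of the potential stays
  below half the level, hence the near part, whose \<open>L\<^sup>1\<close> norm is small, has to exceed the other half.
\<close>

lemma superlevel_set_bound:
  fixes u :: "'a \<Rightarrow> real"
  defines "N \<equiv> real DIM('a)"
  assumes deriv: "\<And>x. (u has_derivative (\<lambda>v. D x \<bullet> v)) (at x)"
    and cont: "continuous_on UNIV D"
    and B: "(\<integral>\<^sup>+y. ennreal \<bar>u y\<bar> \<partial>lborel) \<le> ennreal B" "0 \<le> B"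
    and E: "E \<in> sets borel"
    and dom: "\<And>x \<tau> z. x \<in> E \<Longrightarrow> \<tau> \<in> {0..b} \<Longrightarrow> z \<in> cbox 0 One \<Longrightarrow> norm (D (x + \<tau> *\<^sub>R z)) \<le> g (x + \<tau> *\<^sub>R z)"
    and h: "0 < h" "h \<le> b"
    and A_def: "A = b powr (\<alpha> - N) * B + N * ((1 + \<Gamma>) / \<alpha> + 1)"
  shows "emeasure lborel {x \<in> E. 2 * A * h powr - \<alpha> < \<bar>u x\<bar>} \<le> ennreal (N * \<Gamma> / A * h powr N)"
proof -
  let ?R = "segment_potential 0 h (\<lambda>y. ennreal (g y powr r))"
  have N: "N > 0" by (simp add: N_def)
  have A: "A > 0"
    unfolding A_def using B(2) \<Gamma>(2) decay_exponent_pos N by (intro add_nonneg_pos mult_pos_pos) auto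
  have "continuous_on UNIV u"
    by (intro continuous_at_imp_continuous_on ballI has_derivative_continuous[OF deriv])
  then have [measurable]: "u \<in> borel_measurable borel"
    by (rule borel_measurable_continuous_onI)
  have [measurable]: "E \<in> sets borel" by (rule E)
  define c where "c = N * h powr (N - 1) / A"
  have c: "c > 0" using N A h by (simp add: c_def)
  have bound: "ennreal \<bar>u x\<bar> \<le> ennreal (A * h powr - \<alpha>) + ennreal (A * h powr - \<alpha>) * (ennreal c * ?R x)" if "x \<in> E" for x
  proof -
    have "ennreal \<bar>u x\<bar> \<le> ennreal (b powr - N * B) + ennreal N * segment_potential 0 b (\<lambda>y. ennreal (norm (D y))) x"
      using abs_le_average_plus_segment_potential[OF deriv cont _ B, of b x] h by (simp add: N_def)
    also have "\<dots> \<le> ennreal (b powr - N * B) + ennreal N * segment_potential 0 b (\<lambda>y. ennreal (g y)) x"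
      by (intro add_left_mono mult_left_mono segment_potential_mono ennreal_leI dom that) auto
    also have "\<dots> \<le> ennreal (b powr - N * B) + ennreal N *
        (segment_potential 0 h (\<lambda>y. ennreal (g y)) x + segment_potential h b (\<lambda>y. ennreal (g y)) x)"
      using h by (intro add_left_mono mult_left_mono segment_potential_split) auto
    also have "\<dots> \<le> ennreal (b powr - N * B) + ennreal N *
        ((ennreal (h powr - \<alpha>) + ennreal (h powr (N - 1 - \<alpha>)) * ?R x) + ennreal ((1 + \<Gamma>) / \<alpha> * h powr - \<alpha>))"
      unfolding N_def by (intro add_left_mono mult_left_mono add_mono segment_potential_near_le segment_potential_far_le h) auto
    also have "\<dots> = ennreal (b powr - N * B + N * (((1 + \<Gamma>) / \<alpha> + 1) * h powr - \<alpha>)) + ennreal (N * h powr (N - 1 - \<alpha>)) * ?R x"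
    proof -
      have "ennreal (b powr - N * B + N * (((1 + \<Gamma>) / \<alpha> + 1) * h powr - \<alpha>)) =
         ennreal (b powr - N * B) + ennreal N * (ennreal (h powr - \<alpha>) + ennreal ((1 + \<Gamma>) / \<alpha> * h powr - \<alpha>))"
        using B(2) N \<Gamma>(2) decay_exponent_pos
        by (simp add: ennreal_plus[symmetric] ennreal_mult[symmetric] algebra_simps del: ennreal_plus)
      then show ?thesis
        using N by (simp add: ennreal_mult algebra_simps)
    qed
    also have "\<dots> \<le> ennreal (A * h powr - \<alpha>) + ennreal (N * h powr (N - 1 - \<alpha>)) * ?R x"
    proof (intro add_right_mono ennreal_leI)
      have "b powr - N = b powr (\<alpha> - N) * b powr - \<alpha>"
        by (simp add: powr_add[symmetric])
      also have "\<dots> \<le> b powr (\<alpha> - N) * h powr - \<alpha>"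
        using h decay_exponent_pos by (intro mult_left_mono powr_mono2') auto
      finally have "b powr - N * B \<le> b powr (\<alpha> - N) * h powr - \<alpha> * B"
        using B(2) by (rule mult_right_mono)
      then show "b powr - N * B + N * (((1 + \<Gamma>) / \<alpha> + 1) * h powr - \<alpha>) \<le> A * h powr - \<alpha>"
        unfolding A_def by (simp add: algebra_simps)
    qed
    also have "N * h powr (N - 1 - \<alpha>) = (A * h powr - \<alpha>) * c"
    proof -
      have "h powr (N - 1 - \<alpha>) = h powr (N - 1) * h powr - \<alpha>" by (simp add: powr_add[symmetric])
      then show ?thesis using A by (simp add: c_def)
    qed
    finally show ?thesis
      using A c by (simp add: ennreal_mult mult.assoc)
  qed
  have "{x \<in> E. 2 * A * h powr - \<alpha> < \<bar>u x\<bar>} \<subseteq> {x \<in> E. 1 \<le> ennreal c * ?R x}"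
  proof (intro subsetI CollectI conjI; elim CollectE conjE)
    fix x assume x: "x \<in> E" and big: "2 * A * h powr - \<alpha> < \<bar>u x\<bar>"
    show "1 \<le> ennreal c * ?R x"
    proof (rule ccontr)
      assume "\<not> ?thesis"
      then have "ennreal c * ?R x \<le> 1" by simp
      have "ennreal \<bar>u x\<bar> \<le> ennreal (A * h powr - \<alpha>) + ennreal (A * h powr - \<alpha>) * 1"
        by (rule order_trans[OF bound[OF x]]) (intro add_left_mono mult_left_mono \<open>ennreal c * ?R x \<le> 1\<close>, simp)
      also have "\<dots> = ennreal (2 * A * h powr - \<alpha>)"
        using A by (simp add: ennreal_plus[symmetric] del: ennreal_plus)
      finally show False using big A by (simp add: ennreal_le_iff)
    qed
  qed
  then have "emeasure lborel {x \<in> E. 2 * A * h powr - \<alpha> < \<bar>u x\<bar>} \<le> emeasure lborel {x \<in> E. 1 \<le> ennreal c * ?R x}"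
    by (intro emeasure_mono) auto
  also have "\<dots> \<le> ennreal c * (\<integral>\<^sup>+x. ?R x * indicator E x \<partial>lborel)"
    by (rule nn_integral_Markov_inequality) auto
  also have "\<dots> \<le> ennreal c * (\<integral>\<^sup>+x. ?R x \<partial>lborel)"
    by (intro mult_left_mono nn_integral_mono) (auto simp: indicator_def)
  also have "\<dots> \<le> ennreal c * (ennreal h * ennreal \<Gamma>)"
    using h \<Gamma>(1) by (subst nn_integral_segment_potential) (auto intro!: mult_left_mono)
  also have "\<dots> = ennreal (N * \<Gamma> / A * h powr N)"
  proof -
    have "h powr N = h powr (N - 1) * h"
      using h powr_add[of h "N - 1" 1] by simp
    then have "c * (h * \<Gamma>) = N * \<Gamma> / A * h powr N" by (simp add: c_def)
    then show ?thesis using c h \<Gamma>(2) by (simp add: ennreal_mult[symmetric])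
  qed
  finally show ?thesis .
qed

end

text \<open>
  The levels \<open>\<Lambda> * (b / 2 ^ k) powr - \<alpha>\<close> grow geometrically, and the layers between them contribute
  a geometric series whose ratio is below \<open>1\<close> exactly because \<open>\<alpha> * \<sigma> < N\<close>.
\<close>

lemma nn_integral_powr_le_if_superlevel_bounds:
  fixes \<alpha> \<sigma> N \<Lambda> b C m :: real
  assumes pos: "0 < \<alpha>" "0 < \<sigma>" "0 < \<Lambda>" "0 < b" "0 \<le> C" and sub: "\<alpha> * \<sigma> < N"
  obtains M where "\<And>E (u :: 'a::euclidean_space \<Rightarrow> real). u \<in> borel_measurable borel \<Longrightarrow> E \<in> sets borel \<Longrightarrow>
    emeasure lborel E \<le> ennreal m \<Longrightarrow>
    (\<And>h. 0 < h \<Longrightarrow> h \<le> b \<Longrightarrow> emeasure lborel {x \<in> E. \<Lambda> * h powr - \<alpha> < \<bar>u x\<bar>} \<le> ennreal (C * h powr N)) \<Longrightarrow>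
    (\<integral>\<^sup>+x. ennreal (\<bar>u x\<bar> powr \<sigma>) * indicator E x \<partial>lborel) \<le> ennreal M"
proof -
  define h where "h k = b * 2 powr - real k" for k :: nat
  define lev where "lev k = \<Lambda> * h k powr - \<alpha>" for k
  define q where "q = 2 powr (\<alpha> * \<sigma> - N)"
  have h: "0 < h k" "h k \<le> b" for k
    using pos by (auto simp: h_def powr_minus field_simps ge_one_powr_ge_zero)
  have lev_eq: "lev k = lev 0 * (2 powr \<alpha>) ^ k" for k
    using pos by (simp add: lev_def h_def powr_mult powr_powr powr_realpow[symmetric] mult.commute)
  have lev_pos: "0 < lev k" for k using pos h[of k] by (simp add: lev_def)
  have q: "0 < q" "q < 1" using sub by (auto simp: q_def powr_less_one)
  have unbounded: "\<exists>k. t \<le> lev k" for t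
  proof -
    have "1 < 2 powr \<alpha>" using pos by simp
    then obtain k where "t / lev 0 < (2 powr \<alpha>) ^ k" using real_arch_pow by blast
    then show ?thesis using lev_pos[of 0] lev_eq[of k] by (intro exI[of _ k]) (simp add: field_simps)
  qed
  define K where "K = lev 0 powr \<sigma> * 2 powr (\<alpha> * \<sigma>) * C * b powr N"
  have K: "0 \<le> K" using pos lev_pos by (simp add: K_def)
  define M where "M = lev 0 powr \<sigma> * max m 0 + K / (1 - q)"
  have layer: "lev (Suc k) powr \<sigma> * (C * h k powr N) = K * q ^ k" for k
  proof -
    have "lev (Suc k) powr \<sigma> = lev 0 powr \<sigma> * 2 powr (\<alpha> * real (Suc k) * \<sigma>)"
      using lev_pos[of 0] by (simp only: lev_eq[of "Suc k"]) (simp add: powr_mult powr_powr powr_realpow[symmetric] mult.commute del: power_Suc)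
    moreover have "h k powr N = b powr N * 2 powr (- real k * N)"
      using pos by (simp add: h_def powr_mult powr_powr)
    moreover have "q ^ k = 2 powr ((\<alpha> * \<sigma> - N) * real k)"
      by (simp add: q_def powr_powr powr_realpow[symmetric])
    moreover have "2 powr (\<alpha> * real (Suc k) * \<sigma>) * 2 powr (- real k * N) = 2 powr (\<alpha> * \<sigma>) * 2 powr ((\<alpha> * \<sigma> - N) * real k)"
      unfolding powr_add[symmetric] by (simp add: algebra_simps)
    ultimately show ?thesis by (simp add: K_def mult_ac)
  qed
  show ?thesis
  proof (rule that[of M])
    fix E and u :: "'a \<Rightarrow> real"
    assume [measurable]: "u \<in> borel_measurable borel" "E \<in> sets borel"
      and m: "emeasure lborel E \<le> ennreal m"
      and lev_bound: "\<And>h. 0 < h \<Longrightarrow> h \<le> b \<Longrightarrow>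
        emeasure lborel {x \<in> E. \<Lambda> * h powr - \<alpha> < \<bar>u x\<bar>} \<le> ennreal (C * h powr N)"
    let ?S = "\<lambda>k. {x \<in> E. lev k < \<bar>u x\<bar>}"
    have "(\<integral>\<^sup>+x. ennreal (\<bar>u x\<bar> powr \<sigma>) * indicator E x \<partial>lborel) \<le>
        (\<integral>\<^sup>+x. ennreal (lev 0 powr \<sigma>) * indicator E x + (\<Sum>k. ennreal (lev (Suc k) powr \<sigma>) * indicator (?S k) x) \<partial>lborel)"
    proof (rule nn_integral_mono)
      fix x
      show "ennreal (\<bar>u x\<bar> powr \<sigma>) * indicator E x \<le>
         ennreal (lev 0 powr \<sigma>) * indicator E x + (\<Sum>k. ennreal (lev (Suc k) powr \<sigma>) * indicator (?S k) x)"
      proof (cases "x \<in> E")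
        case True
        define k where "k = (LEAST k. \<bar>u x\<bar> \<le> lev k)"
        have k: "\<bar>u x\<bar> \<le> lev k" unfolding k_def by (rule LeastI_ex[OF unbounded])
        show ?thesis
        proof (cases k)
          case 0
          then have "ennreal (\<bar>u x\<bar> powr \<sigma>) \<le> ennreal (lev 0 powr \<sigma>)"
            using k pos by (intro ennreal_leI powr_mono2) auto
          then show ?thesis using True by (simp add: add_increasing2)
        next
          case (Suc j)
          then have "\<not> \<bar>u x\<bar> \<le> lev j" unfolding k_def using not_less_Least by (metis lessI)
          then have "indicator (?S j) x = (1 :: ennreal)" using True by simp
          moreover have "ennreal (\<bar>u x\<bar> powr \<sigma>) \<le> ennreal (lev (Suc j) powr \<sigma>)"
            using k Suc pos by (intro ennreal_leI powr_mono2) auto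
          ultimately have "ennreal (\<bar>u x\<bar> powr \<sigma>) \<le> ennreal (lev (Suc j) powr \<sigma>) * indicator (?S j) x"
            by simp
          also have "\<dots> \<le> (\<Sum>k. ennreal (lev (Suc k) powr \<sigma>) * indicator (?S k) x)"
            using sum_le_suminf[of "\<lambda>k. ennreal (lev (Suc k) powr \<sigma>) * indicator (?S k) x" "{j}"]
            by (simp del: sum_mult_indicator indicator_simps)
          finally show ?thesis using True by (simp add: add_increasing)
        qed
      qed simp
    qed
    also have "\<dots> = ennreal (lev 0 powr \<sigma>) * emeasure lborel E +
        (\<Sum>k. ennreal (lev (Suc k) powr \<sigma>) * emeasure lborel (?S k))"
      by (simp add: nn_integral_add nn_integral_suminf nn_integral_cmult_indicator)
    also have "\<dots> \<le> ennreal (lev 0 powr \<sigma>) * ennreal (max m 0) + (\<Sum>k. ennreal (K * q ^ k))"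
    proof (intro add_mono mult_left_mono suminf_le)
      show "emeasure lborel E \<le> ennreal (max m 0)"
        by (rule order_trans[OF m]) (intro ennreal_leI, simp)
      fix k
      have "emeasure lborel (?S k) \<le> ennreal (C * h k powr N)"
        unfolding lev_def by (rule lev_bound[OF h])
      then have "ennreal (lev (Suc k) powr \<sigma>) * emeasure lborel (?S k) \<le> ennreal (lev (Suc k) powr \<sigma>) * ennreal (C * h k powr N)"
        by (rule mult_left_mono) simp
      also have "\<dots> = ennreal (K * q ^ k)"
        using pos by (simp add: ennreal_mult[symmetric] layer)
      finally show "ennreal (lev (Suc k) powr \<sigma>) * emeasure lborel (?S k) \<le> ennreal (K * q ^ k)" .
    qed auto
    also have "(\<Sum>k. ennreal (K * q ^ k)) = ennreal (K / (1 - q))"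
    proof (rule suminf_ennreal_eq)
      show "(\<lambda>k. K * q ^ k) sums (K / (1 - q))"
        using sums_mult[OF geometric_sums[of q], of K] q by simp
    qed (use K q in auto)
    also have "ennreal (lev 0 powr \<sigma>) * ennreal (max m 0) + ennreal (K / (1 - q)) = ennreal M"
      using K q by (simp add: M_def ennreal_mult ennreal_plus)
    finally show "(\<integral>\<^sup>+x. ennreal (\<bar>u x\<bar> powr \<sigma>) * indicator E x \<partial>lborel) \<le> ennreal M" .
  qed
qed

text \<open>
  The constant is chosen before \<open>u\<close> and depends only on the exponents and the bounds.  The function \<open>g\<close> has to
  dominate the gradient only at points reached from \<open>E\<close> by segments of relative length \<open>b\<close>; this is what makes the inequality local.
\<close>

lemma subcritical_sobolev_inequality:
  fixes r \<sigma> \<Gamma> B b m :: real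
  assumes r: "1 \<le> r" "r < real DIM('a::euclidean_space)"
    and \<sigma>: "0 < \<sigma>" "\<sigma> * (real DIM('a) - r) < real DIM('a) * r"
    and nonneg: "0 \<le> \<Gamma>" "0 \<le> B" "0 < b"
  shows "\<exists>K. \<forall>E (u :: 'a \<Rightarrow> real) D g. (\<forall>x. (u has_derivative (\<lambda>v. D x \<bullet> v)) (at x)) \<longrightarrow>
    continuous_on UNIV D \<longrightarrow> (\<integral>\<^sup>+y. ennreal \<bar>u y\<bar> \<partial>lborel) \<le> ennreal B \<longrightarrow>
    g \<in> borel_measurable borel \<longrightarrow> (\<forall>y. 0 \<le> g y) \<longrightarrow>
    (\<integral>\<^sup>+y. ennreal (g y powr r) \<partial>lborel) \<le> ennreal \<Gamma> \<longrightarrow>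
    E \<in> sets borel \<longrightarrow> emeasure lborel E \<le> ennreal m \<longrightarrow>
    (\<forall>x\<in>E. \<forall>\<tau>\<in>{0..b}. \<forall>z\<in>cbox 0 One. norm (D (x + \<tau> *\<^sub>R z)) \<le> g (x + \<tau> *\<^sub>R z)) \<longrightarrow>
    (\<integral>\<^sup>+x. ennreal (\<bar>u x\<bar> powr \<sigma>) * indicator E x \<partial>lborel) \<le> ennreal K"
proof -
  define N where "N = real DIM('a)"
  define \<alpha> where "\<alpha> = N / r - 1"
  have \<alpha>: "\<alpha> > 0" using r by (simp add: \<alpha>_def N_def field_simps)
  define A where "A = b powr (\<alpha> - N) * B + N * ((1 + \<Gamma>) / \<alpha> + 1)"
  have N: "N > 0" by (simp add: N_def)
  have A: "A > 0"
    unfolding A_def using nonneg \<alpha> N by (intro add_nonneg_pos mult_pos_pos) auto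
  have sub: "\<alpha> * \<sigma> < N" using \<sigma> r by (simp add: \<alpha>_def N_def field_simps)
  have pos: "0 < 2 * A" "0 \<le> N * \<Gamma> / A" using A N nonneg by auto
  obtain K where K: "\<And>E (u :: 'a \<Rightarrow> real). u \<in> borel_measurable borel \<Longrightarrow> E \<in> sets borel \<Longrightarrow>
    emeasure lborel E \<le> ennreal m \<Longrightarrow>
    (\<And>h. 0 < h \<Longrightarrow> h \<le> b \<Longrightarrow> emeasure lborel {x \<in> E. 2 * A * h powr - \<alpha> < \<bar>u x\<bar>} \<le> ennreal (N * \<Gamma> / A * h powr N)) \<Longrightarrow>
    (\<integral>\<^sup>+x. ennreal (\<bar>u x\<bar> powr \<sigma>) * indicator E x \<partial>lborel) \<le> ennreal K"
    by (rule nn_integral_powr_le_if_superlevel_bounds[where 'a = 'a and m = m, OF \<alpha> \<sigma>(1) pos(1) nonneg(3) pos(2) sub]) blast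
  show ?thesis
  proof (intro exI[of _ K] allI impI)
    fix E and u :: "'a \<Rightarrow> real" and D g
    assume deriv: "\<forall>x. (u has_derivative (\<lambda>v. D x \<bullet> v)) (at x)"
      and cont: "continuous_on UNIV D" and B: "(\<integral>\<^sup>+y. ennreal \<bar>u y\<bar> \<partial>lborel) \<le> ennreal B"
      and g: "g \<in> borel_measurable borel" "\<forall>y. 0 \<le> g y" "(\<integral>\<^sup>+y. ennreal (g y powr r) \<partial>lborel) \<le> ennreal \<Gamma>"
      and E: "E \<in> sets borel" "emeasure lborel E \<le> ennreal m"
      and dom: "\<forall>x\<in>E. \<forall>\<tau>\<in>{0..b}. \<forall>z\<in>cbox 0 One. norm (D (x + \<tau> *\<^sub>R z)) \<le> g (x + \<tau> *\<^sub>R z)"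
    show "(\<integral>\<^sup>+x. ennreal (\<bar>u x\<bar> powr \<sigma>) * indicator E x \<partial>lborel) \<le> ennreal K"
    proof (rule K[OF _ E])
      show "u \<in> borel_measurable borel"
        by (intro borel_measurable_continuous_onI continuous_at_imp_continuous_on ballI has_derivative_continuous[OF deriv[rule_format]])
      fix h assume "0 < h" "h \<le> b"
      then show "emeasure lborel {x \<in> E. 2 * A * h powr - \<alpha> < \<bar>u x\<bar>} \<le> ennreal (N * \<Gamma> / A * h powr N)"
        using superlevel_set_bound[where b = b and h = h and A = A and D = D and E = E, OF g(1) g(2)[rule_format] r g(3) nonneg(1) deriv[rule_format] cont B nonneg(2) E(1) dom[rule_format]]
        by (simp add: \<alpha>_def[symmetric] N_def[symmetric] A_def[symmetric])
    qed
  qed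
qed

section \<open>Compactness in \<open>L\<^sup>1\<close>\<close>

text \<open>A smooth function vanishing off a bounded set vanishes at the far end of a long segment.\<close>

lemma poincare_inequality_L1:
  fixes S :: "'a::euclidean_space set"
  assumes "bounded S"
  shows "\<exists>C\<ge>0. \<forall>(u :: 'a \<Rightarrow> real) D. (\<forall>x. (u has_derivative (\<lambda>v. D x \<bullet> v)) (at x)) \<longrightarrow>
    continuous_on UNIV D \<longrightarrow> (\<forall>x. x \<notin> S \<longrightarrow> u x = 0) \<longrightarrow>
    (\<integral>\<^sup>+x. ennreal \<bar>u x\<bar> \<partial>lborel) \<le> ennreal C * (\<integral>\<^sup>+x. ennreal (norm (D x)) \<partial>lborel)"
proof -
  obtain R where R: "\<And>x. x \<in> S \<Longrightarrow> norm x \<le> R" "0 \<le> R"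
    using assms unfolding bounded_iff by (metis norm_ge_zero order_trans dual_order.refl linear)
  obtain e :: 'a where e: "norm e = 1" using vector_choose_size[of 1] by auto
  show ?thesis
  proof (intro exI[of _ "2 * R + 1"] conjI allI impI)
    fix u :: "'a \<Rightarrow> real" and D
    assume deriv: "\<forall>x. (u has_derivative (\<lambda>v. D x \<bullet> v)) (at x)"
      and cont: "continuous_on UNIV D" and zero: "\<forall>x. x \<notin> S \<longrightarrow> u x = 0"
    have [measurable]: "D \<in> borel_measurable borel"
      by (rule borel_measurable_continuous_onI[OF cont])
    have "(\<integral>\<^sup>+x. ennreal \<bar>u x\<bar> \<partial>lborel) \<le>
      (\<integral>\<^sup>+x. (\<integral>\<^sup>+\<tau>. ennreal (norm (D (x + \<tau> *\<^sub>R e))) * indicator {0..2 * R + 1} \<tau> \<partial>lborel) \<partial>lborel)"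
    proof (rule nn_integral_mono)
      fix x
      show "ennreal \<bar>u x\<bar> \<le> (\<integral>\<^sup>+\<tau>. ennreal (norm (D (x + \<tau> *\<^sub>R e))) * indicator {0..2 * R + 1} \<tau> \<partial>lborel)"
      proof (cases "x \<in> S")
        case True
        have "norm (x + (2 * R + 1) *\<^sub>R e) \<ge> (2 * R + 1) - norm x"
          using norm_diff_ineq[of "(2 * R + 1) *\<^sub>R e" x] e R(2) by (simp add: add.commute)
        then have "x + (2 * R + 1) *\<^sub>R e \<notin> S"
          using R(1)[OF True] R(1)[of "x + (2 * R + 1) *\<^sub>R e"] by auto
        then have "u (x + (2 * R + 1) *\<^sub>R e) = 0" using zero by blast
        then show ?thesis
          using abs_diff_le_segment_integral[of u D 0 "2 * R + 1" x e] deriv cont R(2) e by simp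
      qed (simp add: zero)
    qed
    also have "\<dots> = (\<integral>\<^sup>+\<tau>. (\<integral>\<^sup>+x. ennreal (norm (D (x + \<tau> *\<^sub>R e))) * indicator {0..2 * R + 1} \<tau> \<partial>lborel) \<partial>lborel)"
      by (rule lborel_pair.Fubini') measurable
    also have "\<dots> = (\<integral>\<^sup>+\<tau>. (\<integral>\<^sup>+y. ennreal (norm (D y)) \<partial>lborel) * indicator {0..2 * R + 1} \<tau> \<partial>lborel)"
      using nn_integral_lborel_translate[of "\<lambda>y. ennreal (norm (D y))"] by (simp add: nn_integral_multc)
    also have "\<dots> = ennreal (2 * R + 1) * (\<integral>\<^sup>+y. ennreal (norm (D y)) \<partial>lborel)"
      using R(2) by (simp add: nn_integral_cmult_indicator mult.commute)
    finally show "(\<integral>\<^sup>+x. ennreal \<bar>u x\<bar> \<partial>lborel) \<le> ennreal (2 * R + 1) * (\<integral>\<^sup>+x. ennreal (norm (D x)) \<partial>lborel)" .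
  qed (use R in simp)
qed

definition cube_average :: "real \<Rightarrow> ('a::euclidean_space \<Rightarrow> real) \<Rightarrow> 'a \<Rightarrow> real" where
  "cube_average h u x = (LINT z|lborel. indicator (cbox 0 One) z *\<^sub>R u (x + h *\<^sub>R z))"

context
  fixes u :: "'a::euclidean_space \<Rightarrow> real" and D and B h :: real
  assumes deriv: "\<And>x. (u has_derivative (\<lambda>v. D x \<bullet> v)) (at x)"
    and cont: "continuous_on UNIV D"
    and B_u: "(\<integral>\<^sup>+x. ennreal \<bar>u x\<bar> \<partial>lborel) \<le> ennreal B"
    and B_D: "(\<integral>\<^sup>+x. ennreal (norm (D x)) \<partial>lborel) \<le> ennreal B"
    and B_nonneg: "0 \<le> B" and h_pos: "0 < h"
begin

lemma C1_continuous: "continuous_on A u"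
  by (intro continuous_at_imp_continuous_on ballI has_derivative_continuous[OF deriv])

lemma C1_measurable: "u \<in> borel_measurable borel"
  by (rule borel_measurable_continuous_onI[OF C1_continuous])

lemma C1_gradient_measurable: "D \<in> borel_measurable borel"
  by (rule borel_measurable_continuous_onI[OF cont])

lemma cube_average_integrable: "integrable lborel (\<lambda>z. indicator (cbox 0 One) z *\<^sub>R u (x + h *\<^sub>R z))"
  by (intro borel_integrable_compact continuous_on_compose2[OF C1_continuous[of UNIV]] continuous_intros) auto

lemma abs_diff_cube_average_le:
  "ennreal \<bar>c - cube_average h u x\<bar> \<le> (\<integral>\<^sup>+z. ennreal \<bar>u (x + h *\<^sub>R z) - c\<bar> * indicator (cbox 0 One) z \<partial>lborel)"
proof -
  note [measurable] = C1_measurable C1_gradient_measurable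
  have Q: "integrable lborel (\<lambda>z. indicator (cbox 0 (One::'a)) z *\<^sub>R c)"
    by (rule borel_integrable_compact) auto
  have "c = (LINT z|lborel. indicator (cbox 0 (One::'a)) z *\<^sub>R c)"
    by (simp add: measure_def emeasure_unit_cube)
  then have "c - cube_average h u x =
      (LINT z|lborel. indicator (cbox 0 (One::'a)) z *\<^sub>R c - indicator (cbox 0 One) z *\<^sub>R u (x + h *\<^sub>R z))"
    unfolding cube_average_def by (subst Bochner_Integration.integral_diff[OF Q cube_average_integrable]) simp
  then have "ennreal (norm (c - cube_average h u x)) \<le>
      (\<integral>\<^sup>+z. ennreal (norm (indicator (cbox 0 (One::'a)) z *\<^sub>R c - indicator (cbox 0 One) z *\<^sub>R u (x + h *\<^sub>R z))) \<partial>lborel)"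
    using integral_norm_bound_ennreal[OF Bochner_Integration.integrable_diff[OF Q cube_average_integrable]] by simp
  also have "\<dots> = (\<integral>\<^sup>+z. ennreal \<bar>u (x + h *\<^sub>R z) - c\<bar> * indicator (cbox 0 One) z \<partial>lborel)"
    by (intro nn_integral_cong) (auto simp: indicator_def)
  finally show ?thesis by simp
qed

lemma nn_integral_minus_cube_average_le:
  "(\<integral>\<^sup>+x. ennreal \<bar>u x - cube_average h u x\<bar> \<partial>lborel) \<le> ennreal (real DIM('a) * h * B)"
proof -
  note [measurable] = C1_measurable C1_gradient_measurable
  have "(\<integral>\<^sup>+x. ennreal \<bar>u x - cube_average h u x\<bar> \<partial>lborel) \<le>
      (\<integral>\<^sup>+x. ennreal (real DIM('a)) * segment_potential 0 h (\<lambda>y. ennreal (norm (D y))) x \<partial>lborel)"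
    using h_pos
    by (intro nn_integral_mono order_trans[OF abs_diff_cube_average_le] nn_integral_increment_le_segment_potential deriv cont) auto
  also have "\<dots> = ennreal (real DIM('a)) * (ennreal h * (\<integral>\<^sup>+y. ennreal (norm (D y)) \<partial>lborel))"
    using h_pos by (simp add: nn_integral_cmult nn_integral_segment_potential)
  also have "\<dots> \<le> ennreal (real DIM('a)) * (ennreal h * ennreal B)"
    by (intro mult_left_mono B_D) auto
  finally show ?thesis using h_pos B_nonneg by (simp add: ennreal_mult mult.assoc)
qed

lemma abs_cube_average_le: "\<bar>cube_average h u x\<bar> \<le> h powr - real DIM('a) * B"
proof -
  note [measurable] = C1_measurable C1_gradient_measurable
  have "ennreal \<bar>0 - cube_average h u x\<bar> \<le> (\<integral>\<^sup>+z. ennreal \<bar>u (x + h *\<^sub>R z)\<bar> * indicator (cbox 0 One) z \<partial>lborel)"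
    using abs_diff_cube_average_le[of 0 x] by simp
  also have "\<dots> \<le> ennreal (h powr - real DIM('a)) * (\<integral>\<^sup>+x. ennreal \<bar>u x\<bar> \<partial>lborel)"
    by (rule nn_integral_unit_cube_scaled_le[OF _ h_pos]) measurable
  also have "\<dots> \<le> ennreal (h powr - real DIM('a)) * ennreal B"
    by (intro mult_left_mono B_u) auto
  also have "\<dots> = ennreal (h powr - real DIM('a) * B)"
    using B_nonneg by (simp add: ennreal_mult)
  finally show ?thesis using B_nonneg by (simp add: ennreal_le_iff)
qed

text \<open>
  The increment of the average is an average of increments along parallel segments, and an average at scale
  \<open>h\<close> of the gradient is at most \<open>h powr (- N)\<close> times its \<open>L\<^sup>1\<close> norm.
\<close>

lemma cube_average_lipschitz:
  "\<bar>cube_average h u x - cube_average h u y\<bar> \<le> norm (y - x) * (h powr - real DIM('a) * B)"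
proof -
  note [measurable] = C1_measurable C1_gradient_measurable
  let ?ind = "indicator (cbox 0 (One::'a))"
  have "cube_average h u y - cube_average h u x =
      (LINT z|lborel. ?ind z *\<^sub>R u (y + h *\<^sub>R z) - ?ind z *\<^sub>R u (x + h *\<^sub>R z))"
    unfolding cube_average_def by (rule Bochner_Integration.integral_diff[symmetric]; rule cube_average_integrable)
  then have "ennreal (norm (cube_average h u y - cube_average h u x)) \<le>
      (\<integral>\<^sup>+z. ennreal (norm (?ind z *\<^sub>R u (y + h *\<^sub>R z) - ?ind z *\<^sub>R u (x + h *\<^sub>R z))) \<partial>lborel)"
    using integral_norm_bound_ennreal[OF Bochner_Integration.integrable_diff[OF cube_average_integrable cube_average_integrable]]
    by simp
  also have "\<dots> \<le> (\<integral>\<^sup>+z. (\<integral>\<^sup>+\<tau>. ennreal (norm (y - x)) *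
      (ennreal (norm (D ((x + \<tau> *\<^sub>R (y - x)) + h *\<^sub>R z))) * indicator {0..1} \<tau>) * ?ind z \<partial>lborel) \<partial>lborel)"
  proof (rule nn_integral_mono)
    fix z :: 'a
    have "ennreal \<bar>u ((x + h *\<^sub>R z) + 1 *\<^sub>R (y - x)) - u ((x + h *\<^sub>R z) + 0 *\<^sub>R (y - x))\<bar> \<le> ennreal (norm (y - x)) *
      (\<integral>\<^sup>+\<tau>. ennreal (norm (D ((x + h *\<^sub>R z) + \<tau> *\<^sub>R (y - x)))) * indicator {0..1} \<tau> \<partial>lborel)"
      by (rule abs_diff_le_segment_integral[OF deriv cont]) simp
    then show "ennreal (norm (?ind z *\<^sub>R u (y + h *\<^sub>R z) - ?ind z *\<^sub>R u (x + h *\<^sub>R z))) \<le> (\<integral>\<^sup>+\<tau>. ennreal (norm (y - x)) *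
      (ennreal (norm (D ((x + \<tau> *\<^sub>R (y - x)) + h *\<^sub>R z))) * indicator {0..1} \<tau>) * ?ind z \<partial>lborel)"
      by (auto simp: indicator_def nn_integral_cmult algebra_simps)
  qed
  also have "\<dots> = (\<integral>\<^sup>+\<tau>. (\<integral>\<^sup>+z. ennreal (norm (y - x)) *
      (ennreal (norm (D ((x + \<tau> *\<^sub>R (y - x)) + h *\<^sub>R z))) * indicator {0..1} \<tau>) * ?ind z \<partial>lborel) \<partial>lborel)"
    by (rule lborel_pair.Fubini') measurable
  also have "\<dots> = (\<integral>\<^sup>+\<tau>. ennreal (norm (y - x)) *
      ((\<integral>\<^sup>+z. ennreal (norm (D ((x + \<tau> *\<^sub>R (y - x)) + h *\<^sub>R z))) * ?ind z \<partial>lborel) * indicator {0..1} \<tau>) \<partial>lborel)"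
    by (simp add: nn_integral_cmult nn_integral_multc mult_ac)
  also have "\<dots> \<le> (\<integral>\<^sup>+\<tau>. (ennreal (norm (y - x)) * (ennreal (h powr - real DIM('a)) * ennreal B)) * indicator {0..1::real} \<tau> \<partial>lborel)"
  proof (rule nn_integral_mono)
    fix \<tau> :: real
    have "(\<integral>\<^sup>+z. ennreal (norm (D ((x + \<tau> *\<^sub>R (y - x)) + h *\<^sub>R z))) * ?ind z \<partial>lborel)
        \<le> ennreal (h powr - real DIM('a)) * (\<integral>\<^sup>+x. ennreal (norm (D x)) \<partial>lborel)"
      by (rule nn_integral_unit_cube_scaled_le[OF _ h_pos]) measurable
    also have "\<dots> \<le> ennreal (h powr - real DIM('a)) * ennreal B"
      by (intro mult_left_mono B_D) auto
    finally show "ennreal (norm (y - x)) *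
      ((\<integral>\<^sup>+z. ennreal (norm (D ((x + \<tau> *\<^sub>R (y - x)) + h *\<^sub>R z))) * ?ind z \<partial>lborel) * indicator {0..1} \<tau>)
      \<le> (ennreal (norm (y - x)) * (ennreal (h powr - real DIM('a)) * ennreal B)) * indicator {0..1} \<tau>"
      by (auto simp: indicator_def intro!: mult_left_mono)
  qed
  also have "\<dots> = ennreal (norm (y - x) * (h powr - real DIM('a) * B))"
    using B_nonneg by (subst nn_integral_cmult_indicator) (auto simp: ennreal_mult)
  finally show ?thesis using B_nonneg by (simp add: ennreal_le_iff abs_minus_commute)
qed

lemma measurable_cube_average: "cube_average h u \<in> borel_measurable borel"
proof -
  have "(h powr - real DIM('a) * B)-lipschitz_on UNIV (cube_average h u)"
    using B_nonneg cube_average_lipschitz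
    by (intro lipschitz_onI) (auto simp: dist_norm norm_minus_commute mult.commute)
  then show ?thesis
    by (intro borel_measurable_continuous_onI) (rule lipschitz_on_continuous_on)
qed

end

text \<open>
  Cube averages at a fixed scale are uniformly bounded and equi-Lipschitz, so a diagonal
  sequence of them converges everywhere at every scale \<open>1 / (m + 1)\<close>.  Replacing the functions by
  their averages costs \<open>O(1 / m)\<close> in \<open>L\<^sup>1\<close>; hence the diagonal sequence is Cauchy in \<open>L\<^sup>1\<close>.
\<close>

lemma L1_Cauchy_subsequence:
  fixes u :: "nat \<Rightarrow> 'a::euclidean_space \<Rightarrow> real"
  assumes deriv: "\<And>k x. (u k has_derivative (\<lambda>v. D k x \<bullet> v)) (at x)"
    and cont: "\<And>k. continuous_on UNIV (D k)"
    and B_u: "\<And>k. (\<integral>\<^sup>+x. ennreal \<bar>u k x\<bar> \<partial>lborel) \<le> ennreal B"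
    and B_D: "\<And>k. (\<integral>\<^sup>+x. ennreal (norm (D k x)) \<partial>lborel) \<le> ennreal B"
    and B: "0 \<le> B"
    and S: "bounded S" "\<And>k x. x \<notin> S \<Longrightarrow> u k x = 0"
  obtains r where "strict_mono (r :: nat \<Rightarrow> nat)"
    "\<And>\<epsilon>. 0 < \<epsilon> \<Longrightarrow> \<exists>n0. \<forall>j\<ge>n0. \<forall>k\<ge>n0. (\<integral>\<^sup>+x. ennreal \<bar>u (r j) x - u (r k) x\<bar> \<partial>lborel) < ennreal \<epsilon>"
proof -
  define h :: "nat \<Rightarrow> real" where "h m = inverse (real (Suc m))" for m
  have h: "0 < h m" for m by (simp add: h_def)
  define a where "a k m = cube_average (h m) (u k)" for k m
  let ?L = "\<lambda>m. h m powr - real DIM('a) * B"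
  have a_bound: "\<bar>a k m x\<bar> \<le> ?L m" for k m x
    unfolding a_def by (rule abs_cube_average_le[OF deriv cont B_u B_D B h])
  have a_lip: "\<bar>a k m x - a k m y\<bar> \<le> norm (y - x) * ?L m" for k m x y
    unfolding a_def by (rule cube_average_lipschitz[OF deriv cont B_u B_D B h])
  have a_meas [measurable]: "a k m \<in> borel_measurable borel" for k m
    unfolding a_def by (rule measurable_cube_average[OF deriv cont B_u B_D B h])
  have u_meas [measurable]: "u k \<in> borel_measurable borel" for k
    by (rule C1_measurable[OF deriv cont B_u B_D B h])
  have a_err: "(\<integral>\<^sup>+x. ennreal \<bar>u k x - a k m x\<bar> \<partial>lborel) \<le> ennreal (real DIM('a) * h m * B)" for k m
    unfolding a_def by (rule nn_integral_minus_cube_average_le[OF deriv cont B_u B_D B h])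
  obtain Q :: "'a set" where Q: "countable Q" "\<And>X. open X \<Longrightarrow> X \<noteq> {} \<Longrightarrow> \<exists>d\<in>Q. d \<in> X"
    using countable_dense_exists by metis
  have L_pos: "0 \<le> ?L m" for m using B by simp
  have norm_le: "norm (a k (fst y) (snd y) / (1 + ?L (fst y))) \<le> 1" for k y
    using a_bound[of k "fst y" "snd y"] L_pos[of "fst y"] by (simp add: divide_le_eq)
  \<comment> \<open>Dividing by \<open>1 + ?L m\<close> gives one bound for all scales, as the diagonal argument requires.\<close>
  obtain r where r: "strict_mono r"
    "\<And>y. y \<in> UNIV \<times> Q \<Longrightarrow> \<exists>l. (\<lambda>n. a (r n) (fst y) (snd y) / (1 + ?L (fst y))) \<longlonglongrightarrow> l"
  proof (rule function_convergent_subsequence[of "UNIV \<times> Q" "\<lambda>k y. a k (fst y) (snd y) / (1 + ?L (fst y))" 1])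
    show "countable (UNIV \<times> Q :: (nat \<times> 'a) set)" using Q(1) by (intro countable_SIGMA) auto
  qed (use norm_le in blast)+
  have conv_Q: "convergent (\<lambda>n. a (r n) m d)" if d: "d \<in> Q" for m d
  proof -
    obtain l where "(\<lambda>n. a (r n) m d / (1 + ?L m)) \<longlonglongrightarrow> l" using r(2)[of "(m, d)"] d by auto
    then have "(\<lambda>n. a (r n) m d / (1 + ?L m) * (1 + ?L m)) \<longlonglongrightarrow> l * (1 + ?L m)"
      by (intro tendsto_intros)
    moreover have "1 + ?L m \<noteq> 0" using L_pos[of m] by linarith
    ultimately show ?thesis by (auto simp: convergent_def)
  qed
  have conv: "convergent (\<lambda>n. a (r n) m x)" for m x
  proof -
    have "Cauchy (\<lambda>n. a (r n) m x)"
    proof (rule metric_CauchyI)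
      fix \<epsilon> :: real assume "\<epsilon> > 0"
      define \<delta> where "\<delta> = \<epsilon> / (3 * (1 + ?L m))"
      have L1: "0 < 1 + ?L m" using L_pos[of m] by linarith
      have \<delta>: "\<delta> > 0" using \<open>\<epsilon> > 0\<close> L1 by (simp add: \<delta>_def)
      obtain d where d: "d \<in> Q" "d \<in> ball x \<delta>" using Q(2)[of "ball x \<delta>"] \<delta> by auto
      have near: "\<bar>a k m x - a k m d\<bar> < \<epsilon> / 3" for k
      proof -
        have "\<bar>a k m x - a k m d\<bar> \<le> norm (d - x) * ?L m" by (rule a_lip)
        also have "\<dots> \<le> norm (d - x) * (1 + ?L m)" by (intro mult_left_mono) auto
        also have "\<dots> < \<delta> * (1 + ?L m)"
          using d(2) L1 by (intro mult_strict_right_mono) (auto simp: dist_norm norm_minus_commute)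
        also have "\<dots> = \<epsilon> / 3" using less_imp_neq[OF L1, symmetric] unfolding \<delta>_def by (simp del: distrib_left_numeral)
        finally show ?thesis .
      qed
      obtain n0 where n0: "\<forall>j\<ge>n0. \<forall>k\<ge>n0. dist (a (r j) m d) (a (r k) m d) < \<epsilon> / 3"
        using metric_CauchyD[OF convergent_Cauchy[OF conv_Q[OF d(1), of m]], of "\<epsilon> / 3"] \<open>\<epsilon> > 0\<close> by auto
      show "\<exists>M. \<forall>j\<ge>M. \<forall>k\<ge>M. dist (a (r j) m x) (a (r k) m x) < \<epsilon>"
      proof (intro exI[of _ n0] allI impI)
        fix j k assume "j \<ge> n0" "k \<ge> n0"
        then have "\<bar>a (r j) m d - a (r k) m d\<bar> < \<epsilon> / 3" using n0 by (auto simp: dist_real_def)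
        then show "dist (a (r j) m x) (a (r k) m x) < \<epsilon>"
          using near[of "r j"] near[of "r k"] unfolding dist_real_def by linarith
      qed
    qed
    then show ?thesis by (rule Cauchy_convergent)
  qed
  define l where "l m x = lim (\<lambda>n. a (r n) m x)" for m x
  have l: "(\<lambda>n. a (r n) m x) \<longlonglongrightarrow> l m x" for m x
    using conv unfolding l_def by (simp add: convergent_LIMSEQ_iff)
  have l_meas [measurable]: "l m \<in> borel_measurable borel" for m
    unfolding l_def by measurable
  have l_bound: "\<bar>l m x\<bar> \<le> ?L m" for m x
    by (rule LIMSEQ_le_const2[OF tendsto_rabs[OF l]]) (auto intro: a_bound)
  obtain c d where box: "S \<subseteq> cbox c d" using bounded_subset_cbox_symmetric[OF S(1)] by metis
  define e where "e m n = (\<integral>\<^sup>+x. ennreal \<bar>a (r n) m x - l m x\<bar> * indicator (cbox c d) x \<partial>lborel)" for m n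
  have e: "(\<lambda>n. e m n) \<longlonglongrightarrow> 0" for m
  proof -
    have "(\<lambda>n. e m n) \<longlonglongrightarrow> (\<integral>\<^sup>+x. (0::ennreal) \<partial>(lborel :: 'a measure))"
      unfolding e_def
    proof (rule nn_integral_dominated_convergence[where w = "\<lambda>x. ennreal (2 * ?L m) * indicator (cbox c d) x"])
      show "(\<integral>\<^sup>+x. ennreal (2 * ?L m) * indicator (cbox c d) x \<partial>lborel) < \<infinity>"
        using emeasure_compact_finite[OF compact_cbox, of c d]
        by (simp add: nn_integral_cmult_indicator ennreal_mult_less_top)
      show "AE x in lborel. (\<lambda>n. ennreal \<bar>a (r n) m x - l m x\<bar> * indicator (cbox c d) x) \<longlonglongrightarrow> 0"
      proof (rule AE_I2)
        fix x
        have "(\<lambda>n. \<bar>a (r n) m x - l m x\<bar>) \<longlonglongrightarrow> 0"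
          using l[of m x] by (simp add: LIM_zero_iff tendsto_rabs_zero_iff)
        then have "(\<lambda>n. ennreal \<bar>a (r n) m x - l m x\<bar>) \<longlonglongrightarrow> 0"
          using tendsto_ennrealI by fastforce
        then show "(\<lambda>n. ennreal \<bar>a (r n) m x - l m x\<bar> * indicator (cbox c d) x) \<longlonglongrightarrow> 0"
          by (cases "x \<in> cbox c d") auto
      qed
      show "AE x in lborel. ennreal \<bar>a (r n) m x - l m x\<bar> * indicator (cbox c d) x \<le> ennreal (2 * ?L m) * indicator (cbox c d) x" for n
      proof (intro AE_I2 mult_right_mono ennreal_leI)
        fix x show "\<bar>a (r n) m x - l m x\<bar> \<le> 2 * ?L m"
          using a_bound[of "r n" m x] l_bound[of m x] by linarith
      qed simp
    qed measurable
    then show ?thesis by simp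
  qed
  have main: "(\<integral>\<^sup>+x. ennreal \<bar>u (r j) x - u (r k) x\<bar> \<partial>lborel) \<le> ennreal (2 * (real DIM('a) * h m * B)) + (e m j + e m k)" for j k m
  proof -
    have "(\<integral>\<^sup>+x. ennreal \<bar>u (r j) x - u (r k) x\<bar> \<partial>lborel) \<le>
      (\<integral>\<^sup>+x. (ennreal \<bar>u (r j) x - a (r j) m x\<bar> + ennreal \<bar>u (r k) x - a (r k) m x\<bar>) +
         (ennreal \<bar>a (r j) m x - l m x\<bar> * indicator (cbox c d) x + ennreal \<bar>a (r k) m x - l m x\<bar> * indicator (cbox c d) x) \<partial>lborel)"
    proof (rule nn_integral_mono)
      fix x
      show "ennreal \<bar>u (r j) x - u (r k) x\<bar> \<le>
         (ennreal \<bar>u (r j) x - a (r j) m x\<bar> + ennreal \<bar>u (r k) x - a (r k) m x\<bar>) +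
         (ennreal \<bar>a (r j) m x - l m x\<bar> * indicator (cbox c d) x + ennreal \<bar>a (r k) m x - l m x\<bar> * indicator (cbox c d) x)"
      proof (cases "x \<in> cbox c d")
        case True
        then show ?thesis
          by (simp add: ennreal_plus[symmetric] del: ennreal_plus)
      next
        case False
        then have "u i x = 0" for i using S(2) box by blast
        then show ?thesis by simp
      qed
    qed
    also have "\<dots> = ((\<integral>\<^sup>+x. ennreal \<bar>u (r j) x - a (r j) m x\<bar> \<partial>lborel) + (\<integral>\<^sup>+x. ennreal \<bar>u (r k) x - a (r k) m x\<bar> \<partial>lborel))
        + (e m j + e m k)"
      unfolding e_def by (simp add: nn_integral_add)
    also have "\<dots> \<le> (ennreal (real DIM('a) * h m * B) + ennreal (real DIM('a) * h m * B)) + (e m j + e m k)"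
      by (intro add_mono a_err order_refl)
    also have "ennreal (real DIM('a) * h m * B) + ennreal (real DIM('a) * h m * B) = ennreal (2 * (real DIM('a) * h m * B))"
      using B h[of m] by (simp add: ennreal_plus[symmetric] del: ennreal_plus)
    finally show ?thesis .
  qed
  show ?thesis
  proof (rule that[OF r(1)])
    fix \<epsilon> :: real assume \<epsilon>: "\<epsilon> > 0"
    have "(\<lambda>m. 2 * (real DIM('a) * h m * B)) \<longlonglongrightarrow> 2 * (real DIM('a) * 0 * B)"
      unfolding h_def by (intro tendsto_intros LIMSEQ_inverse_real_of_nat)
    from order_tendstoD(2)[OF this, of "\<epsilon> / 3"]
    have "eventually (\<lambda>m. 2 * (real DIM('a) * h m * B) < \<epsilon> / 3) sequentially"
      using \<epsilon> by simp
    then obtain m where m: "2 * (real DIM('a) * h m * B) < \<epsilon> / 3"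
      by (auto simp: eventually_sequentially)
    have "eventually (\<lambda>n. e m n < ennreal (\<epsilon> / 3)) sequentially"
      using \<epsilon> e[of m] by (intro order_tendstoD(2)) auto
    then obtain n0 where n0: "\<And>n. n \<ge> n0 \<Longrightarrow> e m n < ennreal (\<epsilon> / 3)"
      by (auto simp: eventually_sequentially)
    show "\<exists>n0. \<forall>j\<ge>n0. \<forall>k\<ge>n0. (\<integral>\<^sup>+x. ennreal \<bar>u (r j) x - u (r k) x\<bar> \<partial>lborel) < ennreal \<epsilon>"
    proof (intro exI[of _ n0] allI impI)
      fix j k assume jk: "j \<ge> n0" "k \<ge> n0"
      have "(\<integral>\<^sup>+x. ennreal \<bar>u (r j) x - u (r k) x\<bar> \<partial>lborel) \<le> ennreal (2 * (real DIM('a) * h m * B)) + (e m j + e m k)"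
        by (rule main)
      also have "\<dots> \<le> ennreal (2 * (real DIM('a) * h m * B)) + (ennreal (\<epsilon> / 3) + ennreal (\<epsilon> / 3))"
        using n0 jk by (intro add_mono order_refl less_imp_le) auto
      also have "\<dots> = ennreal (2 * (real DIM('a) * h m * B) + (\<epsilon> / 3 + \<epsilon> / 3))"
        using \<epsilon> B h[of m] by (simp add: ennreal_plus[symmetric] del: ennreal_plus)
      also have "\<dots> < ennreal \<epsilon>"
        using m \<epsilon> by (intro ennreal_lessI) auto
      finally show "(\<integral>\<^sup>+x. ennreal \<bar>u (r j) x - u (r k) x\<bar> \<partial>lborel) < ennreal \<epsilon>" .
    qed
  qed
qed

text \<open>
  Along a subsequence with summable consecutive distances the telescoping series converges absolutely
  almost everywhere.
\<close>

lemma L1_Cauchy_imp_AE_convergent_subsequence: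
  fixes u :: "nat \<Rightarrow> 'a \<Rightarrow> real"
  assumes [measurable]: "\<And>k. u k \<in> borel_measurable M"
    and Cauchy: "\<And>\<epsilon>. 0 < \<epsilon> \<Longrightarrow> \<exists>n0. \<forall>j\<ge>n0. \<forall>k\<ge>n0. (\<integral>\<^sup>+x. ennreal \<bar>u j x - u k x\<bar> \<partial>M) < ennreal \<epsilon>"
  obtains q v where "strict_mono (q :: nat \<Rightarrow> nat)" "v \<in> borel_measurable M"
    "AE x in M. (\<lambda>n. u (q n) x) \<longlonglongrightarrow> v x"
proof -
  have "\<exists>n0. \<forall>j\<ge>n0. \<forall>k\<ge>n0. (\<integral>\<^sup>+x. ennreal \<bar>u j x - u k x\<bar> \<partial>M) < ennreal ((1/2) ^ n)" for n
    by (rule Cauchy) simp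
  then obtain c where c: "\<And>n j k. c n \<le> j \<Longrightarrow> c n \<le> k \<Longrightarrow> (\<integral>\<^sup>+x. ennreal \<bar>u j x - u k x\<bar> \<partial>M) < ennreal ((1/2) ^ n)"
    by metis
  define q where "q n = n + (\<Sum>i\<le>n. c i)" for n
  have q: "strict_mono q" by (rule strict_monoI_Suc) (simp add: q_def)
  have cq: "c n \<le> q n" for n
    unfolding q_def using member_le_sum[of n "{..n}" c] by simp
  have cq': "c n \<le> q (Suc n)" for n
    by (rule order_trans[OF cq]) (use q in \<open>simp add: strict_mono_less_eq\<close>)
  have "(\<integral>\<^sup>+x. (\<Sum>n. ennreal \<bar>u (q (Suc n)) x - u (q n) x\<bar>) \<partial>M) = (\<Sum>n. (\<integral>\<^sup>+x. ennreal \<bar>u (q (Suc n)) x - u (q n) x\<bar> \<partial>M))"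
    by (rule nn_integral_suminf) measurable
  also have "\<dots> \<le> (\<Sum>n. ennreal ((1/2) ^ n))"
    by (intro suminf_le less_imp_le[OF c[OF cq' cq]]) auto
  also have "\<dots> = ennreal (1 / (1 - 1/2))"
    by (rule suminf_ennreal_eq[OF _ geometric_sums]) auto
  finally have "(\<integral>\<^sup>+x. (\<Sum>n. ennreal \<bar>u (q (Suc n)) x - u (q n) x\<bar>) \<partial>M) \<noteq> \<infinity>"
    by (auto simp: top_unique)
  then have "AE x in M. (\<Sum>n. ennreal \<bar>u (q (Suc n)) x - u (q n) x\<bar>) \<noteq> \<infinity>"
    by (intro nn_integral_PInf_AE) measurable
  then have "AE x in M. (\<lambda>n. u (q n) x) \<longlonglongrightarrow> lim (\<lambda>n. u (q n) x)"
  proof (rule eventually_mono)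
    fix x assume "(\<Sum>n. ennreal \<bar>u (q (Suc n)) x - u (q n) x\<bar>) \<noteq> \<infinity>"
    then have "summable (\<lambda>n. \<bar>u (q (Suc n)) x - u (q n) x\<bar>)"
      by (intro summable_suminf_not_top) auto
    then have "summable (\<lambda>n. u (q (Suc n)) x - u (q n) x)"
      by (rule summable_rabs_cancel)
    then have "convergent (\<lambda>n. \<Sum>i<n. u (q (Suc i)) x - u (q i) x)"
      by (simp add: summable_iff_convergent)
    then have "convergent (\<lambda>n. u (q n) x - u (q 0) x)"
      using sum_lessThan_telescope[of "\<lambda>i. u (q i) x"] by simp
    then have "convergent (\<lambda>n. (u (q n) x - u (q 0) x) + u (q 0) x)"
      by (intro convergent_add convergent_const)
    then show "(\<lambda>n. u (q n) x) \<longlonglongrightarrow> lim (\<lambda>n. u (q n) x)"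
      by (simp add: convergent_LIMSEQ_iff)
  qed
  moreover have "(\<lambda>x. lim (\<lambda>n. u (q n) x)) \<in> borel_measurable M" by measurable
  ultimately show ?thesis using that q by blast
qed

section \<open>The Luxemburg norm\<close>

lemma powr_convex_nonneg:
  fixes a b r s :: real
  assumes "1 \<le> r" "0 \<le> a" "0 \<le> b" "0 \<le> s" "s \<le> 1"
  shows "(s * a + (1 - s) * b) powr r \<le> s * a powr r + (1 - s) * b powr r"
proof -
  have scaled: "(t * c) powr r \<le> t * c powr r" if "0 \<le> t" "t \<le> 1" "0 \<le> c" for t c :: real
  proof -
    have "t powr r \<le> t powr 1" if "0 < t" using that \<open>t \<le> 1\<close> assms(1) by (intro powr_mono') auto
    then have "t powr r \<le> t" using that by (cases "t = 0") auto
    then show ?thesis using that by (simp add: powr_mult mult_right_mono)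
  qed
  show ?thesis
  proof (cases "a = 0 \<or> b = 0")
    case True
    then show ?thesis using scaled[of s a] scaled[of "1 - s" b] assms by auto
  next
    case False
    then show ?thesis
      using convex_onD[OF powr_convex[OF assms(1)], of "1 - s" a b] assms by auto
  qed
qed

lemma dphase_zero [simp]: "dphase p q \<mu> x 0 = 0"
  by (simp add: dphase_def)

lemma dphase_nonneg: "0 \<le> \<mu> x \<Longrightarrow> 0 \<le> dphase p q \<mu> x t"
  by (simp add: dphase_def)

lemma dphase_mono:
  "0 \<le> p x \<Longrightarrow> 0 \<le> q x \<Longrightarrow> 0 \<le> \<mu> x \<Longrightarrow> 0 \<le> a \<Longrightarrow> a \<le> b \<Longrightarrow> dphase p q \<mu> x a \<le> dphase p q \<mu> x b"
  unfolding dphase_def by (intro add_mono mult_left_mono powr_mono2) auto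

lemma dphase_convex:
  assumes "1 \<le> p x" "1 \<le> q x" "0 \<le> \<mu> x" "0 \<le> a" "0 \<le> b" "0 \<le> s" "s \<le> 1"
  shows "dphase p q \<mu> x (s * a + (1 - s) * b) \<le> s * dphase p q \<mu> x a + (1 - s) * dphase p q \<mu> x b"
proof -
  have "(s * a + (1 - s) * b) powr p x + \<mu> x * (s * a + (1 - s) * b) powr q x
      \<le> (s * a powr p x + (1 - s) * b powr p x) + \<mu> x * (s * a powr q x + (1 - s) * b powr q x)"
    using assms by (intro add_mono mult_left_mono powr_convex_nonneg) auto
  then show ?thesis by (simp add: dphase_def algebra_simps)
qed

lemma borel_measurable_lebesgue_on_AE:
  fixes f g :: "'a::euclidean_space \<Rightarrow> 'b::euclidean_space"
  assumes S: "S \<in> sets lebesgue" and f: "f \<in> borel_measurable (lebesgue_on S)"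
    and eq: "AE x in lebesgue_on S. f x = g x"
  shows "g \<in> borel_measurable (lebesgue_on S)"
proof -
  have "(\<lambda>x. if x \<in> S then f x else 0) \<in> borel_measurable lebesgue"
    using f S by (simp add: borel_measurable_if)
  moreover have "AE x in lebesgue. (if x \<in> S then f x else 0) = (if x \<in> S then g x else 0)"
    using eq S by (subst (asm) AE_restrict_space_iff) (auto elim: eventually_mono)
  ultimately have "(\<lambda>x. if x \<in> S then g x else 0) \<in> borel_measurable lebesgue"
    by (rule borel_measurable_AE)
  then show ?thesis using S by (simp add: borel_measurable_if)
qed

text \<open>
  The double phase integrand with bounded exponents: it is convex in its second argument and satisfies a doubling condition.
\<close>

locale double_phase =
  fixes \<Omega> :: "'a::euclidean_space set" and p q \<mu> :: "'a \<Rightarrow> real" and P :: real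
  assumes open_domain: "open \<Omega>" and bounded_domain: "bounded \<Omega>"
    and p_measurable: "p \<in> borel_measurable (lebesgue_on \<Omega>)"
    and q_measurable: "q \<in> borel_measurable (lebesgue_on \<Omega>)"
    and \<mu>_measurable: "\<mu> \<in> borel_measurable (lebesgue_on \<Omega>)"
    and p_bounds: "\<And>x. x \<in> \<Omega> \<Longrightarrow> 1 \<le> p x \<and> p x \<le> P"
    and q_bounds: "\<And>x. x \<in> \<Omega> \<Longrightarrow> 1 \<le> q x \<and> q x \<le> P"
    and \<mu>_nonneg: "AE x in lebesgue_on \<Omega>. 0 \<le> \<mu> x"
begin

abbreviation "H \<equiv> dphase p q \<mu>"
abbreviation "M \<equiv> lebesgue_on \<Omega>"
abbreviation "\<rho> \<equiv> modular \<Omega> H"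
abbreviation "lux \<equiv> luxemburg_norm \<Omega> H"
abbreviation "L \<equiv> L_space \<Omega> H"

lemma domain_sets [measurable]: "\<Omega> \<in> sets lebesgue"
  using open_domain by (simp add: borel_open)

lemma emeasure_domain: "emeasure M \<Omega> < \<infinity>"
  using emeasure_bounded_finite[OF bounded_domain] open_domain
  by (simp add: emeasure_restrict_space borel_open)

lemma finite_measure_domain: "finite_measure M"
  by (rule finite_measureI) (use emeasure_domain in auto)

lemma AE_domain:
  assumes "\<And>x. x \<in> \<Omega> \<Longrightarrow> 0 \<le> \<mu> x \<Longrightarrow> Q x"
  shows "AE x in M. Q x"
  using \<mu>_nonneg AE_space[of M] by eventually_elim (use assms in auto)

lemma measurable_dphase [measurable]:
  "u \<in> borel_measurable M \<Longrightarrow> (\<lambda>x. H x \<bar>u x\<bar>) \<in> borel_measurable M"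
  unfolding dphase_def using p_measurable q_measurable \<mu>_measurable
  by (intro borel_measurable_add borel_measurable_times powr_real_measurable borel_measurable_abs)

lemma modular_mono:
  assumes "AE x in M. \<bar>u x\<bar> \<le> \<bar>v x\<bar>"
  shows "\<rho> u \<le> \<rho> v"
  unfolding modular_def
proof (rule nn_integral_mono_AE)
  show "AE x in M. ennreal (H x \<bar>u x\<bar>) \<le> ennreal (H x \<bar>v x\<bar>)"
    using \<mu>_nonneg AE_space[of M] assms
  proof eventually_elim
    case (elim x)
    then show ?case using p_bounds[of x] q_bounds[of x] by (intro ennreal_leI dphase_mono) auto
  qed
qed

lemma modular_convex:
  assumes [measurable]: "u \<in> borel_measurable M" "v \<in> borel_measurable M" and s: "0 \<le> s" "s \<le> 1"
  shows "\<rho> (\<lambda>x. s * u x + (1 - s) * v x) \<le> ennreal s * \<rho> u + ennreal (1 - s) * \<rho> v"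
proof -
  have "\<rho> (\<lambda>x. s * u x + (1 - s) * v x) \<le>
      (\<integral>\<^sup>+x. ennreal s * ennreal (H x \<bar>u x\<bar>) + ennreal (1 - s) * ennreal (H x \<bar>v x\<bar>) \<partial>M)"
    unfolding modular_def
  proof (rule nn_integral_mono_AE, rule AE_domain)
    fix x assume x: "x \<in> \<Omega>" "0 \<le> \<mu> x"
    have "H x \<bar>s * u x + (1 - s) * v x\<bar> \<le> H x (s * \<bar>u x\<bar> + (1 - s) * \<bar>v x\<bar>)"
      using p_bounds[of x] q_bounds[of x] x s
      by (intro dphase_mono) (auto intro!: order_trans[OF abs_triangle_ineq] add_mono simp: abs_mult)
    also have "\<dots> \<le> s * H x \<bar>u x\<bar> + (1 - s) * H x \<bar>v x\<bar>"
      using p_bounds[of x] q_bounds[of x] x s by (intro dphase_convex) auto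
    finally have "ennreal (H x \<bar>s * u x + (1 - s) * v x\<bar>) \<le> ennreal (s * H x \<bar>u x\<bar> + (1 - s) * H x \<bar>v x\<bar>)"
      by (rule ennreal_leI)
    then show "ennreal (H x \<bar>s * u x + (1 - s) * v x\<bar>) \<le> ennreal s * ennreal (H x \<bar>u x\<bar>) + ennreal (1 - s) * ennreal (H x \<bar>v x\<bar>)"
      using x s by (simp add: dphase_nonneg ennreal_mult)
  qed
  also have "\<dots> = ennreal s * \<rho> u + ennreal (1 - s) * \<rho> v"
    unfolding modular_def by (simp add: nn_integral_add nn_integral_cmult)
  finally show ?thesis .
qed

lemma modular_zero: "\<rho> (\<lambda>x. 0) = 0"
  by (simp add: modular_def)

lemma modular_scale_down:
  assumes "u \<in> borel_measurable M" "0 \<le> s" "s \<le> 1"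
  shows "\<rho> (\<lambda>x. s * u x) \<le> ennreal s * \<rho> u"
  using modular_convex[of u "\<lambda>x. 0" s] assms by (simp add: modular_zero)

lemma modular_scale_up:
  assumes [measurable]: "u \<in> borel_measurable M" and c: "1 \<le> c"
  shows "\<rho> (\<lambda>x. c * u x) \<le> ennreal (c powr P) * \<rho> u"
proof -
  have "\<rho> (\<lambda>x. c * u x) \<le> (\<integral>\<^sup>+x. ennreal (c powr P) * ennreal (H x \<bar>u x\<bar>) \<partial>M)"
    unfolding modular_def
  proof (rule nn_integral_mono_AE, rule AE_domain)
    fix x assume x: "x \<in> \<Omega>" "0 \<le> \<mu> x"
    have "c powr p x \<le> c powr P" "c powr q x \<le> c powr P"
      using p_bounds[of x] q_bounds[of x] x c by (auto intro!: powr_mono)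
    then have "H x \<bar>c * u x\<bar> \<le> c powr P * \<bar>u x\<bar> powr p x + \<mu> x * (c powr P * \<bar>u x\<bar> powr q x)"
      unfolding dphase_def using x c
      by (auto simp: abs_mult powr_mult intro!: add_mono mult_left_mono mult_right_mono)
    also have "\<dots> = c powr P * H x \<bar>u x\<bar>" by (simp add: dphase_def algebra_simps)
    finally show "ennreal (H x \<bar>c * u x\<bar>) \<le> ennreal (c powr P) * ennreal (H x \<bar>u x\<bar>)"
      using x dphase_nonneg[of \<mu> x p q "\<bar>u x\<bar>"] by (simp add: ennreal_mult[symmetric] ennreal_leI)
  qed
  also have "\<dots> = ennreal (c powr P) * \<rho> u"
    unfolding modular_def by (simp add: nn_integral_cmult)
  finally show ?thesis .
qed

lemma L_measurable: "u \<in> L \<Longrightarrow> u \<in> borel_measurable M"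
  by (simp add: L_space_def)

lemma L_mono:
  assumes "v \<in> L" "u \<in> borel_measurable M" "AE x in M. \<bar>u x\<bar> \<le> \<bar>v x\<bar>"
  shows "u \<in> L"
  using modular_mono[OF assms(3)] assms by (auto simp: L_space_def intro: le_less_trans)

lemma L_scale:
  assumes "u \<in> L"
  shows "(\<lambda>x. c * u x) \<in> L"
proof -
  define d where "d = max 1 \<bar>c\<bar>"
  have [measurable]: "u \<in> borel_measurable M" by (rule L_measurable[OF assms])
  have "\<rho> (\<lambda>x. d * u x) \<le> ennreal (d powr P) * \<rho> u"
    by (rule modular_scale_up) (auto simp: d_def)
  then have "(\<lambda>x. d * u x) \<in> L"
    using assms by (auto simp: L_space_def ennreal_mult_less_top intro: le_less_trans)
  then show ?thesis
    by (rule L_mono) (auto simp: abs_mult d_def intro!: mult_right_mono)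
qed

lemma L_add:
  assumes "u \<in> L" "v \<in> L"
  shows "(\<lambda>x. u x + v x) \<in> L"
proof -
  have m [measurable]: "u \<in> borel_measurable M" "v \<in> borel_measurable M"
    using assms by (auto intro: L_measurable)
  have "\<rho> (\<lambda>x. 1 / 2 * u x + (1 - 1 / 2) * v x) \<le> ennreal (1 / 2) * \<rho> u + ennreal (1 - 1 / 2) * \<rho> v"
    by (rule modular_convex[OF m]) auto
  also have "\<dots> < \<infinity>"
    using assms unfolding L_space_def infinity_ennreal_def ennreal_add_less_top[symmetric]
    by (auto intro!: ennreal_mult_less_top[THEN iffD2] simp del: ennreal_half)
  finally have "(\<lambda>x. 1 / 2 * u x + (1 - 1 / 2) * v x) \<in> L" by (simp add: L_space_def)
  from L_scale[OF this, of 2] show ?thesis by (simp add: algebra_simps)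
qed

lemma L_zero: "(\<lambda>x. 0) \<in> L"
  by (simp add: L_space_def modular_zero)

lemma lux_bdd_below: "bdd_below {\<zeta>. \<zeta> > 0 \<and> \<rho> (\<lambda>x. u x / \<zeta>) \<le> 1}"
  by (rule bdd_belowI[of _ 0]) auto

lemma lux_le: "0 < c \<Longrightarrow> \<rho> (\<lambda>x. u x / c) \<le> 1 \<Longrightarrow> lux u \<le> c"
  unfolding luxemburg_norm_def by (rule cInf_lower[OF _ lux_bdd_below]) auto

text \<open>
  The infimum of the empty set of reals is unspecified, so the Luxemburg norm is meaningful only because
  modulars of \<open>u / \<zeta>\<close> become small for large \<open>\<zeta>\<close>.
\<close>

lemma lux_set_nonempty:
  assumes "u \<in> L"
  shows "{\<zeta>. \<zeta> > 0 \<and> \<rho> (\<lambda>x. u x / \<zeta>) \<le> 1} \<noteq> {}"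
proof -
  obtain m where m: "\<rho> u = ennreal m" "0 \<le> m"
    using assms by (cases "\<rho> u") (auto simp: L_space_def)
  have "\<rho> (\<lambda>x. 1 / (1 + m) * u x) \<le> ennreal (1 / (1 + m)) * \<rho> u"
    by (rule modular_scale_down) (use assms m in \<open>auto simp: L_space_def\<close>)
  also have "\<dots> \<le> 1"
    using m by (simp add: ennreal_mult[symmetric])
  finally show ?thesis using m(2) by (auto intro!: exI[of _ "1 + m"] simp: divide_inverse mult.commute)
qed

lemma lux_nonneg: "u \<in> L \<Longrightarrow> 0 \<le> lux u"
  unfolding luxemburg_norm_def by (rule cInf_greatest[OF lux_set_nonempty]) auto

lemma modular_le_1_if_lux_less:
  assumes "u \<in> L" "lux u < c"
  shows "\<rho> (\<lambda>x. u x / c) \<le> 1"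
proof -
  obtain \<zeta> where \<zeta>: "0 < \<zeta>" "\<rho> (\<lambda>x. u x / \<zeta>) \<le> 1" "\<zeta> < c"
    using cInf_lessD[OF lux_set_nonempty[OF assms(1)], of c] assms(2)
    unfolding luxemburg_norm_def by auto
  have "\<rho> (\<lambda>x. u x / c) \<le> \<rho> (\<lambda>x. u x / \<zeta>)"
    using \<zeta> by (intro modular_mono AE_I2) (auto simp: abs_divide intro!: divide_left_mono)
  then show ?thesis using \<zeta>(2) by simp
qed

text \<open>
  If \<open>u / a\<close> and \<open>v / b\<close> have modular at most \<open>1\<close>, so has their convex combination \<open>(u + v) / (a + b)\<close>.
\<close>

lemma lux_triangle:
  assumes "u \<in> L" "v \<in> L"
  shows "lux (\<lambda>x. u x + v x) \<le> lux u + lux v"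
proof (rule field_le_epsilon)
  fix e :: real assume "e > 0"
  define a b where "a = lux u + e / 2" and "b = lux v + e / 2"
  have ab: "0 < a" "0 < b" using \<open>e > 0\<close> lux_nonneg assms by (auto simp: a_def b_def add_nonneg_pos)
  have le: "\<rho> (\<lambda>x. u x / a) \<le> 1" "\<rho> (\<lambda>x. v x / b) \<le> 1"
    using assms \<open>e > 0\<close> by (auto intro!: modular_le_1_if_lux_less simp: a_def b_def)
  have [measurable]: "u \<in> borel_measurable M" "v \<in> borel_measurable M"
    using assms by (auto intro: L_measurable)
  define s where "s = a / (a + b)"
  have s: "0 \<le> s" "s \<le> 1" "1 - s = b / (a + b)" using ab by (auto simp: s_def field_simps)
  have "(\<lambda>x. (u x + v x) / (a + b)) = (\<lambda>x. s * (u x / a) + (1 - s) * (v x / b))"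
    unfolding s(3) using ab by (auto simp: s_def add_divide_distrib)
  then have "\<rho> (\<lambda>x. (u x + v x) / (a + b)) \<le> ennreal s * \<rho> (\<lambda>x. u x / a) + ennreal (1 - s) * \<rho> (\<lambda>x. v x / b)"
    using modular_convex[of "\<lambda>x. u x / a" "\<lambda>x. v x / b" s] s by simp
  also have "\<dots> \<le> ennreal s * 1 + ennreal (1 - s) * 1"
    by (intro add_mono mult_left_mono le) auto
  also have "\<dots> = 1" using s by (simp add: ennreal_plus[symmetric] del: ennreal_plus)
  finally have "lux (\<lambda>x. u x + v x) \<le> a + b" using ab by (intro lux_le) auto
  then show "lux (\<lambda>x. u x + v x) \<le> lux u + lux v + e" by (simp add: a_def b_def)
qed

lemma lux_zero: "lux (\<lambda>x. 0) = 0"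
proof (rule antisym)
  show "lux (\<lambda>x. 0) \<le> 0"
    by (rule field_le_epsilon) (auto intro!: lux_le simp: modular_zero)
qed (rule lux_nonneg[OF L_zero])

lemma lux_mono:
  assumes "v \<in> L" "AE x in M. \<bar>u x\<bar> \<le> \<bar>v x\<bar>"
  shows "lux u \<le> lux v"
proof (rule field_le_epsilon)
  fix e :: real assume "e > 0"
  then have pos: "0 < lux v + e" using lux_nonneg[OF assms(1)] by simp
  have "\<rho> (\<lambda>x. u x / (lux v + e)) \<le> \<rho> (\<lambda>x. v x / (lux v + e))"
    by (rule modular_mono) (use assms(2) pos in \<open>auto elim!: eventually_mono intro!: divide_right_mono\<close>)
  also have "\<dots> \<le> 1" using \<open>e > 0\<close> by (intro modular_le_1_if_lux_less assms) simp
  finally show "lux u \<le> lux v + e" by (rule lux_le[OF pos])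
qed

lemma lux_scale_le:
  assumes "u \<in> L"
  shows "lux (\<lambda>x. c * u x) \<le> \<bar>c\<bar> * lux u"
proof (cases "c = 0")
  case True
  then show ?thesis by (simp add: lux_zero)
next
  case False
  show ?thesis
  proof (rule field_le_epsilon)
    fix e :: real assume "e > 0"
    define a where "a = lux u + e / \<bar>c\<bar>"
    have a: "0 < a" "lux u < a" using \<open>e > 0\<close> False lux_nonneg[OF assms] by (auto simp: a_def add_nonneg_pos)
    have "\<rho> (\<lambda>x. c * u x / (\<bar>c\<bar> * a)) \<le> \<rho> (\<lambda>x. u x / a)"
      using False by (intro modular_mono) (auto simp: abs_mult)
    also have "\<dots> \<le> 1" by (rule modular_le_1_if_lux_less[OF assms a(2)])
    finally have "lux (\<lambda>x. c * u x) \<le> \<bar>c\<bar> * a" using False a by (intro lux_le) auto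
    then show "lux (\<lambda>x. c * u x) \<le> \<bar>c\<bar> * lux u + e" using False by (simp add: a_def algebra_simps)
  qed
qed

lemma nn_integral_powr_le_1_if_lux_less:
  assumes "u \<in> L" "lux u < c" "0 < c"
  shows "(\<integral>\<^sup>+x. ennreal ((\<bar>u x\<bar> / c) powr p x) \<partial>M) \<le> 1"
proof -
  have "(\<integral>\<^sup>+x. ennreal ((\<bar>u x\<bar> / c) powr p x) \<partial>M) \<le> \<rho> (\<lambda>x. u x / c)"
    unfolding modular_def using assms(3)
    by (intro nn_integral_mono_AE AE_domain ennreal_leI) (auto simp: dphase_def abs_divide)
  then show ?thesis using modular_le_1_if_lux_less[OF assms(1,2)] by simp
qed

text \<open>
  The modular dominates \<open>\<integral> |u / c|\<^bsup>p(x)\<^esup>\<close>, which with \<open>p \<ge> 1\<close> controls the \<open>L\<^sup>1\<close> norm on a domain of finite measure.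
\<close>

lemma nn_integral_le_if_lux_less:
  assumes "u \<in> L" "lux u < c" "0 < c"
  shows "(\<integral>\<^sup>+x. ennreal \<bar>u x\<bar> \<partial>M) \<le> ennreal c * (emeasure M \<Omega> + 1)"
proof -
  have [measurable]: "u \<in> borel_measurable M" by (rule L_measurable[OF assms(1)])
  have [measurable]: "(\<lambda>x. (\<bar>u x\<bar> / c) powr p x) \<in> borel_measurable M"
    by (intro powr_real_measurable p_measurable) measurable
  have "(\<integral>\<^sup>+x. ennreal \<bar>u x\<bar> \<partial>M) \<le> (\<integral>\<^sup>+x. ennreal c * (1 + ennreal ((\<bar>u x\<bar> / c) powr p x)) \<partial>M)"
  proof (rule nn_integral_mono_AE, rule AE_domain)
    fix x assume x: "x \<in> \<Omega>" "0 \<le> \<mu> x"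
    have "\<bar>u x\<bar> / c \<le> 1 + (\<bar>u x\<bar> / c) powr p x"
      using le_add_powr_mult_powr[of "\<bar>u x\<bar> / c" 1 "p x"] p_bounds[OF x(1)] assms(3) by simp
    then have "\<bar>u x\<bar> \<le> c * (1 + (\<bar>u x\<bar> / c) powr p x)" using assms(3) by (simp add: field_simps)
    then show "ennreal \<bar>u x\<bar> \<le> ennreal c * (1 + ennreal ((\<bar>u x\<bar> / c) powr p x))"
      using assms(3) by (simp add: ennreal_leI ennreal_1[symmetric] ennreal_plus[symmetric] ennreal_mult[symmetric] del: ennreal_plus ennreal_1)
  qed
  also have "\<dots> = ennreal c * (emeasure M \<Omega> + (\<integral>\<^sup>+x. ennreal ((\<bar>u x\<bar> / c) powr p x) \<partial>M))"
    by (simp add: nn_integral_cmult nn_integral_add)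
  also have "\<dots> \<le> ennreal c * (emeasure M \<Omega> + 1)"
    by (intro mult_left_mono add_left_mono nn_integral_powr_le_1_if_lux_less assms) simp
  finally show ?thesis .
qed

section \<open>The spaces of weakly differentiable functions\<close>

abbreviation "W \<equiv> W_space \<Omega> H"
abbreviation "V \<equiv> W0_space \<Omega> H"
abbreviation "grad \<equiv> grad_norm \<Omega> H"
abbreviation "Wnorm \<equiv> W_norm \<Omega> H"

text \<open>
  By almost everywhere uniqueness the chosen weak gradient inherits measurability and finite modular
  from the one whose existence defines the space.
\<close>

lemma W_gradient:
  assumes "u \<in> W"
  shows "is_weak_gradient \<Omega> u (weak_gradient \<Omega> u)" "(\<lambda>x. norm (weak_gradient \<Omega> u x)) \<in> L"
proof -
  obtain g where g: "is_weak_gradient \<Omega> u g" "(\<lambda>x. norm (g x)) \<in> L"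
    using assms by (auto simp: W_space_def)
  show wg: "is_weak_gradient \<Omega> u (weak_gradient \<Omega> u)"
    unfolding weak_gradient_def using g(1) by (rule someI[where P = "is_weak_gradient \<Omega> u"])
  have ae: "AE x in M. weak_gradient \<Omega> u x = g x"
    by (rule weak_gradient_AE_eq[OF open_domain g(1)])
  have "(\<lambda>x. norm (weak_gradient \<Omega> u x)) \<in> borel_measurable M"
    by (rule borel_measurable_lebesgue_on_AE[OF _ L_measurable[OF g(2)]]) (use ae in \<open>auto elim: eventually_mono\<close>)
  then show "(\<lambda>x. norm (weak_gradient \<Omega> u x)) \<in> L"
    by (rule L_mono[OF g(2)]) (use ae in \<open>auto elim: eventually_mono\<close>)
qed

lemma grad_eq:
  assumes "u \<in> W" "is_weak_gradient \<Omega> u g"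
  shows "(\<lambda>x. norm (g x)) \<in> L" "grad u = lux (\<lambda>x. norm (g x))"
proof -
  have ae: "AE x in M. weak_gradient \<Omega> u x = g x"
    by (rule weak_gradient_AE_eq[OF open_domain assms(2)])
  have "(\<lambda>x. norm (g x)) \<in> borel_measurable M"
    by (rule borel_measurable_lebesgue_on_AE[OF _ L_measurable[OF W_gradient(2)[OF assms(1)]]])
       (use ae in \<open>auto elim: eventually_mono\<close>)
  then show L: "(\<lambda>x. norm (g x)) \<in> L"
    by (rule L_mono[OF W_gradient(2)[OF assms(1)]]) (use ae in \<open>auto elim: eventually_mono\<close>)
  show "grad u = lux (\<lambda>x. norm (g x))"
    unfolding grad_norm_def
    by (intro antisym lux_mono L W_gradient(2)[OF assms(1)]) (use ae in \<open>auto elim: eventually_mono\<close>)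
qed

lemma W_imp_L: "u \<in> W \<Longrightarrow> u \<in> L"
  by (simp add: W_space_def)

lemma W_linear:
  assumes u: "u \<in> W" and v: "v \<in> W"
  shows "(\<lambda>x. a * u x + b * v x) \<in> W"
    and "grad (\<lambda>x. a * u x + b * v x) \<le> \<bar>a\<bar> * grad u + \<bar>b\<bar> * grad v"
    and "Wnorm (\<lambda>x. a * u x + b * v x) \<le> \<bar>a\<bar> * Wnorm u + \<bar>b\<bar> * Wnorm v"
proof -
  let ?g = "weak_gradient \<Omega> u" and ?h = "weak_gradient \<Omega> v"
  note gL = W_gradient(2)[OF u] W_gradient(2)[OF v]
  have wg: "is_weak_gradient \<Omega> (\<lambda>x. a * u x + b * v x) (\<lambda>x. a *\<^sub>R ?g x + b *\<^sub>R ?h x)"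
    by (rule is_weak_gradient_linear[OF W_gradient(1)[OF u] W_gradient(1)[OF v]])
  have sumL: "(\<lambda>x. \<bar>a\<bar> * norm (?g x) + \<bar>b\<bar> * norm (?h x)) \<in> L"
    by (intro L_add L_scale gL)
  have g_meas: "?g \<in> borel_measurable M" "?h \<in> borel_measurable M"
  proof -
    \<comment> \<open>Integrability on compact sets makes the gradient measurable on boxes, and countably many boxes exhaust the domain.\<close>
    have "w \<in> W \<Longrightarrow> weak_gradient \<Omega> w \<in> borel_measurable M" for w
    proof -
      assume w: "w \<in> W"
      obtain \<D> where \<D>: "countable \<D>" "\<Union>\<D> = \<Omega>" "\<And>X. X \<in> \<D> \<Longrightarrow> \<exists>a b. X = cbox a b"
        using open_countable_Union_open_cbox[OF open_domain] by metis
      have loc: "(\<lambda>x. indicator K x *\<^sub>R weak_gradient \<Omega> w x) \<in> borel_measurable lebesgue" if "compact K" "K \<subseteq> \<Omega>" for K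
        using W_gradient(1)[OF w] that unfolding is_weak_gradient_def set_integrable_def
        by (auto intro: borel_measurable_integrable)
      show ?thesis
      proof (rule measurable_piecewise_restrict[OF \<D>(1)])
        show "space M \<subseteq> \<Union>\<D>" using \<D>(2) by simp
        fix X assume X: "X \<in> \<D>"
        then have "X \<subseteq> \<Omega>" using \<D>(2) by auto
        have "compact X" using \<D>(3)[OF X] by auto
        show "X \<inter> space M \<in> sets M"
          using \<open>X \<subseteq> \<Omega>\<close> \<D>(3)[OF X] by (auto simp: sets_restrict_space_iff Int_absorb2)
        have "weak_gradient \<Omega> w \<in> borel_measurable (lebesgue_on X)"
          using loc[OF \<open>compact X\<close> \<open>X \<subseteq> \<Omega>\<close>] \<D>(3)[OF X] by (subst borel_measurable_restrict_space_iff) auto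
        then show "weak_gradient \<Omega> w \<in> borel_measurable (restrict_space M X)"
          using \<open>X \<subseteq> \<Omega>\<close> \<D>(3)[OF X] by (subst restrict_restrict_space) (auto simp: Int_absorb1)
      qed
    qed
    then show "?g \<in> borel_measurable M" "?h \<in> borel_measurable M" using u v by blast+
  qed
  have le: "AE x in M. \<bar>norm (a *\<^sub>R ?g x + b *\<^sub>R ?h x)\<bar> \<le> \<bar>\<bar>a\<bar> * norm (?g x) + \<bar>b\<bar> * norm (?h x)\<bar>"
    by (intro AE_I2) (simp add: norm_triangle_le add_nonneg_nonneg abs_of_nonneg)
  have gradL: "(\<lambda>x. norm (a *\<^sub>R ?g x + b *\<^sub>R ?h x)) \<in> L"
    by (rule L_mono[OF sumL _ le], rule measurable_compose[OF _ borel_measurable_norm])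
       (intro borel_measurable_add borel_measurable_scaleR borel_measurable_const g_meas)
  show lin: "(\<lambda>x. a * u x + b * v x) \<in> W"
    using wg gradL u v by (auto simp: W_space_def intro!: L_add L_scale)
  have "grad (\<lambda>x. a * u x + b * v x) = lux (\<lambda>x. norm (a *\<^sub>R ?g x + b *\<^sub>R ?h x))"
    by (rule grad_eq(2)[OF lin wg])
  also have "\<dots> \<le> lux (\<lambda>x. \<bar>a\<bar> * norm (?g x) + \<bar>b\<bar> * norm (?h x))"
    by (rule lux_mono[OF sumL le])
  also have "\<dots> \<le> lux (\<lambda>x. \<bar>a\<bar> * norm (?g x)) + lux (\<lambda>x. \<bar>b\<bar> * norm (?h x))"
    by (intro lux_triangle L_scale gL)
  also have "\<dots> \<le> \<bar>a\<bar> * grad u + \<bar>b\<bar> * grad v"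
    unfolding grad_norm_def using lux_scale_le[OF gL(1), of "\<bar>a\<bar>"] lux_scale_le[OF gL(2), of "\<bar>b\<bar>"] by simp
  finally show g: "grad (\<lambda>x. a * u x + b * v x) \<le> \<bar>a\<bar> * grad u + \<bar>b\<bar> * grad v" .
  have "lux (\<lambda>x. a * u x + b * v x) \<le> lux (\<lambda>x. a * u x) + lux (\<lambda>x. b * v x)"
    by (intro lux_triangle L_scale W_imp_L u v)
  also have "\<dots> \<le> \<bar>a\<bar> * lux u + \<bar>b\<bar> * lux v"
    by (intro add_mono lux_scale_le W_imp_L u v)
  finally show "Wnorm (\<lambda>x. a * u x + b * v x) \<le> \<bar>a\<bar> * Wnorm u + \<bar>b\<bar> * Wnorm v"
    using g by (simp add: W_norm_def algebra_simps)
qed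

lemma grad_nonneg: "u \<in> W \<Longrightarrow> 0 \<le> grad u"
  unfolding grad_norm_def by (rule lux_nonneg[OF W_gradient(2)])

lemma grad_le_Wnorm: "u \<in> W \<Longrightarrow> grad u \<le> Wnorm u"
  and lux_le_Wnorm: "u \<in> W \<Longrightarrow> lux u \<le> Wnorm u"
  using lux_nonneg[OF W_imp_L, of u] grad_nonneg[of u] by (auto simp: W_norm_def)

lemma W_zero: "(\<lambda>x. 0) \<in> W"
  by (auto simp: W_space_def L_zero is_weak_gradient_def set_integrable_def set_lebesgue_integral_def
      intro!: exI[of _ "\<lambda>x. 0"])

lemma W_diff:
  assumes "u \<in> W" "v \<in> W"
  shows "u - v \<in> W" "Wnorm (u - v) \<le> Wnorm u + Wnorm v" "grad (u - v) \<le> grad u + grad v"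
proof -
  have "u - v = (\<lambda>x. 1 * u x + (- 1) * v x)" by (auto simp: fun_eq_iff)
  then show "u - v \<in> W" "Wnorm (u - v) \<le> Wnorm u + Wnorm v" "grad (u - v) \<le> grad u + grad v"
    using W_linear[OF assms, of 1 "-1"] by simp_all
qed

lemma W_diff_triangle:
  assumes "u \<in> W" "v \<in> W" "w \<in> W"
  shows "Wnorm (u - w) \<le> Wnorm (u - v) + Wnorm (v - w)" "grad (u - w) \<le> grad (u - v) + grad (v - w)"
proof -
  have "u - w = (\<lambda>x. 1 * (u - v) x + 1 * (v - w) x)" by (auto simp: fun_eq_iff)
  then show "Wnorm (u - w) \<le> Wnorm (u - v) + Wnorm (v - w)" "grad (u - w) \<le> grad (u - v) + grad (v - w)"
    using W_linear[OF W_diff(1)[OF assms(1,2)] W_diff(1)[OF assms(2,3)], of 1 1] by simp_all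
qed

lemma Wnorm_zero: "Wnorm (\<lambda>x. 0) = 0" "grad (\<lambda>x. 0) = 0"
proof -
  have "grad (\<lambda>x. 0) \<le> 0" using W_linear(2)[OF W_zero W_zero, of 0 0] by simp
  then show "grad (\<lambda>x. 0) = 0" using grad_nonneg[OF W_zero] by simp
  then show "Wnorm (\<lambda>x. 0) = 0" by (simp add: W_norm_def lux_zero)
qed

text \<open>
  The seminorm balls are open by the triangle inequality, so closure points are approximated in the seminorm.
\<close>

lemma V_iff: "u \<in> V \<longleftrightarrow> u \<in> W \<and> (\<forall>r>0. \<exists>\<phi>\<in>test_functions \<Omega>. \<phi> \<in> W \<and> Wnorm (\<phi> - u) < r)"
proof -
  let ?T = "norm_topology W Wnorm"
  have "openin ?T W" unfolding openin_norm_topology by (auto intro: exI[of _ 1])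
  moreover have "topspace ?T \<subseteq> W" using openin_norm_topology[of W Wnorm] by (metis openin_topspace)
  ultimately have top: "topspace ?T = W" using openin_subset by blast
  show ?thesis
  proof
    assume "u \<in> V"
    then have u: "u \<in> W" and cl: "\<And>U. openin ?T U \<Longrightarrow> u \<in> U \<Longrightarrow> \<exists>\<phi>. \<phi> \<in> test_functions \<Omega> \<and> \<phi> \<in> U"
      unfolding W0_space_def in_closure_of top by blast+
    have "\<exists>\<phi>\<in>test_functions \<Omega>. \<phi> \<in> W \<and> Wnorm (\<phi> - u) < r" if "r > 0" for r
    proof -
      let ?U = "{v \<in> W. Wnorm (v - u) < r}"
      have "openin ?T ?U"
        unfolding openin_norm_topology
      proof (intro conjI ballI)
        fix v assume v: "v \<in> ?U"
        have "w \<in> ?U" if "w \<in> W" "Wnorm (w - v) < r - Wnorm (v - u)" for w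
          using W_diff_triangle(1)[of w v u] that v u by auto
        then show "\<exists>d>0. \<forall>w\<in>W. Wnorm (w - v) < d \<longrightarrow> w \<in> ?U"
          using v by (intro exI[of _ "r - Wnorm (v - u)"]) auto
      qed auto
      moreover have "u - u = (\<lambda>x. 0)" by auto
      then have "u \<in> ?U" using u \<open>r > 0\<close> by (simp add: Wnorm_zero)
      ultimately show ?thesis using cl[of ?U] by blast
    qed
    with u show "u \<in> W \<and> (\<forall>r>0. \<exists>\<phi>\<in>test_functions \<Omega>. \<phi> \<in> W \<and> Wnorm (\<phi> - u) < r)" by blast
  next
    assume *: "u \<in> W \<and> (\<forall>r>0. \<exists>\<phi>\<in>test_functions \<Omega>. \<phi> \<in> W \<and> Wnorm (\<phi> - u) < r)"
    then show "u \<in> V"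
      unfolding W0_space_def in_closure_of top openin_norm_topology by (meson subsetD)
  qed
qed

lemma V_imp_W: "u \<in> V \<Longrightarrow> u \<in> W"
  by (simp add: V_iff)

lemma V_measurable: "u \<in> V \<Longrightarrow> u \<in> borel_measurable M"
  by (simp add: V_imp_W W_imp_L L_measurable)

lemma V_linear:
  assumes u: "u \<in> V" and v: "v \<in> V"
  shows "(\<lambda>x. a * u x + b * v x) \<in> V"
  unfolding V_iff
proof (intro conjI allI impI)
  show "(\<lambda>x. a * u x + b * v x) \<in> W" by (intro W_linear V_imp_W u v)
  fix r :: real assume r: "r > 0"
  define e where "e = r / (1 + \<bar>a\<bar> + \<bar>b\<bar>)"
  have e: "e > 0" using r by (simp add: e_def add_pos_nonneg)
  obtain \<phi> \<psi> where *: "\<phi> \<in> test_functions \<Omega>" "\<phi> \<in> W" "Wnorm (\<phi> - u) < e"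
      "\<psi> \<in> test_functions \<Omega>" "\<psi> \<in> W" "Wnorm (\<psi> - v) < e"
    using u v e unfolding V_iff by blast
  have eq: "(\<lambda>x. a * \<phi> x + b * \<psi> x) - (\<lambda>x. a * u x + b * v x) = (\<lambda>x. a * (\<phi> - u) x + b * (\<psi> - v) x)"
    by (auto simp: fun_eq_iff algebra_simps)
  have "Wnorm ((\<lambda>x. a * \<phi> x + b * \<psi> x) - (\<lambda>x. a * u x + b * v x)) \<le> \<bar>a\<bar> * Wnorm (\<phi> - u) + \<bar>b\<bar> * Wnorm (\<psi> - v)"
    unfolding eq by (intro W_linear(3) W_diff(1) * V_imp_W u v)
  also have "\<dots> \<le> \<bar>a\<bar> * e + \<bar>b\<bar> * e"
    using * by (intro add_mono mult_left_mono) auto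
  also have "\<dots> < (1 + \<bar>a\<bar> + \<bar>b\<bar>) * e" using e by (simp add: algebra_simps)
  also have "\<dots> = r"
    unfolding e_def by (simp add: add_pos_nonneg less_imp_neq[symmetric])
  finally have "Wnorm ((\<lambda>x. a * \<phi> x + b * \<psi> x) - (\<lambda>x. a * u x + b * v x)) < r" .
  then show "\<exists>\<theta>\<in>test_functions \<Omega>. \<theta> \<in> W \<and> Wnorm (\<theta> - (\<lambda>x. a * u x + b * v x)) < r"
    using * by (intro bexI[of _ "\<lambda>x. a * \<phi> x + b * \<psi> x"] conjI W_linear test_functions_add test_functions_cmult)
qed

lemma V_add: "u \<in> V \<Longrightarrow> v \<in> V \<Longrightarrow> (\<lambda>x. u x + v x) \<in> V"
  using V_linear[of u v 1 1] by simp

lemma V_scale: "u \<in> V \<Longrightarrow> (\<lambda>x. c * u x) \<in> V"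
  using V_linear[of u u c 0] by simp

lemma V_zero: "(\<lambda>x. 0) \<in> V"
proof -
  have "(\<lambda>x. 0) \<in> test_functions \<Omega>"
    by (simp add: test_functions_def k_times_cont_diff_const)
  moreover have "(\<lambda>x. 0) - (\<lambda>x. 0) = (\<lambda>x::'a. 0::real)" by auto
  ultimately show ?thesis unfolding V_iff using W_zero Wnorm_zero(1) by metis
qed

lemma V_diff: "u \<in> V \<Longrightarrow> v \<in> V \<Longrightarrow> u - v \<in> V"
  using V_linear[of u v 1 "-1"] by (simp add: fun_diff_def)

lemma grad_scale_le: "u \<in> W \<Longrightarrow> grad (\<lambda>x. c * u x) \<le> \<bar>c\<bar> * grad u"
  using W_linear(2)[of u u c 0] by simp

end

section \<open>The compact embedding\<close>

lemma AE_subseq_if_nn_integral_tendsto_0: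
  fixes w :: "nat \<Rightarrow> 'a \<Rightarrow> real"
  assumes [measurable]: "\<And>k. w k \<in> borel_measurable M"
    and le: "\<And>k. (\<integral>\<^sup>+x. ennreal \<bar>w k x\<bar> \<partial>M) \<le> ennreal (e k)" and e: "e \<longlonglongrightarrow> 0"
  obtains r where "strict_mono (r :: nat \<Rightarrow> nat)" "AE x in M. (\<lambda>k. w (r k) x) \<longlonglongrightarrow> 0"
proof -
  have int: "integrable M (w k)" for k
    by (rule integrableI_bounded) (use le[of k] in \<open>auto intro: le_less_trans\<close>)
  have "(\<lambda>k. LINT x|M. norm (w k x)) \<longlonglongrightarrow> 0"
  proof (rule tendsto_sandwich[OF _ _ tendsto_const])
    show "(\<lambda>k. max (e k) 0) \<longlonglongrightarrow> 0" using tendsto_max[OF e tendsto_const[of 0]] by simp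
    show "eventually (\<lambda>k. (LINT x|M. norm (w k x)) \<le> max (e k) 0) sequentially"
    proof (rule always_eventually, rule allI)
      fix k
      have "ennreal (LINT x|M. norm (w k x)) = (\<integral>\<^sup>+x. ennreal (norm (w k x)) \<partial>M)"
        by (rule nn_integral_eq_integral[symmetric]) (use int in auto)
      also have "\<dots> \<le> ennreal (max (e k) 0)"
        using le[of k] by (simp add: order_trans[OF _ ennreal_leI])
      finally show "(LINT x|M. norm (w k x)) \<le> max (e k) 0" by (simp add: ennreal_le_iff)
    qed
  qed auto
  from tendsto_L1_AE_subseq[OF int this] show ?thesis
    using that by blast
qed

context double_phase
begin

lemma nn_integral_lborel_eq_domain:
  assumes [measurable]: "h \<in> borel_measurable borel" and "\<And>x. x \<notin> \<Omega> \<Longrightarrow> h x = 0"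
  shows "(\<integral>\<^sup>+x. h x \<partial>lborel) = (\<integral>\<^sup>+x. h x \<partial>M)"
proof -
  have "(\<integral>\<^sup>+x. h x \<partial>M) = (\<integral>\<^sup>+x. h x * indicator \<Omega> x \<partial>lebesgue)"
    by (rule nn_integral_restrict_space) auto
  also have "\<dots> = (\<integral>\<^sup>+x. h x \<partial>lebesgue)"
    using assms(2) by (intro nn_integral_cong) (auto simp: indicator_def)
  also have "\<dots> = (\<integral>\<^sup>+x. h x \<partial>lborel)"
    by (rule nn_integral_completion)
  finally show ?thesis ..
qed

lemma AE_lborel_imp_AE_domain: "AE x in lborel. Q x \<Longrightarrow> AE x in M. Q x"
  by (subst AE_restrict_space_iff) (auto dest: AE_completion elim: eventually_mono)

definition "vol = measure M \<Omega>"

lemma vol: "emeasure M \<Omega> = ennreal vol" "0 \<le> vol"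
  using emeasure_domain by (auto simp: vol_def emeasure_eq_ennreal_measure less_top[symmetric])

lemma nn_integral_le_if_lux_less': "u \<in> L \<Longrightarrow> lux u < c \<Longrightarrow> 0 < c \<Longrightarrow> (\<integral>\<^sup>+x. ennreal \<bar>u x\<bar> \<partial>M) \<le> ennreal (c * (vol + 1))"
  using nn_integral_le_if_lux_less[of u c] vol
  by (simp add: ennreal_mult ennreal_plus ennreal_1[symmetric] del: ennreal_1)

context
  fixes \<phi> assumes test: "\<phi> \<in> test_functions \<Omega>" and W: "\<phi> \<in> W"
begin

lemma measurable_test_function: "\<phi> \<in> borel_measurable borel" "classical_gradient \<phi> \<in> borel_measurable borel"
  by (auto intro!: borel_measurable_continuous_onI continuous_on_test_function[OF test] continuous_on_classical_gradient[OF test])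

lemma grad_test_function:
  "(\<lambda>x. norm (classical_gradient \<phi> x)) \<in> L" "grad \<phi> = lux (\<lambda>x. norm (classical_gradient \<phi> x))"
  using grad_eq[OF W classical_gradient_is_weak_gradient[OF test]] by auto

lemma nn_integral_gradient_test_function_le:
  assumes "grad \<phi> < c" "0 < c"
  shows "(\<integral>\<^sup>+x. ennreal (norm (classical_gradient \<phi> x)) \<partial>lborel) \<le> ennreal (c * (vol + 1))"
proof -
  note [measurable] = measurable_test_function
  have "(\<integral>\<^sup>+x. ennreal (norm (classical_gradient \<phi> x)) \<partial>lborel) = (\<integral>\<^sup>+x. ennreal (norm (classical_gradient \<phi> x)) \<partial>M)"
    by (rule nn_integral_lborel_eq_domain) (auto simp: classical_gradient_eq_0[OF test])
  then show ?thesis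
    using nn_integral_le_if_lux_less'[OF grad_test_function(1), of c] grad_test_function(2) assms by simp
qed

end

lemma test_function_poincare:
  "\<exists>C\<ge>0. \<forall>\<phi>\<in>test_functions \<Omega>. \<phi> \<in> W \<longrightarrow> (\<forall>c>0. grad \<phi> < c \<longrightarrow>
     (\<integral>\<^sup>+x. ennreal \<bar>\<phi> x\<bar> \<partial>lborel) \<le> ennreal (C * c))"
proof -
  obtain C where C: "0 \<le> C" "\<And>(u :: 'a \<Rightarrow> real) D. (\<forall>x. (u has_derivative (\<lambda>v. D x \<bullet> v)) (at x)) \<Longrightarrow>
    continuous_on UNIV D \<Longrightarrow> (\<forall>x. x \<notin> \<Omega> \<longrightarrow> u x = 0) \<Longrightarrow>
    (\<integral>\<^sup>+x. ennreal \<bar>u x\<bar> \<partial>lborel) \<le> ennreal C * (\<integral>\<^sup>+x. ennreal (norm (D x)) \<partial>lborel)"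
    using poincare_inequality_L1[OF bounded_domain] by blast
  show ?thesis
  proof (intro exI[of _ "C * (vol + 1)"] conjI ballI allI impI)
    fix \<phi> c assume \<phi>: "\<phi> \<in> test_functions \<Omega>" "\<phi> \<in> W" and c: "0 < c" "grad \<phi> < c"
    have "(\<integral>\<^sup>+x. ennreal \<bar>\<phi> x\<bar> \<partial>lborel) \<le> ennreal C * (\<integral>\<^sup>+x. ennreal (norm (classical_gradient \<phi> x)) \<partial>lborel)"
      by (intro C(2) allI impI test_function_has_derivative[OF \<phi>(1)] continuous_on_classical_gradient[OF \<phi>(1)]
          test_function_eq_0[OF \<phi>(1)])
    also have "\<dots> \<le> ennreal C * ennreal (c * (vol + 1))"
      by (intro mult_left_mono nn_integral_gradient_test_function_le[OF \<phi> c(2,1)]) simp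
    also have "\<dots> = ennreal (C * (vol + 1) * c)"
      using C(1) c vol(2) by (simp add: ennreal_mult[symmetric] mult_ac)
    finally show "(\<integral>\<^sup>+x. ennreal \<bar>\<phi> x\<bar> \<partial>lborel) \<le> ennreal (C * (vol + 1) * c)" .
  qed (use C vol in simp)
qed

text \<open>
  What approximation in the norm of \<open>W\<close> contributes to the embedding: test functions that are close in
  \<open>L\<^sup>1\<close> and whose gradient norm is almost that of \<open>u\<close>.
\<close>

lemma V_approx:
  assumes "u \<in> V" "0 < e"
  obtains \<phi> where "\<phi> \<in> test_functions \<Omega>" "\<phi> \<in> W" "grad \<phi> < grad u + e"
    "(\<integral>\<^sup>+x. ennreal \<bar>\<phi> x - u x\<bar> \<partial>M) \<le> ennreal (e * (vol + 1))"
proof -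
  obtain \<phi> where \<phi>: "\<phi> \<in> test_functions \<Omega>" "\<phi> \<in> W" "Wnorm (\<phi> - u) < e"
    using assms unfolding V_iff by blast
  have W: "\<phi> - u \<in> W" using W_diff(1)[OF \<phi>(2) V_imp_W[OF assms(1)]] .
  have "\<phi> = (\<lambda>x. 1 * (\<phi> - u) x + 1 * u x)" by auto
  then have "grad \<phi> \<le> grad (\<phi> - u) + grad u"
    using W_linear(2)[OF W V_imp_W[OF assms(1)], of 1 1] by simp
  moreover have "grad (\<phi> - u) < e" using grad_le_Wnorm[OF W] \<phi>(3) by simp
  moreover have "lux (\<phi> - u) < e" using lux_le_Wnorm[OF W] \<phi>(3) by simp
  then have "(\<integral>\<^sup>+x. ennreal \<bar>\<phi> x - u x\<bar> \<partial>M) \<le> ennreal (e * (vol + 1))"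
    using nn_integral_le_if_lux_less'[OF W_imp_L[OF W]] assms(2) by simp
  ultimately show ?thesis using that \<phi> by simp
qed

lemma V_approx_sequence:
  assumes "\<And>k. u k \<in> V" "\<And>k :: nat. 0 < e k"
  obtains \<phi> where "\<And>k. \<phi> k \<in> test_functions \<Omega>" "\<And>k. \<phi> k \<in> W" "\<And>k. grad (\<phi> k) < grad (u k) + e k"
    "\<And>k. (\<integral>\<^sup>+x. ennreal \<bar>\<phi> k x - u k x\<bar> \<partial>M) \<le> ennreal (e k * (vol + 1))"
proof -
  let ?P = "\<lambda>k \<phi>. \<phi> \<in> test_functions \<Omega> \<and> \<phi> \<in> W \<and> grad \<phi> < grad (u k) + e k \<and>
      (\<integral>\<^sup>+x. ennreal \<bar>\<phi> x - u k x\<bar> \<partial>M) \<le> ennreal (e k * (vol + 1))"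
  have "\<forall>k. \<exists>\<phi>. ?P k \<phi>"
  proof
    fix k show "\<exists>\<phi>. ?P k \<phi>" by (rule V_approx[OF assms(1)[of k] assms(2)[of k]]) blast
  qed
  from choice[OF this] obtain \<phi> where "\<forall>k. ?P k (\<phi> k)" by blast
  then show ?thesis using that[of \<phi>] by blast
qed

lemma V_poincare: "\<exists>C\<ge>0. \<forall>u\<in>V. (\<integral>\<^sup>+x. ennreal \<bar>u x\<bar> \<partial>M) \<le> ennreal (C * grad u)"
proof -
  obtain C where C: "0 \<le> C" "\<And>\<phi> c. \<phi> \<in> test_functions \<Omega> \<Longrightarrow> \<phi> \<in> W \<Longrightarrow> 0 < c \<Longrightarrow> grad \<phi> < c \<Longrightarrow>
     (\<integral>\<^sup>+x. ennreal \<bar>\<phi> x\<bar> \<partial>lborel) \<le> ennreal (C * c)"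
    using test_function_poincare by blast
  show ?thesis
  proof (intro exI[of _ C] conjI ballI)
    fix u assume u: "u \<in> V"
    have [measurable]: "u \<in> borel_measurable M" by (rule V_measurable[OF u])
    have gu: "0 \<le> grad u" by (rule grad_nonneg[OF V_imp_W[OF u]])
    show "(\<integral>\<^sup>+x. ennreal \<bar>u x\<bar> \<partial>M) \<le> ennreal (C * grad u)"
    proof (rule ennreal_le_epsilon)
      fix \<epsilon> :: real assume \<epsilon>: "0 < \<epsilon>"
      define e where "e = \<epsilon> / (C + vol + 1)"
      have den: "0 < C + vol + 1" using C(1) vol(2) by simp
      have "e * (C + vol + 1) = \<epsilon>" using den by (simp add: e_def)
      then have e: "0 < e" "C * e + e * (vol + 1) = \<epsilon>"
        using \<epsilon> den by (simp_all add: e_def algebra_simps del: times_divide_eq_right times_divide_eq_left)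
      obtain \<phi> where \<phi>: "\<phi> \<in> test_functions \<Omega>" "\<phi> \<in> W" "grad \<phi> < grad u + e"
        "(\<integral>\<^sup>+x. ennreal \<bar>\<phi> x - u x\<bar> \<partial>M) \<le> ennreal (e * (vol + 1))"
        using V_approx[OF u e(1)] .
      have [measurable]: "\<phi> \<in> borel_measurable borel" by (rule measurable_test_function(1)[OF \<phi>(1,2)])
      have [measurable]: "\<phi> \<in> borel_measurable M" by (rule L_measurable[OF W_imp_L[OF \<phi>(2)]])
      have "(\<integral>\<^sup>+x. ennreal \<bar>u x\<bar> \<partial>M) \<le> (\<integral>\<^sup>+x. ennreal \<bar>\<phi> x\<bar> + ennreal \<bar>\<phi> x - u x\<bar> \<partial>M)"
        by (intro nn_integral_mono) (auto simp: ennreal_plus[symmetric] simp del: ennreal_plus intro!: ennreal_leI)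
      also have "\<dots> = (\<integral>\<^sup>+x. ennreal \<bar>\<phi> x\<bar> \<partial>M) + (\<integral>\<^sup>+x. ennreal \<bar>\<phi> x - u x\<bar> \<partial>M)"
        by (rule nn_integral_add) measurable
      also have "(\<integral>\<^sup>+x. ennreal \<bar>\<phi> x\<bar> \<partial>M) = (\<integral>\<^sup>+x. ennreal \<bar>\<phi> x\<bar> \<partial>lborel)"
        by (rule nn_integral_lborel_eq_domain[symmetric]) (auto simp: test_function_eq_0[OF \<phi>(1)])
      also have "\<dots> \<le> ennreal (C * (grad u + e))"
        by (rule C(2)[OF \<phi>(1,2) _ \<phi>(3)]) (use gu e in simp)
      also have "ennreal (C * (grad u + e)) + (\<integral>\<^sup>+x. ennreal \<bar>\<phi> x - u x\<bar> \<partial>M) \<le>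
          ennreal (C * (grad u + e)) + ennreal (e * (vol + 1))"
        by (intro add_left_mono \<phi>(4))
      also have "\<dots> = ennreal (C * grad u + (C * e + e * (vol + 1)))"
        using C(1) gu e vol(2) by (subst ennreal_plus[symmetric]) (auto simp: algebra_simps)
      also have "\<dots> = ennreal (C * grad u) + ennreal \<epsilon>"
        unfolding e(2) using C(1) gu \<epsilon> by simp
      finally show "(\<integral>\<^sup>+x. ennreal \<bar>u x\<bar> \<partial>M) \<le> ennreal (C * grad u) + ennreal \<epsilon>" by (simp add: add_mono)
    qed
  qed (rule C(1))
qed

text \<open>
  Each \<open>u k\<close> is replaced by a test function at \<open>L\<^sup>1\<close> distance \<open>O(1 / k)\<close>.  The test functions have bounded gradients in
  \<open>L\<^sup>1\<close>, hence a subsequence converging almost everywhere, and along a further subsequence the errors tend to \<open>0\<close>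
  almost everywhere.
\<close>

lemma V_AE_compact:
  assumes u: "\<And>k. u k \<in> V" and R: "\<And>k. grad (u k) \<le> R"
  obtains r v where "strict_mono (r :: nat \<Rightarrow> nat)" "v \<in> borel_measurable M" "AE x in M. (\<lambda>k. u (r k) x) \<longlonglongrightarrow> v x"
proof -
  define e :: "nat \<Rightarrow> real" where "e k = inverse (real (Suc k))" for k
  have e: "0 < e k" "e k \<le> 1" for k by (auto simp: e_def field_simps)
  have elim: "e \<longlonglongrightarrow> 0" unfolding e_def by (rule LIMSEQ_inverse_real_of_nat)
  obtain \<phi> where \<phi>: "\<And>k. \<phi> k \<in> test_functions \<Omega>" "\<And>k. \<phi> k \<in> W" "\<And>k. grad (\<phi> k) < grad (u k) + e k"
    "\<And>k. (\<integral>\<^sup>+x. ennreal \<bar>\<phi> k x - u k x\<bar> \<partial>M) \<le> ennreal (e k * (vol + 1))"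
    using V_approx_sequence[of "\<lambda>k. u k" e, OF u e(1)] by blast
  define c where "c = max R 0 + 1"
  have c: "0 < c" "grad (\<phi> k) < c" for k
    using \<phi>(3)[of k] R[of k] e(2)[of k] by (auto simp: c_def)
  obtain C where C: "0 \<le> C" "\<And>\<phi> c. \<phi> \<in> test_functions \<Omega> \<Longrightarrow> \<phi> \<in> W \<Longrightarrow> 0 < c \<Longrightarrow> grad \<phi> < c \<Longrightarrow>
     (\<integral>\<^sup>+x. ennreal \<bar>\<phi> x\<bar> \<partial>lborel) \<le> ennreal (C * c)"
    using test_function_poincare by blast
  define B where "B = max (C * c) (c * (vol + 1))"
  obtain r1 where r1: "strict_mono (r1 :: nat \<Rightarrow> nat)"
    "\<And>\<epsilon>. 0 < \<epsilon> \<Longrightarrow> \<exists>n0. \<forall>j\<ge>n0. \<forall>k\<ge>n0. (\<integral>\<^sup>+x. ennreal \<bar>\<phi> (r1 j) x - \<phi> (r1 k) x\<bar> \<partial>lborel) < ennreal \<epsilon>"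
  proof (rule L1_Cauchy_subsequence[of \<phi> "\<lambda>k. classical_gradient (\<phi> k)" B \<Omega>])
    show "(\<integral>\<^sup>+x. ennreal \<bar>\<phi> k x\<bar> \<partial>lborel) \<le> ennreal B" for k
      by (rule order_trans[OF C(2)[OF \<phi>(1,2) c]]) (auto simp: B_def intro!: ennreal_leI)
    show "(\<integral>\<^sup>+x. ennreal (norm (classical_gradient (\<phi> k) x)) \<partial>lborel) \<le> ennreal B" for k
      by (rule order_trans[OF nn_integral_gradient_test_function_le[OF \<phi>(1,2) c(2,1)]])
         (auto simp: B_def intro!: ennreal_leI)
    show "0 \<le> B" using C(1) c(1) by (auto simp: B_def le_max_iff_disj)
  qed (auto intro: test_function_has_derivative[OF \<phi>(1)] continuous_on_classical_gradient[OF \<phi>(1)]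
      bounded_domain test_function_eq_0[OF \<phi>(1)])
  have \<phi>_meas: "\<phi> k \<in> borel_measurable lborel" for k
    using measurable_test_function(1)[OF \<phi>(1,2)] by simp
  obtain q v where q: "strict_mono (q :: nat \<Rightarrow> nat)" "v \<in> borel_measurable lborel"
    "AE x in lborel. (\<lambda>n. \<phi> (r1 (q n)) x) \<longlonglongrightarrow> v x"
    using L1_Cauchy_imp_AE_convergent_subsequence[of "\<lambda>k. \<phi> (r1 k)" lborel, OF \<phi>_meas r1(2)] by blast
  define r2 where "r2 = r1 \<circ> q"
  have r2: "strict_mono r2" unfolding r2_def by (rule strict_mono_o[OF r1(1) q(1)])
  have "(\<lambda>k. e (r2 k) * (vol + 1)) \<longlonglongrightarrow> 0 * (vol + 1)"
    using LIMSEQ_subseq_LIMSEQ[OF elim r2] by (intro tendsto_intros) (simp add: o_def)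
  then obtain r3 where r3: "strict_mono (r3 :: nat \<Rightarrow> nat)"
    "AE x in M. (\<lambda>k. \<phi> (r2 (r3 k)) x - u (r2 (r3 k)) x) \<longlonglongrightarrow> 0"
    using AE_subseq_if_nn_integral_tendsto_0[of "\<lambda>k x. \<phi> (r2 k) x - u (r2 k) x" M "\<lambda>k. e (r2 k) * (vol + 1)"]
      \<phi>(4) L_measurable[OF W_imp_L[OF \<phi>(2)]] V_measurable[OF u] by (auto intro!: borel_measurable_diff)
  have "AE x in M. (\<lambda>n. \<phi> (r2 n) x) \<longlonglongrightarrow> v x"
    using AE_lborel_imp_AE_domain[OF q(3)] by (simp add: r2_def)
  with r3(2) have "AE x in M. (\<lambda>k. u (r2 (r3 k)) x) \<longlonglongrightarrow> v x"
  proof eventually_elim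
    case (elim x)
    have "(\<lambda>k. \<phi> (r2 (r3 k)) x) \<longlonglongrightarrow> v x"
      using LIMSEQ_subseq_LIMSEQ[OF elim(2) r3(1)] by (simp add: o_def)
    from tendsto_diff[OF this elim(1)] show ?case by simp
  qed
  moreover have "v \<in> borel_measurable M"
    using q(2) by (intro measurable_restrict_space1 measurable_completion)
  ultimately show ?thesis
    using that[of "r2 \<circ> r3" v] strict_mono_o[OF r2 r3(1)] by (simp add: o_def)
qed

end

text \<open>
  The exponent \<open>t\<close> lies pointwise below the critical exponent of \<open>p\<close>; the condition is multiplied out
  so that it is continuous in both exponents.
\<close>

locale subcritical = double_phase +
  fixes t :: "'a \<Rightarrow> real"
  assumes p_cont: "continuous_on (closure \<Omega>) p" and t_cont: "continuous_on (closure \<Omega>) t"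
    and p_strict: "\<And>x. x \<in> closure \<Omega> \<Longrightarrow> 1 < p x \<and> p x < real DIM('a)"
    and t_pos: "\<And>x. x \<in> closure \<Omega> \<Longrightarrow> 0 < t x"
    and t_subcritical: "\<And>x. x \<in> closure \<Omega> \<Longrightarrow> t x * (real DIM('a) - p x) < real DIM('a) * p x"
begin

lemma t_measurable: "t \<in> borel_measurable M"
  by (rule continuous_imp_measurable_on_sets_lebesgue[OF continuous_on_subset[OF t_cont closure_subset]]) simp

lemma measurable_powr_t: "u \<in> borel_measurable M \<Longrightarrow> (\<lambda>x. ennreal (\<bar>u x\<bar> powr t x)) \<in> borel_measurable M"
  by (intro measurable_compose[OF _ measurable_ennreal] powr_real_measurable t_measurable) measurable

text \<open>
  Fatou's lemma: modular bounds survive almost everywhere limits.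
\<close>

lemma modular_t_le_if_AE_tendsto:
  assumes u: "\<And>k. u k \<in> borel_measurable M" "\<And>k. (\<integral>\<^sup>+x. ennreal (\<bar>u k x\<bar> powr t x) \<partial>M) \<le> ennreal K"
    and lim: "AE x in M. (\<lambda>k. u k x) \<longlonglongrightarrow> v x"
  shows "(\<integral>\<^sup>+x. ennreal (\<bar>v x\<bar> powr t x) \<partial>M) \<le> ennreal K"
proof -
  have "(\<integral>\<^sup>+x. ennreal (\<bar>v x\<bar> powr t x) \<partial>M) \<le> (\<integral>\<^sup>+x. liminf (\<lambda>k. ennreal (\<bar>u k x\<bar> powr t x)) \<partial>M)"
  proof (rule nn_integral_mono_AE)
    show "AE x in M. ennreal (\<bar>v x\<bar> powr t x) \<le> liminf (\<lambda>k. ennreal (\<bar>u k x\<bar> powr t x))"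
      using lim AE_space[of M]
    proof eventually_elim
      case (elim x)
      then have "0 < t x" using t_pos[of x] closure_subset[of \<Omega>] by auto
      then have "(\<lambda>k. \<bar>u k x\<bar> powr t x) \<longlonglongrightarrow> \<bar>v x\<bar> powr t x"
        using elim(1) by (intro tendsto_powr2 tendsto_rabs tendsto_const) auto
      from lim_imp_Liminf[OF _ tendsto_ennrealI[OF this]] show ?case by simp
    qed
  qed
  also have "\<dots> \<le> liminf (\<lambda>k. \<integral>\<^sup>+x. ennreal (\<bar>u k x\<bar> powr t x) \<partial>M)"
    by (intro nn_integral_liminf measurable_powr_t u)
  also have "\<dots> \<le> liminf (\<lambda>k::nat. ennreal K)"
    by (intro Liminf_mono always_eventually allI u)
  finally show ?thesis by (simp add: Liminf_const)
qed

text \<open>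
  On a ball where the exponents oscillate little, \<open>p\<close> may be replaced by a constant \<open>r\<close> below it and
  \<open>t\<close> by a constant \<open>\<sigma>\<close> above it, still with \<open>\<sigma>\<close> subcritical for \<open>r\<close>.
\<close>

lemma local_embedding:
  assumes x0: "x0 \<in> closure \<Omega>"
  shows "\<exists>\<delta>>0. \<exists>K\<ge>0. \<forall>\<phi>\<in>test_functions \<Omega>. \<phi> \<in> W \<longrightarrow> grad \<phi> < 1 \<longrightarrow>
    (\<integral>\<^sup>+x. ennreal (\<bar>\<phi> x\<bar> powr t x) * indicator (ball x0 \<delta>) x \<partial>M) \<le> ennreal K"
proof -
  define N where "N = real DIM('a)"
  have N: "1 \<le> N" by (simp add: N_def DIM_positive Suc_leI)
  have "((\<lambda>\<eta>. N * (p x0 - \<eta>) - (t x0 + \<eta>) * (N - (p x0 - \<eta>))) \<longlongrightarrow> N * (p x0 - 0) - (t x0 + 0) * (N - (p x0 - 0))) (at_right 0)"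
    by (intro tendsto_intros)
  then have ev1: "eventually (\<lambda>\<eta>. 0 < N * (p x0 - \<eta>) - (t x0 + \<eta>) * (N - (p x0 - \<eta>))) (at_right 0)"
    using t_subcritical[OF x0] by (intro order_tendstoD(1)) (auto simp: N_def)
  have "((\<lambda>\<eta>. p x0 - \<eta>) \<longlongrightarrow> p x0 - 0) (at_right 0)" by (intro tendsto_intros)
  then have ev2: "eventually (\<lambda>\<eta>. 1 < p x0 - \<eta>) (at_right 0)"
    using p_strict[OF x0] by (intro order_tendstoD(1)) auto
  have "eventually (\<lambda>\<eta>. 0 < \<eta> \<and> 1 < p x0 - \<eta> \<and> 0 < N * (p x0 - \<eta>) - (t x0 + \<eta>) * (N - (p x0 - \<eta>))) (at_right (0::real))"
    using ev1 ev2 eventually_at_right_less by eventually_elim auto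
  then obtain \<eta> where \<eta>: "0 < \<eta>" "1 < p x0 - \<eta>" "0 < N * (p x0 - \<eta>) - (t x0 + \<eta>) * (N - (p x0 - \<eta>))"
    using eventually_happens'[OF trivial_limit_at_right_real] by blast
  define r \<sigma> where "r = p x0 - \<eta>" and "\<sigma> = t x0 + \<eta>"
  have r: "1 \<le> r" "r < N" and \<sigma>: "0 < \<sigma>" "\<sigma> * (N - r) < N * r"
    using \<eta> p_strict[OF x0] t_pos[OF x0] by (auto simp: r_def \<sigma>_def N_def)
  obtain d1 where d1: "0 < d1" "\<And>y. y \<in> closure \<Omega> \<Longrightarrow> dist y x0 < d1 \<Longrightarrow> dist (p y) (p x0) < \<eta>"
    using p_cont x0 \<eta>(1) unfolding continuous_on_iff by metis
  obtain d2 where d2: "0 < d2" "\<And>y. y \<in> closure \<Omega> \<Longrightarrow> dist y x0 < d2 \<Longrightarrow> dist (t y) (t x0) < \<eta>"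
    using t_cont x0 \<eta>(1) unfolding continuous_on_iff by metis
  define \<delta> where "\<delta> = min d1 d2 / 2"
  have \<delta>: "0 < \<delta>" using d1(1) d2(1) by (simp add: \<delta>_def)
  have r_le: "r \<le> p y" if "y \<in> \<Omega>" "dist y x0 < 2 * \<delta>" for y
    using d1(2)[of y] that closure_subset[of \<Omega>] by (auto simp: \<delta>_def r_def dist_real_def)
  have \<sigma>_ge: "t y \<le> \<sigma>" if "y \<in> \<Omega>" "dist y x0 < 2 * \<delta>" for y
    using d2(2)[of y] that closure_subset[of \<Omega>] by (auto simp: \<delta>_def \<sigma>_def dist_real_def)
  obtain C where C: "0 \<le> C" "\<And>\<phi> c. \<phi> \<in> test_functions \<Omega> \<Longrightarrow> \<phi> \<in> W \<Longrightarrow> 0 < c \<Longrightarrow> grad \<phi> < c \<Longrightarrow>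
     (\<integral>\<^sup>+x. ennreal \<bar>\<phi> x\<bar> \<partial>lborel) \<le> ennreal (C * c)"
    using test_function_poincare by blast
  \<comment> \<open>Segments of relative length \<open>b\<close> have length at most \<open>\<delta>\<close>, so from \<open>ball x0 \<delta>\<close> they stay in \<open>ball x0 (2 * \<delta>)\<close>.\<close>
  define b where "b = \<delta> / N"
  have b: "0 < b" using \<delta> N by (simp add: b_def)
  obtain m where m: "emeasure lborel (ball x0 \<delta>) = ennreal m"
    using emeasure_bounded_finite[OF bounded_ball, of x0 \<delta>] by (cases "emeasure lborel (ball x0 \<delta>)") auto
  have vol1: "0 \<le> vol + 1" using vol(2) by simp
  define bound where "bound K \<longleftrightarrow> (\<forall>E (u :: 'a \<Rightarrow> real) D g. (\<forall>x. (u has_derivative (\<lambda>v. D x \<bullet> v)) (at x)) \<longrightarrow>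
    continuous_on UNIV D \<longrightarrow> (\<integral>\<^sup>+y. ennreal \<bar>u y\<bar> \<partial>lborel) \<le> ennreal C \<longrightarrow>
    g \<in> borel_measurable borel \<longrightarrow> (\<forall>y. 0 \<le> g y) \<longrightarrow>
    (\<integral>\<^sup>+y. ennreal (g y powr r) \<partial>lborel) \<le> ennreal (vol + 1) \<longrightarrow>
    E \<in> sets borel \<longrightarrow> emeasure lborel E \<le> ennreal m \<longrightarrow>
    (\<forall>x\<in>E. \<forall>\<tau>\<in>{0..b}. \<forall>z\<in>cbox 0 One. norm (D (x + \<tau> *\<^sub>R z)) \<le> g (x + \<tau> *\<^sub>R z)) \<longrightarrow>
    (\<integral>\<^sup>+x. ennreal (\<bar>u x\<bar> powr \<sigma>) * indicator E x \<partial>lborel) \<le> ennreal K)" for K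
  have "\<exists>K. bound K"
    unfolding bound_def
    by (rule subcritical_sobolev_inequality[where 'a = 'a and m = m, OF r[unfolded N_def] \<sigma>[unfolded N_def] vol1 C(1) b])
  then obtain K where "bound K" by blast
  note K = this[unfolded bound_def, rule_format]
  show ?thesis
  proof (rule exI[of _ \<delta>], rule conjI[OF \<delta>], rule exI[of _ "vol + max K 0"], intro conjI ballI impI)
    show "0 \<le> vol + max K 0" using vol(2) by simp
    fix \<phi> assume \<phi>: "\<phi> \<in> test_functions \<Omega>" "\<phi> \<in> W" "grad \<phi> < 1"
    let ?D = "classical_gradient \<phi>"
    note [measurable] = measurable_test_function[OF \<phi>(1,2)]
    have \<phi>M [measurable]: "\<phi> \<in> borel_measurable M" by (rule L_measurable[OF W_imp_L[OF \<phi>(2)]])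
    define g where "g y = norm (?D y) * indicator (ball x0 (2 * \<delta>)) y" for y
    have [measurable]: "ball x0 \<delta> \<in> sets borel" "ball x0 (2 * \<delta>) \<in> sets borel" by simp_all
    have [measurable]: "g \<in> borel_measurable borel" unfolding g_def by measurable
    have "(\<integral>\<^sup>+y. ennreal (g y powr r) \<partial>lborel) = (\<integral>\<^sup>+y. ennreal (g y powr r) \<partial>M)"
      by (rule nn_integral_lborel_eq_domain) (auto simp: g_def classical_gradient_eq_0[OF \<phi>(1)])
    also have "\<dots> \<le> (\<integral>\<^sup>+y. 1 + ennreal ((\<bar>norm (?D y)\<bar> / 1) powr p y) \<partial>M)"
    proof (rule nn_integral_mono)
      fix y assume "y \<in> space M"
      then have y: "y \<in> \<Omega>" by simp
      have "g y powr r \<le> 1 + norm (?D y) powr p y"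
        using powr_le_1_add_powr[of "norm (?D y)" r "p y"] r_le[OF y] r(1)
        by (auto simp: g_def indicator_def dist_commute add_increasing)
      then show "ennreal (g y powr r) \<le> 1 + ennreal ((\<bar>norm (?D y)\<bar> / 1) powr p y)"
        by (simp add: ennreal_leI ennreal_1[symmetric] ennreal_plus[symmetric] del: ennreal_1 ennreal_plus)
    qed
    also have "\<dots> = emeasure M \<Omega> + (\<integral>\<^sup>+y. ennreal ((\<bar>norm (?D y)\<bar> / 1) powr p y) \<partial>M)"
    proof -
      have [measurable]: "(\<lambda>y. norm (?D y)) \<in> borel_measurable M"
        by (rule L_measurable[OF grad_test_function(1)[OF \<phi>(1,2)]])
      have "(\<lambda>y. ennreal ((\<bar>norm (?D y)\<bar> / 1) powr p y)) \<in> borel_measurable M"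
        by (intro measurable_compose[OF _ measurable_ennreal] powr_real_measurable p_measurable) measurable
      then show ?thesis by (subst nn_integral_add) auto
    qed
    also have "\<dots> \<le> ennreal vol + 1"
      unfolding vol(1)
      by (intro add_left_mono nn_integral_powr_le_1_if_lux_less grad_test_function(1)[OF \<phi>(1,2)])
         (use \<phi>(3) in \<open>simp_all add: grad_test_function(2)[OF \<phi>(1,2)]\<close>)
    also have "\<dots> = ennreal (vol + 1)" using vol(2) by simp
    finally have g_int: "(\<integral>\<^sup>+y. ennreal (g y powr r) \<partial>lborel) \<le> ennreal (vol + 1)" .
    have "(\<integral>\<^sup>+x. ennreal (\<bar>\<phi> x\<bar> powr \<sigma>) * indicator (ball x0 \<delta>) x \<partial>lborel) \<le> ennreal K"
    proof (rule K[where D = ?D and g = g])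
      show "(\<integral>\<^sup>+y. ennreal \<bar>\<phi> y\<bar> \<partial>lborel) \<le> ennreal C"
        using C(2)[OF \<phi>(1,2), of 1] \<phi>(3) by simp
      show "norm (?D (x + \<tau> *\<^sub>R z)) \<le> g (x + \<tau> *\<^sub>R z)"
        if *: "x \<in> ball x0 \<delta>" "\<tau> \<in> {0..b}" "z \<in> cbox 0 One" for x \<tau> and z :: 'a
      proof -
        have "norm (\<tau> *\<^sub>R z) \<le> b * N"
          using * norm_le_DIM_if_unit_cube[OF *(3)] unfolding N_def by (auto intro!: mult_mono)
        then have "norm (\<tau> *\<^sub>R z) \<le> \<delta>" using N by (simp add: b_def)
        then have "dist x0 (x + \<tau> *\<^sub>R z) < 2 * \<delta>"
          using *(1) norm_triangle_ineq4[of "x0 - x" "\<tau> *\<^sub>R z"] by (simp add: dist_norm diff_diff_eq)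
        then show "norm (?D (x + \<tau> *\<^sub>R z)) \<le> g (x + \<tau> *\<^sub>R z)" by (simp add: g_def)
      qed
    qed (use \<phi> g_int m in \<open>auto intro: test_function_has_derivative continuous_on_classical_gradient simp: g_def\<close>)
    moreover have "(\<integral>\<^sup>+x. ennreal (\<bar>\<phi> x\<bar> powr \<sigma>) * indicator (ball x0 \<delta>) x \<partial>lborel) =
        (\<integral>\<^sup>+x. ennreal (\<bar>\<phi> x\<bar> powr \<sigma>) * indicator (ball x0 \<delta>) x \<partial>M)"
      by (rule nn_integral_lborel_eq_domain) (auto simp: test_function_eq_0[OF \<phi>(1)])
    ultimately have K': "(\<integral>\<^sup>+x. ennreal (\<bar>\<phi> x\<bar> powr \<sigma>) * indicator (ball x0 \<delta>) x \<partial>M) \<le> ennreal (max K 0)"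
      by (metis order_trans ennreal_leI max.cobounded1)
    have "(\<integral>\<^sup>+x. ennreal (\<bar>\<phi> x\<bar> powr t x) * indicator (ball x0 \<delta>) x \<partial>M) \<le>
        (\<integral>\<^sup>+x. 1 + ennreal (\<bar>\<phi> x\<bar> powr \<sigma>) * indicator (ball x0 \<delta>) x \<partial>M)"
    proof (rule nn_integral_mono)
      fix x assume "x \<in> space M"
      then have x: "x \<in> \<Omega>" by simp
      have "\<bar>\<phi> x\<bar> powr t x \<le> 1 + \<bar>\<phi> x\<bar> powr \<sigma>" if "x \<in> ball x0 \<delta>"
        using t_pos[of x] x closure_subset[of \<Omega>] \<sigma>_ge[OF x] that \<delta>
        by (intro powr_le_1_add_powr) (auto simp: dist_commute)
      then show "ennreal (\<bar>\<phi> x\<bar> powr t x) * indicator (ball x0 \<delta>) x \<le> 1 + ennreal (\<bar>\<phi> x\<bar> powr \<sigma>) * indicator (ball x0 \<delta>) x"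
        by (cases "x \<in> ball x0 \<delta>") (auto dest: ennreal_leI)
    qed
    also have "\<dots> = emeasure M \<Omega> + (\<integral>\<^sup>+x. ennreal (\<bar>\<phi> x\<bar> powr \<sigma>) * indicator (ball x0 \<delta>) x \<partial>M)"
    proof -
      have "(\<lambda>x. ennreal (\<bar>\<phi> x\<bar> powr \<sigma>) * indicator (ball x0 \<delta>) x) \<in> borel_measurable M"
        by (intro measurable_restrict_space1 measurable_completion) measurable
      then show ?thesis by (subst nn_integral_add) auto
    qed
    also have "\<dots> \<le> ennreal vol + ennreal (max K 0)"
      unfolding vol(1) by (intro add_left_mono K')
    also have "\<dots> = ennreal (vol + max K 0)" using vol(2) by simp
    finally show "(\<integral>\<^sup>+x. ennreal (\<bar>\<phi> x\<bar> powr t x) * indicator (ball x0 \<delta>) x \<partial>M) \<le> ennreal (vol + max K 0)" .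
  qed
qed

lemma test_function_embedding:
  "\<exists>K\<ge>0. \<forall>\<phi>\<in>test_functions \<Omega>. \<phi> \<in> W \<longrightarrow> grad \<phi> < 1 \<longrightarrow> (\<integral>\<^sup>+x. ennreal (\<bar>\<phi> x\<bar> powr t x) \<partial>M) \<le> ennreal K"
proof -
  define good where "good x \<delta> K \<longleftrightarrow> 0 < \<delta> \<and> 0 \<le> K \<and> (\<forall>\<phi>\<in>test_functions \<Omega>. \<phi> \<in> W \<longrightarrow> grad \<phi> < 1 \<longrightarrow>
    (\<integral>\<^sup>+y. ennreal (\<bar>\<phi> y\<bar> powr t y) * indicator (ball x \<delta>) y \<partial>M) \<le> ennreal K)" for x \<delta> K
  have "\<forall>x\<in>closure \<Omega>. \<exists>\<delta> K. good x \<delta> K"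
    using local_embedding unfolding good_def by blast
  then obtain \<delta> K where good: "\<forall>x\<in>closure \<Omega>. good x (\<delta> x) (K x)" by metis
  have \<delta>K: "\<And>x. x \<in> closure \<Omega> \<Longrightarrow> 0 < \<delta> x" "\<And>x. x \<in> closure \<Omega> \<Longrightarrow> 0 \<le> K x"
    "\<And>x \<phi>. x \<in> closure \<Omega> \<Longrightarrow> \<phi> \<in> test_functions \<Omega> \<Longrightarrow> \<phi> \<in> W \<Longrightarrow> grad \<phi> < 1 \<Longrightarrow>
      (\<integral>\<^sup>+y. ennreal (\<bar>\<phi> y\<bar> powr t y) * indicator (ball x (\<delta> x)) y \<partial>M) \<le> ennreal (K x)"
    using good unfolding good_def by blast+
  have "compact (closure \<Omega>)" using bounded_domain by simp
  then obtain F where F: "F \<subseteq> closure \<Omega>" "finite F" "closure \<Omega> \<subseteq> (\<Union>x\<in>F. ball x (\<delta> x))"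
  proof (rule compactE_image[of "closure \<Omega>" "closure \<Omega>" "\<lambda>x. ball x (\<delta> x)"])
    show "closure \<Omega> \<subseteq> (\<Union>x\<in>closure \<Omega>. ball x (\<delta> x))" using \<delta>K(1) by force
  qed auto
  show ?thesis
  proof (intro exI[of _ "\<Sum>x\<in>F. K x"] conjI ballI impI)
    show "0 \<le> (\<Sum>x\<in>F. K x)" using F \<delta>K(2) by (intro sum_nonneg) auto
    fix \<phi> assume \<phi>: "\<phi> \<in> test_functions \<Omega>" "\<phi> \<in> W" "grad \<phi> < 1"
    have m: "(\<lambda>x. ennreal (\<bar>\<phi> x\<bar> powr t x)) \<in> borel_measurable M"
      by (rule measurable_powr_t[OF L_measurable[OF W_imp_L[OF \<phi>(2)]]])
    have ind: "(\<lambda>y. indicator (ball x (\<delta> x)) y :: ennreal) \<in> borel_measurable M" for x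
      by (intro measurable_restrict_space1 measurable_completion borel_measurable_indicator) simp
    have "(\<integral>\<^sup>+y. ennreal (\<bar>\<phi> y\<bar> powr t y) \<partial>M) \<le> (\<integral>\<^sup>+y. (\<Sum>x\<in>F. ennreal (\<bar>\<phi> y\<bar> powr t y) * indicator (ball x (\<delta> x)) y) \<partial>M)"
    proof (rule nn_integral_mono)
      fix y assume "y \<in> space M"
      then obtain x where x: "x \<in> F" "y \<in> ball x (\<delta> x)" using F(3) closure_subset[of \<Omega>] by auto
      then have "ennreal (\<bar>\<phi> y\<bar> powr t y) = ennreal (\<bar>\<phi> y\<bar> powr t y) * indicator (ball x (\<delta> x)) y" by simp
      also have "\<dots> \<le> (\<Sum>x\<in>F. ennreal (\<bar>\<phi> y\<bar> powr t y) * indicator (ball x (\<delta> x)) y)"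
        by (rule member_le_sum[OF x(1) _ F(2)]) simp
      finally show "ennreal (\<bar>\<phi> y\<bar> powr t y) \<le> (\<Sum>x\<in>F. ennreal (\<bar>\<phi> y\<bar> powr t y) * indicator (ball x (\<delta> x)) y)" .
    qed
    also have "\<dots> = (\<Sum>x\<in>F. (\<integral>\<^sup>+y. ennreal (\<bar>\<phi> y\<bar> powr t y) * indicator (ball x (\<delta> x)) y \<partial>M))"
      by (intro nn_integral_sum borel_measurable_times_ennreal m ind)
    also have "\<dots> \<le> (\<Sum>x\<in>F. ennreal (K x))"
      using F(1) \<phi> by (intro sum_mono \<delta>K(3)) auto
    also have "\<dots> = ennreal (\<Sum>x\<in>F. K x)" using F(1) \<delta>K(2) by (intro sum_ennreal) auto
    finally show "(\<integral>\<^sup>+x. ennreal (\<bar>\<phi> x\<bar> powr t x) \<partial>M) \<le> ennreal (\<Sum>x\<in>F. K x)" .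
  qed
qed

lemma t_bounded: "\<exists>T\<ge>0. \<forall>x\<in>closure \<Omega>. t x \<le> T"
proof -
  have "compact (t ` closure \<Omega>)"
    using bounded_domain by (intro compact_continuous_image[OF t_cont]) simp
  then obtain B where "\<forall>y\<in>t ` closure \<Omega>. norm y \<le> B"
    using compact_imp_bounded bounded_iff by metis
  then show ?thesis by (intro exI[of _ "max B 0"]) fastforce
qed

text \<open>
  On the open unit ball the bound passes from test functions to their limits; larger balls are scaled
  into it, which multiplies \<open>t\<close>-modulars by at most a power of the radius.
\<close>

lemma V_embedding: "\<exists>K\<ge>0. \<forall>u\<in>V. grad u \<le> R \<longrightarrow> (\<integral>\<^sup>+x. ennreal (\<bar>u x\<bar> powr t x) \<partial>M) \<le> ennreal K"
proof -
  obtain K where K: "0 \<le> K" "\<And>\<phi>. \<phi> \<in> test_functions \<Omega> \<Longrightarrow> \<phi> \<in> W \<Longrightarrow> grad \<phi> < 1 \<Longrightarrow>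
      (\<integral>\<^sup>+x. ennreal (\<bar>\<phi> x\<bar> powr t x) \<partial>M) \<le> ennreal K"
    using test_function_embedding by blast
  have unit: "(\<integral>\<^sup>+x. ennreal (\<bar>u x\<bar> powr t x) \<partial>M) \<le> ennreal K" if u: "u \<in> V" and gu: "grad u < 1" for u
  proof -
    \<comment> \<open>The error is at most \<open>1 - grad u\<close>, which keeps the approximating test functions in the open unit ball.\<close>
    define e :: "nat \<Rightarrow> real" where "e k = (1 - grad u) * inverse (real (Suc k))" for k
    have e: "0 < e k" "e k \<le> 1 - grad u" for k
      using gu mult_left_mono[of "inverse (real (Suc k))" 1 "1 - grad u"] by (auto simp: e_def field_simps)
    have "e \<longlonglongrightarrow> (1 - grad u) * 0" unfolding e_def by (intro tendsto_intros LIMSEQ_inverse_real_of_nat)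
    then have elim: "(\<lambda>k. e k * (vol + 1)) \<longlonglongrightarrow> 0" using tendsto_mult_left_zero by simp
    obtain \<phi> where \<phi>: "\<And>k. \<phi> k \<in> test_functions \<Omega>" "\<And>k. \<phi> k \<in> W" "\<And>k. grad (\<phi> k) < grad u + e k"
      "\<And>k. (\<integral>\<^sup>+x. ennreal \<bar>\<phi> k x - u x\<bar> \<partial>M) \<le> ennreal (e k * (vol + 1))"
      using V_approx_sequence[of "\<lambda>k. u" e, OF u e(1)] by blast
    have \<phi>1: "grad (\<phi> k) < 1" for k using \<phi>(3)[of k] e(2)[of k] by simp
    have \<phi>m: "\<phi> k \<in> borel_measurable M" for k by (rule L_measurable[OF W_imp_L[OF \<phi>(2)]])
    obtain r where r: "strict_mono (r :: nat \<Rightarrow> nat)" "AE x in M. (\<lambda>k. \<phi> (r k) x - u x) \<longlonglongrightarrow> 0"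
      using AE_subseq_if_nn_integral_tendsto_0[of "\<lambda>k x. \<phi> k x - u x" M, OF _ \<phi>(4) elim]
        \<phi>m V_measurable[OF u] by (auto intro!: borel_measurable_diff)
    show ?thesis
    proof (rule modular_t_le_if_AE_tendsto[of "\<lambda>k. \<phi> (r k)"])
      show "AE x in M. (\<lambda>k. \<phi> (r k) x) \<longlonglongrightarrow> u x"
        using r(2) by eventually_elim (simp add: LIM_zero_iff)
    qed (intro \<phi>m K(2) \<phi> \<phi>1)+
  qed
  obtain T where T: "0 \<le> T" "\<And>x. x \<in> closure \<Omega> \<Longrightarrow> t x \<le> T" using t_bounded by blast
  define c where "c = max R 0 + 1"
  have c: "1 \<le> c" "R < c" by (auto simp: c_def)
  show ?thesis
  proof (intro exI[of _ "c powr T * K"] conjI ballI impI)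
    show "0 \<le> c powr T * K" using K(1) by simp
    fix u assume u: "u \<in> V" and gu: "grad u \<le> R"
    let ?w = "\<lambda>x. 1 / c * u x"
    have w: "?w \<in> V" by (rule V_scale[OF u])
    have "grad ?w \<le> 1 / c * grad u" using grad_scale_le[OF V_imp_W[OF u], of "1 / c"] c by simp
    also have "\<dots> < 1" using gu c by (simp add: field_simps)
    finally have gw: "grad ?w < 1" .
    have "(\<integral>\<^sup>+x. ennreal (\<bar>u x\<bar> powr t x) \<partial>M) \<le> (\<integral>\<^sup>+x. ennreal (c powr T) * ennreal (\<bar>?w x\<bar> powr t x) \<partial>M)"
    proof (rule nn_integral_mono)
      fix x assume "x \<in> space M"
      then have x: "x \<in> closure \<Omega>" using closure_subset by auto
      have "\<bar>u x\<bar> powr t x = (c * \<bar>?w x\<bar>) powr t x" using c by (simp add: abs_mult)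
      also have "\<dots> = c powr t x * \<bar>?w x\<bar> powr t x" by (rule powr_mult)
      also have "\<dots> \<le> c powr T * \<bar>?w x\<bar> powr t x"
        using T(2)[OF x] c by (intro mult_right_mono powr_mono) auto
      finally show "ennreal (\<bar>u x\<bar> powr t x) \<le> ennreal (c powr T) * ennreal (\<bar>?w x\<bar> powr t x)"
        by (simp add: ennreal_mult[symmetric] ennreal_leI)
    qed
    also have "\<dots> = ennreal (c powr T) * (\<integral>\<^sup>+x. ennreal (\<bar>?w x\<bar> powr t x) \<partial>M)"
      by (rule nn_integral_cmult) (intro measurable_powr_t V_measurable w)
    also have "\<dots> \<le> ennreal (c powr T) * ennreal K"
      by (intro mult_left_mono unit w gw) simp
    finally show "(\<integral>\<^sup>+x. ennreal (\<bar>u x\<bar> powr t x) \<partial>M) \<le> ennreal (c powr T * K)"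
      using K(1) by (simp add: ennreal_mult)
  qed
qed

end

section \<open>Caratheodory functions\<close>

text \<open>
  A function that is continuous in the second variable is the limit of its values at that variable
  rounded down to multiples of \<open>1 / (n + 1)\<close>, and each rounding takes countably many values.  The version \<open>f'\<close> is
  set to \<open>0\<close> on the null set where continuity fails.
\<close>

lemma caratheodory_jointly_measurable_version:
  fixes \<Omega> :: "'a::euclidean_space set"
  assumes "caratheodory \<Omega> f"
  obtains f' where "(\<lambda>(x, y). f' x y) \<in> borel_measurable (lebesgue_on \<Omega> \<Otimes>\<^sub>M borel)"
    "AE x in lebesgue_on \<Omega>. f' x = f x"
proof -
  let ?M = "lebesgue_on \<Omega>"
  obtain N where N: "N \<in> null_sets ?M" "{x \<in> space ?M. \<not> continuous_on UNIV (f x)} \<subseteq> N"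
    using assms unfolding caratheodory_def eventually_ae_filter by auto
  have [measurable]: "N \<in> sets ?M" using N(1) by auto
  define f' where "f' x y = (if x \<in> N then 0 else f x y)" for x y
  have sect: "(\<lambda>x. f' x y) \<in> borel_measurable ?M" for y
  proof -
    have [measurable]: "(\<lambda>x. f x y) \<in> borel_measurable ?M" using assms by (simp add: caratheodory_def)
    show ?thesis unfolding f'_def by measurable
  qed
  have cont: "continuous_on UNIV (f' x)" if "x \<in> \<Omega>" for x
    using that N(2) by (cases "x \<in> N") (auto simp: f'_def[abs_def])
  define fn where "fn n z = f' (fst z) (real_of_int \<lfloor>real (Suc n) * snd z\<rfloor> / real (Suc n))" for n and z :: "'a \<times> real"
  have "(\<lambda>(x, y). f' x y) \<in> borel_measurable (?M \<Otimes>\<^sub>M borel)"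
  proof (rule borel_measurable_LIMSEQ_real)
    show "fn n \<in> borel_measurable (?M \<Otimes>\<^sub>M borel)" for n
      unfolding fn_def[abs_def]
    proof (rule measurable_compose_countable[where f = "\<lambda>i z. f' (fst z) (real_of_int i / real (Suc n))"
          and g = "\<lambda>z. \<lfloor>real (Suc n) * snd z\<rfloor>"])
      show "(\<lambda>z. f' (fst z) (real_of_int i / real (Suc n))) \<in> borel_measurable (?M \<Otimes>\<^sub>M borel)" for i
        by (rule measurable_compose[OF measurable_fst sect])
      show "(\<lambda>z :: 'a \<times> real. \<lfloor>real (Suc n) * snd z\<rfloor>) \<in> measurable (?M \<Otimes>\<^sub>M borel) (count_space UNIV)"
        by measurable
    qed
    fix z :: "'a \<times> real" assume "z \<in> space (?M \<Otimes>\<^sub>M borel)"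
    then have x: "fst z \<in> \<Omega>" by (auto simp: space_pair_measure)
    have "(\<lambda>n. real_of_int \<lfloor>real (Suc n) * snd z\<rfloor> / real (Suc n)) \<longlonglongrightarrow> snd z"
    proof (rule tendsto_sandwich)
      show "eventually (\<lambda>n. snd z - inverse (real (Suc n)) \<le> real_of_int \<lfloor>real (Suc n) * snd z\<rfloor> / real (Suc n)) sequentially"
      proof (intro always_eventually allI)
        fix n
        have "real (Suc n) * snd z - 1 \<le> real_of_int \<lfloor>real (Suc n) * snd z\<rfloor>" by linarith
        then have "(real (Suc n) * snd z - 1) / real (Suc n) \<le> real_of_int \<lfloor>real (Suc n) * snd z\<rfloor> / real (Suc n)"
          by (rule divide_right_mono) simp
        then show "snd z - inverse (real (Suc n)) \<le> real_of_int \<lfloor>real (Suc n) * snd z\<rfloor> / real (Suc n)"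
          by (simp add: diff_divide_distrib inverse_eq_divide del: of_nat_Suc)
      qed
      show "eventually (\<lambda>n. real_of_int \<lfloor>real (Suc n) * snd z\<rfloor> / real (Suc n) \<le> snd z) sequentially"
      proof (intro always_eventually allI)
        fix n
        have "real_of_int \<lfloor>real (Suc n) * snd z\<rfloor> \<le> real (Suc n) * snd z" by linarith
        then show "real_of_int \<lfloor>real (Suc n) * snd z\<rfloor> / real (Suc n) \<le> snd z"
          by (simp add: divide_le_eq mult.commute del: of_nat_Suc)
      qed
      show "(\<lambda>n. snd z - inverse (real (Suc n))) \<longlonglongrightarrow> snd z"
        using tendsto_diff[OF tendsto_const LIMSEQ_inverse_real_of_nat, of "snd z"] by simp
    qed simp
    then have "(\<lambda>n. f' (fst z) (real_of_int \<lfloor>real (Suc n) * snd z\<rfloor> / real (Suc n))) \<longlonglongrightarrow> f' (fst z) (snd z)"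
      using cont[OF x] by (intro isCont_tendsto_compose[where g = "f' (fst z)"]) (auto simp: continuous_on_eq_continuous_at)
    then show "(\<lambda>n. fn n z) \<longlonglongrightarrow> (case z of (x, y) \<Rightarrow> f' x y)"
      by (simp add: fn_def case_prod_beta)
  qed
  moreover have "AE x in ?M. f' x = f x"
    using AE_not_in[OF N(1)] by eventually_elim (auto simp: f'_def)
  ultimately show ?thesis using that by blast
qed

lemma caratheodory_measurable_comp:
  fixes u :: "'a::euclidean_space \<Rightarrow> real"
  assumes \<Omega>: "\<Omega> \<in> sets lebesgue" and f: "caratheodory \<Omega> f" and u: "u \<in> borel_measurable (lebesgue_on \<Omega>)"
  shows "(\<lambda>x. f x (u x)) \<in> borel_measurable (lebesgue_on \<Omega>)"
proof -
  obtain f' where f': "(\<lambda>(x, y). f' x y) \<in> borel_measurable (lebesgue_on \<Omega> \<Otimes>\<^sub>M borel)"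
    "AE x in lebesgue_on \<Omega>. f' x = f x"
    using caratheodory_jointly_measurable_version[OF f] .
  have "(\<lambda>x. (x, u x)) \<in> measurable (lebesgue_on \<Omega>) (lebesgue_on \<Omega> \<Otimes>\<^sub>M borel)"
    using u by measurable
  from measurable_compose[OF this f'(1)] have m: "(\<lambda>x. f' x (u x)) \<in> borel_measurable (lebesgue_on \<Omega>)" by simp
  show ?thesis
    by (rule borel_measurable_lebesgue_on_AE[OF \<Omega> m]) (use f'(2) in \<open>auto elim: eventually_mono\<close>)
qed

text \<open>
  The primitive at \<open>u x\<close> is the integral of a jointly measurable function of \<open>(x, y)\<close>; joint measurability
  is what Fubini's theorem needs.
\<close>

lemma primitive_measurable_comp:
  fixes u :: "'a::euclidean_space \<Rightarrow> real"
  assumes \<Omega>: "\<Omega> \<in> sets lebesgue" and f: "caratheodory \<Omega> f" and u: "u \<in> borel_measurable (lebesgue_on \<Omega>)"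
  shows "(\<lambda>x. primitive f x (u x)) \<in> borel_measurable (lebesgue_on \<Omega>)"
proof -
  let ?M = "lebesgue_on \<Omega>"
  obtain f' where f': "(\<lambda>(x, y). f' x y) \<in> borel_measurable (?M \<Otimes>\<^sub>M borel)"
    "AE x in ?M. f' x = f x"
    using caratheodory_jointly_measurable_version[OF f] .
  define g where "g z = (if 0 < snd z \<and> snd z < u (fst z) then f' (fst z) (snd z)
      else if u (fst z) < snd z \<and> snd z < 0 then - f' (fst z) (snd z) else 0)" for z :: "'a \<times> real"
  have [measurable]: "u \<in> borel_measurable ?M" by (rule u)
  have [measurable]: "(\<lambda>z. f' (fst z) (snd z)) \<in> borel_measurable (?M \<Otimes>\<^sub>M lborel)"
    using f'(1) by (simp add: case_prod_beta cong: measurable_cong_sets)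
  have "g \<in> borel_measurable (?M \<Otimes>\<^sub>M lborel)"
    unfolding g_def[abs_def] by measurable
  then have "(\<lambda>(x, y). g (x, y)) \<in> borel_measurable (?M \<Otimes>\<^sub>M lborel)" by (simp add: case_prod_beta)
  then have m: "(\<lambda>x. LINT y|lborel. g (x, y)) \<in> borel_measurable ?M"
    by (rule lborel.borel_measurable_lebesgue_integral)
  show ?thesis
  proof (rule borel_measurable_lebesgue_on_AE[OF \<Omega> m])
    show "AE x in ?M. (LINT y|lborel. g (x, y)) = primitive f x (u x)"
      using f'(2)
    proof eventually_elim
      case (elim x)
      have "primitive f x (u x) = (LINT y|lborel. g (x, y))"
        unfolding primitive_def interval_lebesgue_integral_def set_lebesgue_integral_def einterval_def
        by (auto simp: g_def elim[symmetric] indicator_def simp flip: integral_minus intro!: Bochner_Integration.integral_cong)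
      then show ?case by simp
    qed
  qed
qed

lemma primitive_zero: "primitive f x 0 = 0"
  by (simp add: primitive_def zero_ereal_def[symmetric])

lemma primitive_has_derivative:
  assumes cont: "continuous_on UNIV (f x)"
  shows "(primitive f x has_real_derivative f x y) (at y)"
proof -
  define a b where "a = min 0 y - 1" and "b = max 0 y + 1"
  have ab: "a \<le> 0" "0 \<le> b" "a < y" "y < b" by (auto simp: a_def b_def)
  have "((\<lambda>u. LBINT y=ereal 0..ereal u. f x y) has_vector_derivative f x y) (at y within {a..b})"
    using ab by (intro interval_integral_FTC2 continuous_on_subset[OF cont]) auto
  then have "(primitive f x has_vector_derivative f x y) (at y within {a..b})"
    by (simp add: primitive_def[abs_def])
  moreover have "at y within {a..b} = at y"
    using ab by (intro at_within_interior) auto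
  ultimately show ?thesis by (simp add: has_real_derivative_iff_has_vector_derivative)
qed

lemma primitive_mean_value:
  assumes cont: "continuous_on UNIV (f x)"
  obtains z where "\<bar>z\<bar> \<le> max \<bar>a\<bar> \<bar>b\<bar>" "primitive f x b - primitive f x a = (b - a) * f x z"
proof -
  consider "a < b" | "b < a" | "a = b" by linarith
  then show ?thesis
  proof cases
    case 1
    obtain z where "a < z" "z < b" "primitive f x b - primitive f x a = (b - a) * f x z"
      using MVT2[OF 1, of "primitive f x" "f x"] primitive_has_derivative[where f = f and x = x, OF cont] by blast
    then show ?thesis using that[of z] by auto
  next
    case 2
    obtain z where z: "b < z" "z < a" "primitive f x a - primitive f x b = (a - b) * f x z"
      using MVT2[OF 2, of "primitive f x" "f x"] primitive_has_derivative[where f = f and x = x, OF cont] by blast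
    then have "primitive f x b - primitive f x a = (b - a) * f x z" by (simp add: algebra_simps)
    then show ?thesis using that[of z] z by auto
  next
    case 3
    then show ?thesis using that[of a] by simp
  qed
qed

section \<open>The metric of the dual space\<close>

text \<open>
  The dual space carries a genuine metric although \<open>n\<close> is only a seminorm: a bounded functional vanishes
  where \<open>n\<close> does, and members of the dual space are \<open>0\<close> off \<open>V\<close>.
\<close>

locale seminormed_functions =
  fixes V :: "('a \<Rightarrow> real) set" and n :: "('a \<Rightarrow> real) \<Rightarrow> real"
  assumes zero_mem: "(\<lambda>x. 0) \<in> V" and n_zero: "n (\<lambda>x. 0) = 0"
    and scale_mem: "\<And>u c. u \<in> V \<Longrightarrow> (\<lambda>x. c * u x) \<in> V"
    and n_scale_le: "\<And>u c. u \<in> V \<Longrightarrow> n (\<lambda>x. c * u x) \<le> \<bar>c\<bar> * n u"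
    and n_nonneg: "\<And>u. u \<in> V \<Longrightarrow> 0 \<le> n u"
begin

abbreviation "unit_ball \<equiv> {u \<in> V. n u \<le> 1}"

lemma unit_ball_nonempty: "unit_ball \<noteq> {}"
  using zero_mem n_zero by (metis (mono_tags, lifting) empty_iff mem_Collect_eq zero_le_one)

text \<open>
  Homogeneity turns a bound on the unit ball into a bound by the seminorm.  Where the seminorm
  vanishes, all multiples lie in the unit ball, so the functional vanishes too.
\<close>

lemma abs_le_mult_seminorm:
  assumes hom: "\<And>c u. u \<in> V \<Longrightarrow> T (\<lambda>x. c * u x) = c * T u"
    and C: "\<And>u. u \<in> unit_ball \<Longrightarrow> \<bar>T u\<bar> \<le> C" and u: "u \<in> V"
  shows "\<bar>T u\<bar> \<le> C * n u"
proof (rule field_le_epsilon)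
  fix e :: real assume e: "e > 0"
  have C0: "0 \<le> C" using C[of "\<lambda>x. 0"] zero_mem n_zero by force
  define a where "a = n u + e / (C + 1)"
  have a: "0 < a" "n u \<le> a" using e C0 n_nonneg[OF u] by (auto simp: a_def add_nonneg_pos)
  have "n (\<lambda>x. 1 / a * u x) \<le> 1 / a * n u" using n_scale_le[OF u, of "1 / a"] a by simp
  also have "\<dots> \<le> 1" using a by simp
  finally have "\<bar>T (\<lambda>x. 1 / a * u x)\<bar> \<le> C" using scale_mem[OF u, of "1 / a"] by (intro C) auto
  then have "\<bar>T u\<bar> \<le> C * a" unfolding hom[OF u] using a by (simp add: abs_mult pos_divide_le_eq)
  also have "\<dots> = C * n u + C / (C + 1) * e" by (simp add: a_def algebra_simps)
  also have "C / (C + 1) * e \<le> e" using C0 e by (simp add: mult_left_le_one_le divide_le_eq)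
  finally show "\<bar>T u\<bar> \<le> C * n u + e" by simp
qed

lemma dual_spaceI:
  assumes "\<And>u v. u \<in> V \<Longrightarrow> v \<in> V \<Longrightarrow> T (\<lambda>x. u x + v x) = T u + T v"
    and hom: "\<And>c u. u \<in> V \<Longrightarrow> T (\<lambda>x. c * u x) = c * T u"
    and C: "\<And>u. u \<in> unit_ball \<Longrightarrow> \<bar>T u\<bar> \<le> C"
    and "\<And>u. u \<notin> V \<Longrightarrow> T u = 0"
  shows "T \<in> dual_space V n"
  using abs_le_mult_seminorm[of T C] assms unfolding dual_space_def by blast

lemma dual_bdd_above:
  assumes "S \<in> dual_space V n" "T \<in> dual_space V n"
  shows "bdd_above ((\<lambda>u. \<bar>(S - T) u\<bar>) ` unit_ball)"
proof -
  have "\<exists>C. \<forall>u\<in>V. \<bar>S u\<bar> \<le> C * n u" "\<exists>D. \<forall>u\<in>V. \<bar>T u\<bar> \<le> D * n u"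
    using assms by (simp_all add: dual_space_def)
  then obtain C D where CD: "\<And>u. u \<in> V \<Longrightarrow> \<bar>S u\<bar> \<le> C * n u" "\<And>u. u \<in> V \<Longrightarrow> \<bar>T u\<bar> \<le> D * n u"
    by blast
  show ?thesis
  proof (rule bdd_aboveI2[where M = "\<bar>C\<bar> + \<bar>D\<bar>"])
    fix u assume u: "u \<in> unit_ball"
    have "X * n u \<le> \<bar>X\<bar>" for X
    proof -
      have "X * n u \<le> \<bar>X\<bar> * n u" using n_nonneg u by (intro mult_right_mono) auto
      also have "\<dots> \<le> \<bar>X\<bar>" using n_nonneg u by (intro mult_left_le) auto
      finally show ?thesis .
    qed
    from this[of C] this[of D] show "\<bar>(S - T) u\<bar> \<le> \<bar>C\<bar> + \<bar>D\<bar>"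
      using CD[of u] u by auto
  qed
qed

lemma dual_norm_upper:
  assumes "S \<in> dual_space V n" "T \<in> dual_space V n" "u \<in> unit_ball"
  shows "\<bar>S u - T u\<bar> \<le> dual_norm V n (S - T)"
  unfolding dual_norm_def using cSUP_upper[OF assms(3) dual_bdd_above[OF assms(1,2)]] by simp

lemma dual_norm_least:
  assumes "\<And>u. u \<in> unit_ball \<Longrightarrow> \<bar>S u - T u\<bar> \<le> C"
  shows "dual_norm V n (S - T) \<le> C"
  unfolding dual_norm_def using assms by (intro cSUP_least unit_ball_nonempty) auto

text \<open>
  The distance is a total function that must be nonnegative and symmetric everywhere, hence the value \<open>0\<close> off the dual space.
\<close>

sublocale dual: Metric_space "dual_space V n" "\<lambda>S T. if S \<in> dual_space V n \<and> T \<in> dual_space V n then dual_norm V n (S - T) else 0"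
proof
  let ?D = "dual_space V n"
  have nonneg: "0 \<le> dual_norm V n (S - T)" if "S \<in> ?D" "T \<in> ?D" for S T
    using dual_norm_upper[OF that, of "\<lambda>x. 0"] zero_mem n_zero by force
  show "0 \<le> (if S \<in> ?D \<and> T \<in> ?D then dual_norm V n (S - T) else 0)" for S T
    using nonneg by auto
  have sym: "dual_norm V n (S - T) = dual_norm V n (T - S)" for S T
    by (simp add: dual_norm_def abs_minus_commute)
  then show "(if S \<in> ?D \<and> T \<in> ?D then dual_norm V n (S - T) else 0) = (if T \<in> ?D \<and> S \<in> ?D then dual_norm V n (T - S) else 0)" for S T
    by auto
  show "((if S \<in> ?D \<and> T \<in> ?D then dual_norm V n (S - T) else 0) = 0) = (S = T)" if ST: "S \<in> ?D" "T \<in> ?D" for S T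
  proof
    assume "S = T"
    then have "dual_norm V n (S - T) \<le> 0" by (intro dual_norm_least) simp
    then show "(if S \<in> ?D \<and> T \<in> ?D then dual_norm V n (S - T) else 0) = 0"
      using nonneg[OF ST] ST by simp
  next
    assume "(if S \<in> ?D \<and> T \<in> ?D then dual_norm V n (S - T) else 0) = 0"
    then have zero: "dual_norm V n (S - T) = 0" using ST by simp
    have "S u = T u" for u
    proof (cases "u \<in> V")
      case True
      have "\<bar>S u - T u\<bar> \<le> 0 * n u"
      proof (rule abs_le_mult_seminorm[where T = "\<lambda>u. S u - T u", OF _ _ True])
        show "\<bar>S v - T v\<bar> \<le> 0" if "v \<in> unit_ball" for v
          using dual_norm_upper[OF ST that] zero by simp
      qed (use ST in \<open>auto simp: dual_space_def algebra_simps\<close>)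
      then show ?thesis by simp
    qed (use ST in \<open>auto simp: dual_space_def\<close>)
    then show "S = T" by blast
  qed
  show "(if S \<in> ?D \<and> U \<in> ?D then dual_norm V n (S - U) else 0) \<le>
      (if S \<in> ?D \<and> T \<in> ?D then dual_norm V n (S - T) else 0) + (if T \<in> ?D \<and> U \<in> ?D then dual_norm V n (T - U) else 0)"
    if STU: "S \<in> ?D" "T \<in> ?D" "U \<in> ?D" for S T U
  proof -
    have "dual_norm V n (S - U) \<le> dual_norm V n (S - T) + dual_norm V n (T - U)"
    proof (rule dual_norm_least)
      fix u assume "u \<in> unit_ball"
      then show "\<bar>S u - U u\<bar> \<le> dual_norm V n (S - T) + dual_norm V n (T - U)"
        using dual_norm_upper[OF STU(1,2), of u] dual_norm_upper[OF STU(2,3), of u] by linarith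
    qed
    then show ?thesis using STU by simp
  qed
qed

lemma dual_mtopology: "dual.mtopology = dual_topology V n"
proof -
  have "openin dual.mtopology U = openin (dual_topology V n) U" for U
  proof -
    have ball: "dual.mball T r \<subseteq> U \<longleftrightarrow> (\<forall>S\<in>dual_space V n. dual_norm V n (S - T) < r \<longrightarrow> S \<in> U)"
      if "T \<in> dual_space V n" for T r
      using that dual.commute[of T] unfolding dual.mball_def by (auto split: if_splits)
    show ?thesis
      unfolding dual.openin_mtopology openin_norm_topology
      using ball by (intro conj_cong refl ball_cong) (auto simp: subset_iff)
  qed
  then show ?thesis by (simp add: topology_eq)
qed

text \<open>
  By the Bolzano--Weierstrass criterion an infinite subset has to have an accumulation point.  An injective sequence in it
  takes the limiting value at most once, so the limit of a subsequence is one.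
\<close>

lemma compactin_closure_if_sequences:
  assumes S: "S \<subseteq> dual_space V n"
    and seq: "\<And>\<sigma>. range \<sigma> \<subseteq> S \<Longrightarrow> \<exists>T r. T \<in> dual_space V n \<and> strict_mono (r :: nat \<Rightarrow> nat) \<and>
       (\<forall>e>0. \<exists>k0. \<forall>k\<ge>k0. dual_norm V n (\<sigma> (r k) - T) < e)"
  shows "compactin (dual_topology V n) (dual_topology V n closure_of S)"
  unfolding dual_mtopology[symmetric] dual.compact_closure_of_eq_Bolzano_Weierstrass
proof (intro allI impI, elim conjE)
  fix A assume A: "infinite A" "A \<subseteq> S"
  obtain \<sigma> :: "nat \<Rightarrow> ('a \<Rightarrow> real) \<Rightarrow> real" where \<sigma>: "inj \<sigma>" "range \<sigma> \<subseteq> A"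
    using infinite_countable_subset[OF A(1)] by blast
  then have "range \<sigma> \<subseteq> S" using A(2) by blast
  from seq[OF this] obtain T and r :: "nat \<Rightarrow> nat" where T: "T \<in> dual_space V n" "strict_mono r"
    "\<And>e. 0 < e \<Longrightarrow> \<exists>k0. \<forall>k\<ge>k0. dual_norm V n (\<sigma> (r k) - T) < e" by blast
  have "T \<in> dual.mtopology derived_set_of A"
    unfolding in_derived_set_of dual_mtopology
  proof (intro conjI allI impI)
    show "T \<in> topspace (dual_topology V n)" using T(1) dual.topspace_mtopology by (simp add: dual_mtopology)
    fix U assume U: "T \<in> U \<and> openin (dual_topology V n) U"
    then obtain e where e: "0 < e" "\<forall>S\<in>dual_space V n. dual_norm V n (S - T) < e \<longrightarrow> S \<in> U"
      unfolding openin_norm_topology by blast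
    obtain k0 where k0: "\<forall>k\<ge>k0. dual_norm V n (\<sigma> (r k) - T) < e" using T(3)[OF e(1)] by blast
    have "\<sigma> (r k0) \<noteq> \<sigma> (r (Suc k0))"
      using \<sigma>(1) T(2) by (metis injD lessI less_irrefl strict_mono_less)
    then obtain k where k: "k \<ge> k0" "\<sigma> (r k) \<noteq> T" by (metis le_SucI order_refl)
    have "\<sigma> (r k) \<in> A" using \<sigma>(2) by blast
    then show "\<exists>y. y \<noteq> T \<and> y \<in> A \<and> y \<in> U"
      using k k0 e(2) A(2) S by blast
  qed
  then show "dual.mtopology derived_set_of A \<noteq> {}" by blast
qed

end

section \<open>The superposition operator\<close>

text \<open>
  The growth exponent \<open>s\<close> leaves a margin \<open>\<epsilon>\<close> below the integrability exponent \<open>t\<close>.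
\<close>

locale superposition = subcritical +
  fixes f :: "'a \<Rightarrow> real \<Rightarrow> real" and s :: "'a \<Rightarrow> real" and c1 c2 \<epsilon> T :: real
  assumes f_car: "caratheodory \<Omega> f" and c_nonneg: "0 \<le> c1" "0 \<le> c2" and \<epsilon>_pos: "0 < \<epsilon>"
    and s_gt_1: "\<And>x. x \<in> \<Omega> \<Longrightarrow> 1 < s x" and t_eq: "\<And>x. x \<in> \<Omega> \<Longrightarrow> t x = s x + \<epsilon>"
    and t_le: "\<And>x. x \<in> \<Omega> \<Longrightarrow> t x \<le> T"
    and growth: "\<And>x y. x \<in> \<Omega> \<Longrightarrow> \<bar>f x y\<bar> \<le> c1 + c2 * \<bar>y\<bar> powr (s x - 1)"
begin

definition Lt_space :: "('a \<Rightarrow> real) set" where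
  "Lt_space = {u \<in> borel_measurable M. (\<integral>\<^sup>+x. ennreal (\<bar>u x\<bar> powr t x) \<partial>M) < \<infinity>}"

lemma V_subset_Lt: "u \<in> V \<Longrightarrow> u \<in> Lt_space"
  using V_embedding[of "grad u"] V_measurable[of u] by (auto simp: Lt_space_def intro: le_less_trans)

lemma Lt_measurable: "u \<in> Lt_space \<Longrightarrow> u \<in> borel_measurable M"
  by (simp add: Lt_space_def)

lemma Lt_integrable: "u \<in> Lt_space \<Longrightarrow> integrable M (\<lambda>x. \<bar>u x\<bar> powr t x)"
  unfolding Lt_space_def using measurable_powr_t
  by (intro integrableI_bounded powr_real_measurable t_measurable) auto

definition growth_const :: real where "growth_const = (c1 + c2) * (2 powr T + 1)"

lemma growth_const_nonneg: "0 \<le> growth_const"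
  using c_nonneg by (simp add: growth_const_def)

text \<open>
  With \<open>m\<close> the larger of \<open>a\<close> and \<open>b\<close>, the product is of order \<open>m + m powr s\<close>; both terms are
  at most \<open>1 + m powr t\<close>.
\<close>

lemma growth_mult_le:
  assumes x: "x \<in> \<Omega>" and z: "\<bar>z\<bar> \<le> a + b" and ab: "0 \<le> a" "0 \<le> b"
  shows "\<bar>f x z\<bar> * b \<le> growth_const * (1 + a powr t x + b powr t x)"
proof -
  have s: "1 < s x" "1 < t x" "s x \<le> t x" "t x \<le> T"
    using s_gt_1[OF x] t_eq[OF x] \<epsilon>_pos t_le[OF x] by auto
  define m where "m = max a b"
  have m: "0 \<le> m" "a \<le> m" "b \<le> m" using ab by (auto simp: m_def)
  have mt: "m powr t x \<le> a powr t x + b powr t x" by (cases "a \<le> b") (auto simp: m_def)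
  have "b \<le> 1 + b powr t x" using powr_le_1_add_powr[of b 1 "t x"] ab s by simp
  then have 1: "c1 * b \<le> c1 * (1 + a powr t x + b powr t x)"
    using c_nonneg powr_ge_zero[of a "t x"] by (intro mult_left_mono; linarith)
  have "\<bar>z\<bar> powr (s x - 1) * b \<le> (2 * m) powr (s x - 1) * (2 * m)"
    using z m ab s by (intro mult_mono powr_mono2) auto
  also have "\<dots> = (2 * m) powr s x"
  proof (cases "m = 0")
    case False
    then have "0 < m" using m by simp
    then have "(2 * m) powr (s x - 1) * (2 * m) powr 1 = (2 * m) powr s x" unfolding powr_add[symmetric] by simp
    then show ?thesis using \<open>0 < m\<close> by simp
  qed (use s in simp)
  also have "\<dots> \<le> 1 + (2 * m) powr t x"
    using m s by (intro powr_le_1_add_powr) auto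
  also have "(2 * m) powr t x = 2 powr t x * m powr t x" by (rule powr_mult)
  also have "\<dots> \<le> 2 powr T * (a powr t x + b powr t x)"
    using s mt by (intro mult_mono powr_mono) auto
  finally have "\<bar>z\<bar> powr (s x - 1) * b \<le> 1 + 2 powr T * (a powr t x + b powr t x)" by simp
  then have 2: "c2 * (\<bar>z\<bar> powr (s x - 1) * b) \<le> c2 * (1 + 2 powr T * (a powr t x + b powr t x))"
    using c_nonneg by (intro mult_left_mono) auto
  have "\<bar>f x z\<bar> * b \<le> (c1 + c2 * \<bar>z\<bar> powr (s x - 1)) * b"
    using growth[OF x] ab by (intro mult_right_mono) auto
  also have "\<dots> \<le> c1 * (1 + a powr t x + b powr t x) + c2 * (1 + 2 powr T * (a powr t x + b powr t x))"
    using 1 2 by (simp add: algebra_simps)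
  also have "\<dots> \<le> growth_const * (1 + a powr t x + b powr t x)"
  proof -
    have A: "X \<le> (2 powr T + 1) * X" if "0 \<le> X" for X :: real
      using that by (simp add: algebra_simps)
    have "c1 * (1 + a powr t x + b powr t x) \<le> c1 * ((2 powr T + 1) * (1 + a powr t x + b powr t x))"
      using c_nonneg by (intro mult_left_mono A) auto
    moreover have "c2 * (1 + 2 powr T * (a powr t x + b powr t x)) \<le> c2 * ((2 powr T + 1) * (1 + a powr t x + b powr t x))"
      using c_nonneg by (intro mult_left_mono) (auto simp: algebra_simps)
    ultimately show ?thesis by (simp add: growth_const_def algebra_simps)
  qed
  finally show ?thesis .
qed

lemma integrable_dominating:
  assumes "u \<in> Lt_space" "\<phi> \<in> Lt_space"
  shows "integrable M (\<lambda>x. growth_const * (1 + \<bar>u x\<bar> powr t x + \<bar>\<phi> x\<bar> powr t x))"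
proof -
  interpret finite_measure M by (rule finite_measure_domain)
  show ?thesis using Lt_integrable[OF assms(1)] Lt_integrable[OF assms(2)] by simp
qed

lemma measurable_f_comp: "u \<in> borel_measurable M \<Longrightarrow> (\<lambda>x. f x (u x)) \<in> borel_measurable M"
  by (rule caratheodory_measurable_comp[OF domain_sets f_car])

lemma integrable_f_mult:
  assumes "u \<in> Lt_space" "\<phi> \<in> Lt_space"
  shows "integrable M (\<lambda>x. f x (u x) * \<phi> x)"
proof (rule Bochner_Integration.integrable_bound[OF integrable_dominating[OF assms]])
  show "(\<lambda>x. f x (u x) * \<phi> x) \<in> borel_measurable M"
    using assms by (intro borel_measurable_times measurable_f_comp Lt_measurable)
  show "AE x in M. norm (f x (u x) * \<phi> x) \<le> norm (growth_const * (1 + \<bar>u x\<bar> powr t x + \<bar>\<phi> x\<bar> powr t x))"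
  proof (rule AE_I2)
    fix x assume "x \<in> space M"
    then have "\<bar>f x (u x)\<bar> * \<bar>\<phi> x\<bar> \<le> growth_const * (1 + \<bar>u x\<bar> powr t x + \<bar>\<phi> x\<bar> powr t x)"
      by (intro growth_mult_le) auto
    then show "norm (f x (u x) * \<phi> x) \<le> norm (growth_const * (1 + \<bar>u x\<bar> powr t x + \<bar>\<phi> x\<bar> powr t x))"
      using growth_const_nonneg by (simp add: abs_mult)
  qed
qed

lemma f_continuous_AE: "AE x in M. continuous_on UNIV (f x)"
  using f_car by (simp add: caratheodory_def)

lemma primitive_diff_le:
  assumes x: "x \<in> \<Omega>" "continuous_on UNIV (f x)" and h: "\<bar>h\<bar> \<le> 1"
  shows "\<bar>primitive f x (a + h * b) - primitive f x a\<bar> \<le> \<bar>h\<bar> * (growth_const * (1 + \<bar>a\<bar> powr t x + \<bar>b\<bar> powr t x))"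
proof -
  obtain z where z: "\<bar>z\<bar> \<le> max \<bar>a\<bar> \<bar>a + h * b\<bar>" "primitive f x (a + h * b) - primitive f x a = (a + h * b - a) * f x z"
    using primitive_mean_value[where f = f and x = x, OF x(2)] .
  have "\<bar>h * b\<bar> \<le> \<bar>b\<bar>" using h by (simp add: abs_mult mult_left_le_one_le)
  then have "\<bar>z\<bar> \<le> \<bar>a\<bar> + \<bar>b\<bar>" using z(1) by linarith
  from growth_mult_le[OF x(1) this] have "\<bar>h\<bar> * (\<bar>f x z\<bar> * \<bar>b\<bar>) \<le> \<bar>h\<bar> * (growth_const * (1 + \<bar>a\<bar> powr t x + \<bar>b\<bar> powr t x))"
    by (intro mult_left_mono) auto
  then show ?thesis using z(2) by (simp add: abs_mult mult_ac)
qed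

lemma integrable_primitive:
  assumes "u \<in> Lt_space"
  shows "integrable M (\<lambda>x. primitive f x (u x))"
proof (rule Bochner_Integration.integrable_bound[OF integrable_dominating[OF assms assms]])
  show "(\<lambda>x. primitive f x (u x)) \<in> borel_measurable M"
    by (rule primitive_measurable_comp[OF domain_sets f_car Lt_measurable[OF assms]])
  show "AE x in M. norm (primitive f x (u x)) \<le> norm (growth_const * (1 + \<bar>u x\<bar> powr t x + \<bar>u x\<bar> powr t x))"
    using f_continuous_AE AE_space[of M]
  proof eventually_elim
    case (elim x)
    have "0 < t x" using elim(2) s_gt_1[of x] t_eq[of x] \<epsilon>_pos by auto
    then have "\<bar>primitive f x (u x)\<bar> \<le> growth_const * (1 + \<bar>u x\<bar> powr t x)"
      using primitive_diff_le[of x 1 0 "u x"] elim by (simp add: primitive_zero)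
    also have "\<dots> \<le> growth_const * (1 + \<bar>u x\<bar> powr t x + \<bar>u x\<bar> powr t x)"
      by (intro mult_left_mono growth_const_nonneg) auto
    finally show ?case using growth_const_nonneg by (simp add: abs_of_nonneg)
  qed
qed

lemma set_lebesgue_integral_domain:
  fixes g :: "'a \<Rightarrow> real"
  shows "(LINT x:\<Omega>|lebesgue. g x) = (LINT x|M. g x)"
  by (simp add: integral_restrict_space set_lebesgue_integral_def)

lemma set_integrable_domain:
  fixes g :: "'a \<Rightarrow> real"
  shows "set_integrable lebesgue \<Omega> g \<longleftrightarrow> integrable M g"
  by (simp add: integrable_restrict_space set_integrable_def)

text \<open>
  The difference quotients of the energy are dominated by an integrable function because the growth
  exponent \<open>s\<close> stays below the integrability exponent \<open>t\<close>.
\<close>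

lemma energy_difference_quotient_tendsto:
  assumes u: "u \<in> Lt_space" and \<phi>: "\<phi> \<in> Lt_space" and sum: "\<And>h. (\<lambda>x. u x + h * \<phi> x) \<in> Lt_space"
  shows "((\<lambda>h. (energy \<Omega> f (\<lambda>x. u x + h * \<phi> x) - energy \<Omega> f u) / h) \<longlongrightarrow> (LINT x|M. f x (u x) * \<phi> x)) (at 0)"
  unfolding tendsto_at_iff_sequentially
proof (intro allI impI)
  fix X :: "nat \<Rightarrow> real" assume X: "\<forall>i. X i \<in> UNIV - {0}" "X \<longlonglongrightarrow> 0"
  obtain n0 where n0: "\<And>n. n \<ge> n0 \<Longrightarrow> \<bar>X n\<bar> < 1"
    using LIMSEQ_D[OF X(2), of 1] by auto
  define Y where "Y n = X (n + n0)" for n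
  have Y: "Y n \<noteq> 0" "\<bar>Y n\<bar> \<le> 1" for n using X(1) n0[of "n + n0"] by (auto simp: Y_def)
  have Ylim: "Y \<longlonglongrightarrow> 0" unfolding Y_def by (rule LIMSEQ_ignore_initial_segment[OF X(2)])
  have eq: "(energy \<Omega> f (\<lambda>x. u x + h * \<phi> x) - energy \<Omega> f u) / h =
      (LINT x|M. (primitive f x (u x + h * \<phi> x) - primitive f x (u x)) / h)" for h
    unfolding energy_def set_lebesgue_integral_domain
    by (simp add: Bochner_Integration.integral_diff[OF integrable_primitive[OF sum] integrable_primitive[OF u]])
  have "(\<lambda>n. LINT x|M. (primitive f x (u x + Y n * \<phi> x) - primitive f x (u x)) / Y n) \<longlonglongrightarrow> (LINT x|M. f x (u x) * \<phi> x)"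
  proof (rule integral_dominated_convergence[OF _ _ integrable_dominating[OF u \<phi>]])
    show "(\<lambda>x. f x (u x) * \<phi> x) \<in> borel_measurable M"
      by (intro borel_measurable_times measurable_f_comp Lt_measurable u \<phi>)
    show "(\<lambda>x. (primitive f x (u x + Y n * \<phi> x) - primitive f x (u x)) / Y n) \<in> borel_measurable M" for n
      by (intro borel_measurable_divide borel_measurable_diff borel_measurable_const borel_measurable_integrable[OF integrable_primitive] sum u)
    show "AE x in M. norm ((primitive f x (u x + Y n * \<phi> x) - primitive f x (u x)) / Y n)
         \<le> growth_const * (1 + \<bar>u x\<bar> powr t x + \<bar>\<phi> x\<bar> powr t x)" for n
      using f_continuous_AE AE_space[of M]
    proof eventually_elim
      case (elim x)
      then show ?case using primitive_diff_le[of x "Y n" "u x" "\<phi> x"] Y[of n]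
        by (simp add: divide_le_eq mult.commute)
    qed
    show "AE x in M. (\<lambda>n. (primitive f x (u x + Y n * \<phi> x) - primitive f x (u x)) / Y n) \<longlonglongrightarrow> f x (u x) * \<phi> x"
      using f_continuous_AE
    proof eventually_elim
      case (elim x)
      have "((\<lambda>h. primitive f x (u x + h * \<phi> x)) has_real_derivative f x (u x + 0 * \<phi> x) * \<phi> x) (at 0)"
        by (rule DERIV_chain2[OF primitive_has_derivative[where f = f and x = x, OF elim]])
           (auto intro!: derivative_eq_intros)
      then have "((\<lambda>h. (primitive f x (u x + h * \<phi> x) - primitive f x (u x)) / h) \<longlongrightarrow> f x (u x) * \<phi> x) (at 0)"
        by (simp add: has_field_derivative_iff)
      then show ?case
        by (rule filterlim_compose) (use Y Ylim in \<open>auto simp: filterlim_at\<close>)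
    qed
  qed
  then have "(\<lambda>n. (energy \<Omega> f (\<lambda>x. u x + Y n * \<phi> x) - energy \<Omega> f u) / Y n) \<longlonglongrightarrow> (LINT x|M. f x (u x) * \<phi> x)"
    unfolding eq .
  then show "((\<lambda>h. (energy \<Omega> f (\<lambda>x. u x + h * \<phi> x) - energy \<Omega> f u) / h) \<circ> X) \<longlonglongrightarrow> (LINT x|M. f x (u x) * \<phi> x)"
    unfolding o_def Y_def
    by (rule LIMSEQ_offset[where k = n0])
qed

text \<open>
  Where the increment of \<open>f\<close> is at most \<open>\<eta>\<close> nothing is lost; elsewhere, the growth bound costs
  \<open>m powr s\<close> for the largest value \<open>m\<close> involved, and \<open>m powr s \<le> l powr T + l powr (- \<epsilon>) * m powr t\<close>
  because \<open>s = t - \<epsilon>\<close>.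
\<close>

lemma increment_mult_le:
  assumes x: "x \<in> \<Omega>" and \<eta>: "0 \<le> \<eta>" and l: "1 \<le> l"
  defines "C \<equiv> 2 * (c1 + c2)"
  shows "\<bar>f x a - f x b\<bar> * \<bar>d\<bar> \<le> \<eta> * (1 + \<bar>d\<bar> powr t x) +
    C * (1 + l powr T) * (if \<eta> < \<bar>f x a - f x b\<bar> then 1 else 0) +
    C * l powr (- \<epsilon>) * (\<bar>a\<bar> powr t x + \<bar>b\<bar> powr t x + \<bar>d\<bar> powr t x)"
proof -
  have s: "1 < s x" "1 < t x" "s x \<le> t x" "t x \<le> T" "t x - s x = \<epsilon>"
    using s_gt_1[OF x] t_eq[OF x] \<epsilon>_pos t_le[OF x] by auto
  have C: "0 \<le> C" using c_nonneg by (simp add: C_def)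
  show ?thesis
  proof (cases "\<eta> < \<bar>f x a - f x b\<bar>")
    case False
    have "\<bar>f x a - f x b\<bar> * \<bar>d\<bar> \<le> \<eta> * (1 + \<bar>d\<bar> powr t x)"
      using False \<eta> powr_le_1_add_powr[of "\<bar>d\<bar>" 1 "t x"] s by (intro mult_mono) auto
    moreover have "0 \<le> C * l powr (- \<epsilon>) * (\<bar>a\<bar> powr t x + \<bar>b\<bar> powr t x + \<bar>d\<bar> powr t x)"
      using C by (intro mult_nonneg_nonneg add_nonneg_nonneg) auto
    ultimately show ?thesis using False by simp
  next
    case True
    define m where "m = max \<bar>a\<bar> (max \<bar>b\<bar> \<bar>d\<bar>)"
    have m: "0 \<le> m" "\<bar>a\<bar> \<le> m" "\<bar>b\<bar> \<le> m" "\<bar>d\<bar> \<le> m" by (auto simp: m_def)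
    have mt: "m powr t x \<le> \<bar>a\<bar> powr t x + \<bar>b\<bar> powr t x + \<bar>d\<bar> powr t x"
      by (auto simp: m_def max_def)
    have ms: "m powr s x \<le> l powr T + l powr (- \<epsilon>) * m powr t x"
    proof (cases "m \<le> l")
      case True
      then have "m powr s x \<le> l powr s x" using m s by (intro powr_mono2) auto
      also have "\<dots> \<le> l powr T" using l s by (intro powr_mono) auto
      finally show ?thesis by (simp add: add_increasing2)
    next
      case False
      have "s x = t x + (- \<epsilon>)" using s by simp
      then have "m powr s x = m powr (- \<epsilon>) * m powr t x" by (simp only: powr_add) simp
      also have "\<dots> \<le> l powr (- \<epsilon>) * m powr t x"
        using False l \<epsilon>_pos by (intro mult_right_mono powr_mono2') auto
      finally show ?thesis by (simp add: add_increasing)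
    qed
    have fle: "\<bar>f x y\<bar> * \<bar>d\<bar> \<le> (c1 + c2) * (1 + m powr s x)" if y: "\<bar>y\<bar> \<le> m" for y
    proof -
      have "\<bar>d\<bar> \<le> 1 + m powr s x" using powr_le_1_add_powr[of m 1 "s x"] m s by auto
      then have 1: "c1 * \<bar>d\<bar> \<le> c1 * (1 + m powr s x)" using c_nonneg by (intro mult_left_mono) auto
      have "\<bar>y\<bar> powr (s x - 1) * \<bar>d\<bar> \<le> m powr (s x - 1) * m"
        using y m s by (intro mult_mono powr_mono2) auto
      also have "\<dots> = m powr s x"
      proof (cases "m = 0")
        case False
        then have "m powr (s x - 1) * m powr 1 = m powr s x" unfolding powr_add[symmetric] by simp
        then show ?thesis using False m by simp
      qed (use s in simp)
      finally have 2: "c2 * (\<bar>y\<bar> powr (s x - 1) * \<bar>d\<bar>) \<le> c2 * (1 + m powr s x)"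
        using c_nonneg by (intro mult_left_mono) auto
      have "\<bar>f x y\<bar> * \<bar>d\<bar> \<le> (c1 + c2 * \<bar>y\<bar> powr (s x - 1)) * \<bar>d\<bar>"
        using growth[OF x] by (intro mult_right_mono) auto
      then show ?thesis using 1 2 by (simp add: algebra_simps)
    qed
    have "\<bar>f x a - f x b\<bar> * \<bar>d\<bar> \<le> \<bar>f x a\<bar> * \<bar>d\<bar> + \<bar>f x b\<bar> * \<bar>d\<bar>"
      using mult_right_mono[OF abs_triangle_ineq4[of "f x a" "f x b"], of "\<bar>d\<bar>"] by (simp add: algebra_simps)
    also have "\<dots> \<le> C * (1 + m powr s x)"
      using fle[OF m(2)] fle[OF m(3)] by (simp add: C_def algebra_simps)
    also have "\<dots> \<le> C * (1 + (l powr T + l powr (- \<epsilon>) * (\<bar>a\<bar> powr t x + \<bar>b\<bar> powr t x + \<bar>d\<bar> powr t x)))"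
      using ms mult_left_mono[OF mt, of "l powr (- \<epsilon>)"] C by (intro mult_left_mono) auto
    finally have "\<bar>f x a - f x b\<bar> * \<bar>d\<bar> \<le> C * (1 + l powr T) + C * l powr (- \<epsilon>) * (\<bar>a\<bar> powr t x + \<bar>b\<bar> powr t x + \<bar>d\<bar> powr t x)"
      by (simp add: algebra_simps)
    moreover have "0 \<le> \<eta> * (1 + \<bar>d\<bar> powr t x)" using \<eta> by simp
    ultimately show ?thesis using True by simp
  qed
qed

text \<open>
  The three terms of \<open>increment_mult_le\<close> are made smaller than \<open>e / 3\<close> one after the other.  First \<open>l\<close> is taken large
  and \<open>\<eta>\<close> small, independently of the sequence; then \<open>k\<close> is taken so large that the set where the increment of \<open>f\<close> exceeds
  \<open>\<eta>\<close> has small measure.  None of the choices depends on \<open>\<phi>\<close>.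
\<close>

lemma superposition_uniform_convergence:
  assumes u: "\<And>k. u k \<in> borel_measurable M" and v: "v \<in> borel_measurable M"
    and K: "\<And>k. (\<integral>\<^sup>+x. ennreal (\<bar>u k x\<bar> powr t x) \<partial>M) \<le> ennreal K"
      "(\<integral>\<^sup>+x. ennreal (\<bar>v x\<bar> powr t x) \<partial>M) \<le> ennreal K" "0 \<le> K"
    and lim: "AE x in M. (\<lambda>k. u k x) \<longlonglongrightarrow> v x" and e: "0 < e"
  shows "\<exists>k0. \<forall>k\<ge>k0. \<forall>\<phi>\<in>borel_measurable M. (\<integral>\<^sup>+x. ennreal (\<bar>\<phi> x\<bar> powr t x) \<partial>M) \<le> ennreal K \<longrightarrow>
    (\<integral>\<^sup>+x. ennreal (\<bar>f x (u k x) - f x (v x)\<bar> * \<bar>\<phi> x\<bar>) \<partial>M) \<le> ennreal e"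
proof -
  define C where "C = 2 * (c1 + c2)"
  have C: "0 \<le> C" using c_nonneg by (simp add: C_def)
  define X where "X = 9 * (C * K + 1) / e"
  define l where "l = max 1 (X powr (1 / \<epsilon>))"
  have l: "1 \<le> l" by (simp add: l_def)
  have l_small: "C * l powr (- \<epsilon>) * (3 * K) \<le> e / 3"
  proof -
    have "0 < X" using C K(3) e by (simp add: X_def add_nonneg_pos)
    then have "X = (X powr (1 / \<epsilon>)) powr \<epsilon>"
      using \<epsilon>_pos by (simp add: powr_powr)
    also have "\<dots> \<le> l powr \<epsilon>"
      using \<epsilon>_pos by (intro powr_mono2) (auto simp: l_def)
    finally have "9 * (C * K + 1) \<le> l powr \<epsilon> * e" using e by (simp add: X_def pos_divide_le_eq)
    then have "9 * (C * K) \<le> l powr \<epsilon> * e" by simp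
    moreover have pos: "0 < l powr \<epsilon>" using l by simp
    ultimately have "9 * (C * K) / l powr \<epsilon> \<le> e" by (simp only: pos_divide_le_eq mult.commute[of e])
    moreover have "C * l powr (- \<epsilon>) * (3 * K) = (9 * (C * K) / l powr \<epsilon>) / 3"
      using pos by (simp add: powr_minus_divide)
    ultimately show ?thesis by simp
  qed
  define \<eta> where "\<eta> = e / (3 * (vol + K + 1))"
  have den: "0 < vol + K + 1" using vol(2) K(3) by simp
  have \<eta>: "0 < \<eta>" "\<eta> * (vol + K) \<le> e / 3"
  proof -
    show "0 < \<eta>" using e den by (simp add: \<eta>_def)
    then have "\<eta> * (vol + K) \<le> \<eta> * (vol + K + 1)" by (intro mult_left_mono) auto
    also have "\<dots> = e / 3" using less_imp_neq[OF den, symmetric] unfolding \<eta>_def by (simp del: distrib_left_numeral)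
    finally show "\<eta> * (vol + K) \<le> e / 3" .
  qed
  define bad where "bad k x = (if \<eta> < \<bar>f x (u k x) - f x (v x)\<bar> then 1 else 0 :: real)" for k x
  have f_meas [measurable]: "(\<lambda>x. f x (u k x)) \<in> borel_measurable M" "(\<lambda>x. f x (v x)) \<in> borel_measurable M" for k
    by (intro measurable_f_comp u v)+
  have bad_meas [measurable]: "bad k \<in> borel_measurable M" for k
    unfolding bad_def[abs_def] by measurable
  have "(\<lambda>k. \<integral>\<^sup>+x. ennreal (bad k x) \<partial>M) \<longlonglongrightarrow> (\<integral>\<^sup>+x. 0 \<partial>M)"
  proof (rule nn_integral_dominated_convergence[where w = "\<lambda>_. 1"])
    show "(\<integral>\<^sup>+x. 1 \<partial>M) < \<infinity>" using emeasure_domain by simp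
    show "AE x in M. ennreal (bad k x) \<le> 1" for k by (intro AE_I2) (simp add: bad_def)
    show "AE x in M. (\<lambda>k. ennreal (bad k x)) \<longlonglongrightarrow> 0"
      using lim f_continuous_AE
    proof eventually_elim
      case (elim x)
      have "(\<lambda>k. f x (u k x)) \<longlonglongrightarrow> f x (v x)"
        using elim by (intro isCont_tendsto_compose[where g = "f x"]) (auto simp: continuous_on_eq_continuous_at)
      then have "eventually (\<lambda>k. dist (f x (u k x)) (f x (v x)) < \<eta>) sequentially"
        using \<eta>(1) by (rule tendstoD)
      then have "eventually (\<lambda>k. ennreal (bad k x) = 0) sequentially"
        by eventually_elim (auto simp: bad_def dist_real_def)
      then show ?case by (rule tendsto_eventually)
    qed
  qed measurable
  then have bad_lim: "(\<lambda>k. \<integral>\<^sup>+x. ennreal (bad k x) \<partial>M) \<longlonglongrightarrow> 0" by simp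
  define \<delta> where "\<delta> = e / (3 * (C * (1 + l powr T) + 1))"
  have Cl: "0 \<le> C * (1 + l powr T)" using C by simp
  have \<delta>: "0 < \<delta>" "C * (1 + l powr T) * \<delta> \<le> e / 3"
  proof -
    show "0 < \<delta>" using e Cl by (simp add: \<delta>_def add_nonneg_pos)
    then have "C * (1 + l powr T) * \<delta> \<le> (C * (1 + l powr T) + 1) * \<delta>" by (intro mult_right_mono) auto
    also have "\<dots> = e / 3"
      using Cl unfolding \<delta>_def by (simp add: add_nonneg_eq_0_iff del: distrib_left_numeral)
    finally show "C * (1 + l powr T) * \<delta> \<le> e / 3" .
  qed
  have "eventually (\<lambda>k. (\<integral>\<^sup>+x. ennreal (bad k x) \<partial>M) < ennreal \<delta>) sequentially"
    using \<delta>(1) by (intro order_tendstoD(2)[OF bad_lim]) simp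
  then obtain k0 where k0: "\<And>k. k \<ge> k0 \<Longrightarrow> (\<integral>\<^sup>+x. ennreal (bad k x) \<partial>M) < ennreal \<delta>"
    by (auto simp: eventually_sequentially)
  have linear: "(\<integral>\<^sup>+x. (\<alpha> * (1 + g1 x) + \<beta> * g2 x) + \<gamma> * (g3 x + g4 x + g1 x) \<partial>M) =
      (\<alpha> * (emeasure M \<Omega> + integral\<^sup>N M g1) + \<beta> * integral\<^sup>N M g2) + \<gamma> * (integral\<^sup>N M g3 + integral\<^sup>N M g4 + integral\<^sup>N M g1)"
    if [measurable]: "g1 \<in> borel_measurable M" "g2 \<in> borel_measurable M" "g3 \<in> borel_measurable M" "g4 \<in> borel_measurable M"
    for \<alpha> \<beta> \<gamma> and g1 g2 g3 g4 :: "'a \<Rightarrow> ennreal"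
    by (simp add: nn_integral_add nn_integral_cmult)
  show ?thesis
  proof (intro exI[of _ k0] allI impI ballI)
    fix k and \<phi> :: "'a \<Rightarrow> real" assume k: "k \<ge> k0" and \<phi>: "\<phi> \<in> borel_measurable M"
      and \<phi>K: "(\<integral>\<^sup>+x. ennreal (\<bar>\<phi> x\<bar> powr t x) \<partial>M) \<le> ennreal K"
    have "(\<integral>\<^sup>+x. ennreal (\<bar>f x (u k x) - f x (v x)\<bar> * \<bar>\<phi> x\<bar>) \<partial>M) \<le>
      (\<integral>\<^sup>+x. (ennreal \<eta> * (1 + ennreal (\<bar>\<phi> x\<bar> powr t x)) + ennreal (C * (1 + l powr T)) * ennreal (bad k x)) +
        ennreal (C * l powr (- \<epsilon>)) * (ennreal (\<bar>u k x\<bar> powr t x) + ennreal (\<bar>v x\<bar> powr t x) + ennreal (\<bar>\<phi> x\<bar> powr t x)) \<partial>M)"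
    proof (rule nn_integral_mono)
      fix x assume "x \<in> space M"
      then have "\<bar>f x (u k x) - f x (v x)\<bar> * \<bar>\<phi> x\<bar> \<le> \<eta> * (1 + \<bar>\<phi> x\<bar> powr t x) + C * (1 + l powr T) * bad k x +
         C * l powr (- \<epsilon>) * (\<bar>u k x\<bar> powr t x + \<bar>v x\<bar> powr t x + \<bar>\<phi> x\<bar> powr t x)"
        using increment_mult_le[of x \<eta> l "u k x" "v x" "\<phi> x"] \<eta>(1) l by (simp add: bad_def C_def)
      then have "ennreal (\<bar>f x (u k x) - f x (v x)\<bar> * \<bar>\<phi> x\<bar>) \<le> ennreal (\<eta> * (1 + \<bar>\<phi> x\<bar> powr t x) + C * (1 + l powr T) * bad k x +
         C * l powr (- \<epsilon>) * (\<bar>u k x\<bar> powr t x + \<bar>v x\<bar> powr t x + \<bar>\<phi> x\<bar> powr t x))"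
        by (rule ennreal_leI)
      also have "\<dots> = (ennreal \<eta> * (1 + ennreal (\<bar>\<phi> x\<bar> powr t x)) + ennreal (C * (1 + l powr T)) * ennreal (bad k x)) +
        ennreal (C * l powr (- \<epsilon>)) * (ennreal (\<bar>u k x\<bar> powr t x) + ennreal (\<bar>v x\<bar> powr t x) + ennreal (\<bar>\<phi> x\<bar> powr t x))"
      proof -
        have "0 \<le> bad k x" by (simp add: bad_def)
        then show ?thesis
          using \<eta>(1) C Cl
          by (simp add: ennreal_1[symmetric] ennreal_plus[symmetric] ennreal_mult[symmetric] del: ennreal_1 ennreal_plus)
      qed
      finally show "ennreal (\<bar>f x (u k x) - f x (v x)\<bar> * \<bar>\<phi> x\<bar>) \<le> \<dots>" .
    qed
    also have "\<dots> = (ennreal \<eta> * (emeasure M \<Omega> + (\<integral>\<^sup>+x. ennreal (\<bar>\<phi> x\<bar> powr t x) \<partial>M)) + ennreal (C * (1 + l powr T)) * (\<integral>\<^sup>+x. ennreal (bad k x) \<partial>M)) +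
        ennreal (C * l powr (- \<epsilon>)) * ((\<integral>\<^sup>+x. ennreal (\<bar>u k x\<bar> powr t x) \<partial>M) + (\<integral>\<^sup>+x. ennreal (\<bar>v x\<bar> powr t x) \<partial>M) + (\<integral>\<^sup>+x. ennreal (\<bar>\<phi> x\<bar> powr t x) \<partial>M))"
      by (rule linear; intro measurable_powr_t \<phi> u v measurable_compose[OF bad_meas measurable_ennreal])
    also have "\<dots> \<le> (ennreal \<eta> * (ennreal vol + ennreal K) + ennreal (C * (1 + l powr T)) * ennreal \<delta>) +
        ennreal (C * l powr (- \<epsilon>)) * (ennreal K + ennreal K + ennreal K)"
      unfolding vol(1) by (intro add_mono mult_left_mono \<phi>K K order_refl less_imp_le[OF k0[OF k]]) auto
    also have "\<dots> = ennreal ((\<eta> * (vol + K) + C * (1 + l powr T) * \<delta>) + C * l powr (- \<epsilon>) * (3 * K))"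
    proof -
      have "ennreal K + ennreal K + ennreal K = ennreal (3 * K)"
        using K(3) by (simp add: ennreal_plus[symmetric] del: ennreal_plus)
      then show ?thesis
        using \<eta>(1) C Cl \<delta>(1) K(3) vol(2)
        by (simp add: ennreal_plus[symmetric] ennreal_mult[symmetric] del: ennreal_plus)
    qed
    also have "\<dots> \<le> ennreal e"
      using \<eta>(2) \<delta>(2) l_small by (intro ennreal_leI) linarith
    finally show "(\<integral>\<^sup>+x. ennreal (\<bar>f x (u k x) - f x (v x)\<bar> * \<bar>\<phi> x\<bar>) \<partial>M) \<le> ennreal e" .
  qed
qed

sublocale seminormed_functions V grad
  by unfold_locales (auto intro: V_zero Wnorm_zero(2) V_scale grad_scale_le V_imp_W grad_nonneg)

abbreviation "J' \<equiv> energy_derivative \<Omega> V f"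

lemma J'_eq: "\<phi> \<in> V \<Longrightarrow> J' u \<phi> = (LINT x|M. f x (u x) * \<phi> x)"
  by (simp add: energy_derivative_def set_lebesgue_integral_domain)

text \<open>
  Finite \<open>t\<close>-modular of \<open>u\<close> is enough: on the unit ball the modulars of \<open>\<phi>\<close> are bounded by the embedding.
\<close>

lemma J'_dual:
  assumes u: "u \<in> Lt_space"
  shows "J' u \<in> dual_space V grad"
proof -
  obtain K where K: "0 \<le> K" "\<And>\<phi>. \<phi> \<in> V \<Longrightarrow> grad \<phi> \<le> 1 \<Longrightarrow> (\<integral>\<^sup>+x. ennreal (\<bar>\<phi> x\<bar> powr t x) \<partial>M) \<le> ennreal K"
    using V_embedding[of 1] by blast
  show ?thesis
  proof (rule dual_spaceI[where C = "growth_const * (vol + (LINT x|M. \<bar>u x\<bar> powr t x) + K)"])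
    fix \<phi> \<psi> assume \<phi>: "\<phi> \<in> V" "\<psi> \<in> V"
    have "(LINT x|M. f x (u x) * (\<phi> x + \<psi> x)) = (LINT x|M. f x (u x) * \<phi> x + f x (u x) * \<psi> x)"
      by (simp add: distrib_left)
    also have "\<dots> = (LINT x|M. f x (u x) * \<phi> x) + (LINT x|M. f x (u x) * \<psi> x)"
      by (intro Bochner_Integration.integral_add integrable_f_mult u V_subset_Lt \<phi>)
    finally show "J' u (\<lambda>x. \<phi> x + \<psi> x) = J' u \<phi> + J' u \<psi>" using \<phi> V_add[OF \<phi>] by (simp add: J'_eq)
  next
    fix c \<phi> assume \<phi>: "\<phi> \<in> V"
    have "(LINT x|M. f x (u x) * (c * \<phi> x)) = c * (LINT x|M. f x (u x) * \<phi> x)"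
      by (simp add: mult.left_commute)
    then show "J' u (\<lambda>x. c * \<phi> x) = c * J' u \<phi>" using \<phi> V_scale[OF \<phi>] by (simp add: J'_eq)
  next
    fix \<phi> assume "\<phi> \<in> unit_ball"
    then have \<phi>: "\<phi> \<in> V" "grad \<phi> \<le> 1" by auto
    interpret finite_measure M by (rule finite_measure_domain)
    note \<phi>L = V_subset_Lt[OF \<phi>(1)]
    have "\<bar>J' u \<phi>\<bar> \<le> (LINT x|M. \<bar>f x (u x) * \<phi> x\<bar>)"
      unfolding J'_eq[OF \<phi>(1)] by (rule integral_abs_bound)
    also have "\<dots> \<le> (LINT x|M. growth_const * (1 + \<bar>u x\<bar> powr t x + \<bar>\<phi> x\<bar> powr t x))"
      using growth_mult_le
      by (intro integral_mono integrable_abs integrable_f_mult u \<phi>L integrable_dominating) (auto simp: abs_mult)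
    also have "\<dots> = growth_const * (vol + (LINT x|M. \<bar>u x\<bar> powr t x) + (LINT x|M. \<bar>\<phi> x\<bar> powr t x))"
      using Lt_integrable[OF u] Lt_integrable[OF \<phi>L] by (simp add: vol_def)
    also have "\<dots> \<le> growth_const * (vol + (LINT x|M. \<bar>u x\<bar> powr t x) + K)"
    proof -
      have "ennreal (LINT x|M. \<bar>\<phi> x\<bar> powr t x) \<le> ennreal K"
        using K(2)[OF \<phi>] by (subst nn_integral_eq_integral[symmetric, OF Lt_integrable[OF \<phi>L]]) auto
      then show ?thesis using K(1) growth_const_nonneg by (intro mult_left_mono add_left_mono) (auto simp: ennreal_le_iff)
    qed
    finally show "\<bar>J' u \<phi>\<bar> \<le> growth_const * (vol + (LINT x|M. \<bar>u x\<bar> powr t x) + K)" .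
  qed (simp add: energy_derivative_def)
qed

text \<open>
  The limit \<open>v\<close> is only known to be measurable.  Its modular is finite by Fatou's lemma, so \<open>J' v\<close> is a bounded
  functional whether or not \<open>v\<close> belongs to \<open>V\<close>.
\<close>

lemma J'_tendsto_if_AE_tendsto:
  assumes u: "\<And>k. u k \<in> V" "\<And>k. grad (u k) \<le> R" and v: "v \<in> borel_measurable M"
    and lim: "AE x in M. (\<lambda>k. u k x) \<longlonglongrightarrow> v x"
  shows "v \<in> Lt_space" "\<And>e. 0 < e \<Longrightarrow> \<exists>k0. \<forall>k\<ge>k0. dual_norm V grad (J' (u k) - J' v) < e"
proof -
  obtain K where K: "0 \<le> K" "\<And>\<phi>. \<phi> \<in> V \<Longrightarrow> grad \<phi> \<le> max R 1 \<Longrightarrow> (\<integral>\<^sup>+x. ennreal (\<bar>\<phi> x\<bar> powr t x) \<partial>M) \<le> ennreal K"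
    using V_embedding[of "max R 1"] by blast
  have uK: "(\<integral>\<^sup>+x. ennreal (\<bar>u k x\<bar> powr t x) \<partial>M) \<le> ennreal K" for k
    using u by (intro K(2)) (auto simp: le_max_iff_disj)
  have um: "u k \<in> borel_measurable M" for k by (rule V_measurable[OF u(1)])
  have vK: "(\<integral>\<^sup>+x. ennreal (\<bar>v x\<bar> powr t x) \<partial>M) \<le> ennreal K"
    by (rule modular_t_le_if_AE_tendsto[OF um uK lim])
  show vf: "v \<in> Lt_space" using v vK by (auto simp: Lt_space_def intro: le_less_trans)
  fix e :: real assume e: "0 < e"
  obtain k0 where k0: "\<And>k \<phi>. k \<ge> k0 \<Longrightarrow> \<phi> \<in> borel_measurable M \<Longrightarrow> (\<integral>\<^sup>+x. ennreal (\<bar>\<phi> x\<bar> powr t x) \<partial>M) \<le> ennreal K \<Longrightarrow>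
    (\<integral>\<^sup>+x. ennreal (\<bar>f x (u k x) - f x (v x)\<bar> * \<bar>\<phi> x\<bar>) \<partial>M) \<le> ennreal (e / 2)"
    using superposition_uniform_convergence[OF um v uK vK K(1) lim, of "e / 2"] e by auto
  have "dual_norm V grad (J' (u k) - J' v) \<le> e / 2" if k: "k \<ge> k0" for k
  proof (rule dual_norm_least)
    fix \<phi> assume "\<phi> \<in> unit_ball"
    then have \<phi>: "\<phi> \<in> V" "grad \<phi> \<le> 1" by auto
    have int: "integrable M (\<lambda>x. f x (u k x) * \<phi> x)" "integrable M (\<lambda>x. f x (v x) * \<phi> x)"
      by (intro integrable_f_mult V_subset_Lt u \<phi> vf)+
    have "J' (u k) \<phi> - J' v \<phi> = (LINT x|M. f x (u k x) * \<phi> x - f x (v x) * \<phi> x)"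
      unfolding J'_eq[OF \<phi>(1)] by (rule Bochner_Integration.integral_diff[OF int, symmetric])
    then have "ennreal \<bar>J' (u k) \<phi> - J' v \<phi>\<bar> \<le> (\<integral>\<^sup>+x. ennreal (norm (f x (u k x) * \<phi> x - f x (v x) * \<phi> x)) \<partial>M)"
      using integral_norm_bound_ennreal[OF Bochner_Integration.integrable_diff[OF int]] by simp
    also have "\<dots> = (\<integral>\<^sup>+x. ennreal (\<bar>f x (u k x) - f x (v x)\<bar> * \<bar>\<phi> x\<bar>) \<partial>M)"
      by (simp add: abs_mult[symmetric] left_diff_distrib)
    also have "\<dots> \<le> ennreal (e / 2)"
      by (rule k0[OF k V_measurable[OF \<phi>(1)] K(2)]) (use \<phi> in auto)
    finally show "\<bar>J' (u k) \<phi> - J' v \<phi>\<bar> \<le> e / 2" using e by (simp add: ennreal_le_iff)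
  qed
  then show "\<exists>k0. \<forall>k\<ge>k0. dual_norm V grad (J' (u k) - J' v) < e"
    using e by (intro exI[of _ k0]) force
qed

lemma topspace_norm_topology_V: "topspace (norm_topology V grad) = V"
proof -
  have "openin (norm_topology V grad) V" unfolding openin_norm_topology by (auto intro: exI[of _ 1])
  moreover have "topspace (norm_topology V grad) \<subseteq> V"
    using openin_norm_topology[of V grad] by (metis openin_topspace)
  ultimately show ?thesis using openin_subset by blast
qed

text \<open>
  A sequence violating continuity at \<open>u\<close> converges to \<open>u\<close> in \<open>L\<^sup>1\<close> by the Poincare inequality, hence
  almost everywhere along a subsequence, and there \<open>J'\<close> does converge.
\<close>

lemma J'_epsilon_delta:
  assumes u: "u \<in> V" and e: "0 < e"
  shows "\<exists>\<delta>>0. \<forall>v\<in>V. grad (v - u) < \<delta> \<longrightarrow> dual_norm V grad (J' v - J' u) < e"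
proof (rule ccontr)
  assume "\<not> ?thesis"
  then have "\<forall>k. \<exists>v. v \<in> V \<and> grad (v - u) < inverse (real (Suc k)) \<and> \<not> dual_norm V grad (J' v - J' u) < e"
    by (metis inverse_positive_iff_positive of_nat_0_less_iff zero_less_Suc)
  from choice[OF this] obtain v where v: "\<And>k. v k \<in> V" "\<And>k. grad (v k - u) < inverse (real (Suc k))"
    "\<And>k. \<not> dual_norm V grad (J' (v k) - J' u) < e" by blast
  obtain C where C: "0 \<le> C" "\<And>w. w \<in> V \<Longrightarrow> (\<integral>\<^sup>+x. ennreal \<bar>w x\<bar> \<partial>M) \<le> ennreal (C * grad w)"
    using V_poincare by blast
  have diff: "v k - u \<in> V" for k by (rule V_diff[OF v(1) u])
  have le: "(\<integral>\<^sup>+x. ennreal \<bar>v k x - u x\<bar> \<partial>M) \<le> ennreal (C * inverse (real (Suc k)))" for k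
  proof -
    have "(\<integral>\<^sup>+x. ennreal \<bar>(v k - u) x\<bar> \<partial>M) \<le> ennreal (C * grad (v k - u))" by (rule C(2)[OF diff])
    also have "\<dots> \<le> ennreal (C * inverse (real (Suc k)))"
      using v(2)[of k] C(1) by (intro ennreal_leI mult_left_mono) auto
    finally show ?thesis by simp
  qed
  have "(\<lambda>k. C * inverse (real (Suc k))) \<longlonglongrightarrow> C * 0"
    by (intro tendsto_intros LIMSEQ_inverse_real_of_nat)
  then obtain r where r: "strict_mono (r :: nat \<Rightarrow> nat)" "AE x in M. (\<lambda>k. v (r k) x - u x) \<longlonglongrightarrow> 0"
    using AE_subseq_if_nn_integral_tendsto_0[of "\<lambda>k x. v k x - u x" M, OF _ le]
      V_measurable[OF v(1)] V_measurable[OF u] by (auto intro!: borel_measurable_diff)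
  have lim: "AE x in M. (\<lambda>k. v (r k) x) \<longlonglongrightarrow> u x"
    using r(2) by eventually_elim (simp add: LIM_zero_iff)
  have bound: "grad (v (r k)) \<le> grad u + 1" for k
  proof -
    have "v (r k) = (\<lambda>x. 1 * (v (r k) - u) x + 1 * u x)" by auto
    then have "grad (v (r k)) \<le> grad (v (r k) - u) + grad u"
      using W_linear(2)[OF V_imp_W[OF diff[of "r k"]] V_imp_W[OF u], of 1 1] by simp
    also have "grad (v (r k) - u) \<le> 1"
      using v(2)[of "r k"] by (rule order_trans[OF less_imp_le]) (simp add: field_simps)
    finally show ?thesis by simp
  qed
  obtain k where "dual_norm V grad (J' (v (r k)) - J' u) < e"
    using J'_tendsto_if_AE_tendsto(2)[of "\<lambda>k. v (r k)", OF v(1) bound V_measurable[OF u] lim e] by blast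
  then show False using v(3) by blast
qed

lemma J'_continuous: "continuous_map (norm_topology V grad) (dual_topology V grad) J'"
proof -
  have top: "topspace (dual_topology V grad) = dual_space V grad"
    using dual.topspace_mtopology unfolding dual_mtopology .
  show ?thesis
    unfolding continuous_map_def topspace_norm_topology_V top
  proof (intro conjI allI impI)
    show "J' \<in> V \<rightarrow> dual_space V grad" using J'_dual V_subset_Lt by blast
    fix U assume U: "openin (dual_topology V grad) U"
    show "openin (norm_topology V grad) {u \<in> V. J' u \<in> U}"
      unfolding openin_norm_topology
    proof (intro conjI ballI)
      fix u assume "u \<in> {u \<in> V. J' u \<in> U}"
      then have u: "u \<in> V" "J' u \<in> U" by auto
      obtain e where e: "0 < e" "\<forall>S\<in>dual_space V grad. dual_norm V grad (S - J' u) < e \<longrightarrow> S \<in> U"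
        using U u(2) unfolding openin_norm_topology by blast
      obtain \<delta> where "0 < \<delta>" "\<forall>v\<in>V. grad (v - u) < \<delta> \<longrightarrow> dual_norm V grad (J' v - J' u) < e"
        using J'_epsilon_delta[OF u(1) e(1)] by blast
      then show "\<exists>r>0. \<forall>v\<in>V. grad (v - u) < r \<longrightarrow> v \<in> {u \<in> V. J' u \<in> U}"
        using e(2) J'_dual[OF V_subset_Lt] by blast
    qed auto
  qed
qed

lemma J'_compact: "compact_to_dual V grad J'"
  unfolding compact_to_dual_def
proof (intro conjI J'_continuous allI impI)
  fix B assume B: "B \<subseteq> V" "\<exists>C. \<forall>u\<in>B. grad u \<le> C"
  then obtain R where R: "\<And>u. u \<in> B \<Longrightarrow> grad u \<le> R" by blast
  show "compactin (dual_topology V grad) (dual_topology V grad closure_of (J' ` B))"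
  proof (rule compactin_closure_if_sequences)
    show "J' ` B \<subseteq> dual_space V grad" using B J'_dual[OF V_subset_Lt] by blast
    fix \<sigma> :: "nat \<Rightarrow> ('a \<Rightarrow> real) \<Rightarrow> real" assume "range \<sigma> \<subseteq> J' ` B"
    then have "\<forall>k. \<exists>u. u \<in> B \<and> \<sigma> k = J' u" by blast
    from choice[OF this] obtain u where u: "\<And>k. u k \<in> B" "\<And>k. \<sigma> k = J' (u k)" by blast
    have uV: "u k \<in> V" for k using u(1) B(1) by blast
    obtain r v where r: "strict_mono (r :: nat \<Rightarrow> nat)" "v \<in> borel_measurable M" "AE x in M. (\<lambda>k. u (r k) x) \<longlonglongrightarrow> v x"
      using V_AE_compact[of u R] uV R[OF u(1)] by blast
    note lim = J'_tendsto_if_AE_tendsto[of "\<lambda>k. u (r k)", OF uV R[OF u(1)] r(2,3)]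
    show "\<exists>T r. T \<in> dual_space V grad \<and> strict_mono (r :: nat \<Rightarrow> nat) \<and>
       (\<forall>e>0. \<exists>k0. \<forall>k\<ge>k0. dual_norm V grad (\<sigma> (r k) - T) < e)"
      using r(1) J'_dual[OF lim(1)] lim(2) unfolding u(2) by blast
  qed
qed

lemma energy_gateaux:
  assumes u: "u \<in> V"
  shows "has_gateaux_derivative V grad (energy \<Omega> f) (J' u) u"
  unfolding has_gateaux_derivative_def
proof (intro conjI ballI J'_dual V_subset_Lt u)
  fix \<phi> assume \<phi>: "\<phi> \<in> V"
  show "((\<lambda>h. (energy \<Omega> f (\<lambda>x. u x + h * \<phi> x) - energy \<Omega> f u) / h) \<longlongrightarrow> J' u \<phi>) (at 0)"
    unfolding J'_eq[OF \<phi>]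
    by (intro energy_difference_quotient_tendsto V_subset_Lt u \<phi> V_add[OF u V_scale[OF \<phi>]])
qed

end

section \<open>The energy functional\<close>

lemma bdd_image_closure:
  fixes h :: "'a::euclidean_space \<Rightarrow> real"
  assumes "bounded \<Omega>" "continuous_on (closure \<Omega>) h"
  shows "bdd_above (h ` closure \<Omega>)" "bdd_below (h ` closure \<Omega>)"
proof -
  have "bounded (h ` closure \<Omega>)"
    using assms by (intro compact_imp_bounded compact_continuous_image) auto
  then show "bdd_above (h ` closure \<Omega>)" "bdd_below (h ` closure \<Omega>)"
    by (auto intro: bounded_imp_bdd_above bounded_imp_bdd_below)
qed

text \<open>
  Multiplied out, the gap to the critical exponent is a positive continuous function on a compact set, so it
  has a positive minimum.
\<close>

lemma subcritical_gap:
  fixes p s :: "'a::euclidean_space \<Rightarrow> real"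
  assumes "bounded \<Omega>" "\<Omega> \<noteq> {}" "continuous_on (closure \<Omega>) p" "continuous_on (closure \<Omega>) s"
    and p: "\<And>x. x \<in> closure \<Omega> \<Longrightarrow> 0 < p x \<and> p x < N"
    and s: "\<And>x. x \<in> closure \<Omega> \<Longrightarrow> s x < N * p x / (N - p x)"
  obtains \<epsilon> where "0 < \<epsilon>" "\<And>x. x \<in> closure \<Omega> \<Longrightarrow> (s x + \<epsilon>) * (N - p x) < N * p x"
proof -
  let ?g = "\<lambda>x. N * p x - s x * (N - p x)"
  have "compact (closure \<Omega>)" "closure \<Omega> \<noteq> {}" using assms by auto
  moreover have "continuous_on (closure \<Omega>) ?g" using assms by (intro continuous_intros)
  ultimately have "\<exists>x0\<in>closure \<Omega>. \<forall>x\<in>closure \<Omega>. ?g x0 \<le> ?g x"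
    by (rule continuous_attains_inf)
  then obtain x0 where x0: "x0 \<in> closure \<Omega>" "\<And>x. x \<in> closure \<Omega> \<Longrightarrow> ?g x0 \<le> ?g x"
    by blast
  have N: "0 < N" using p[OF x0(1)] by simp
  have g0: "0 < ?g x0" using s[OF x0(1)] p[OF x0(1)] by (simp add: pos_less_divide_eq)
  show ?thesis
  proof (rule that[of "?g x0 / (2 * N)"])
    show "0 < ?g x0 / (2 * N)" using g0 N by simp
    fix x assume x: "x \<in> closure \<Omega>"
    have "?g x0 / (2 * N) * (N - p x) \<le> ?g x0 / (2 * N) * N"
      using p[OF x] g0 N by (intro mult_left_mono) auto
    also have "\<dots> < ?g x0" using g0 N by simp
    also have "\<dots> \<le> ?g x" by (rule x0(2)[OF x])
    finally show "(s x + ?g x0 / (2 * N)) * (N - p x) < N * p x"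
      by (simp only: distrib_right)
  qed
qed

theorem lemma3p5:
  fixes \<Omega> :: "(real ^ 'n) set"
    and p q \<mu> s :: "real ^ 'n \<Rightarrow> real"
    and f :: "real ^ 'n \<Rightarrow> real \<Rightarrow> real"
    and c1 c2 :: real
  defines "V \<equiv> W0_space \<Omega> (dphase p q \<mu>)"
    and "n \<equiv> grad_norm \<Omega> (dphase p q \<mu>)"
  assumes "CARD('n) \<ge> 2"
    and "bounded_lipschitz_domain \<Omega>"
    and "continuous_on (closure \<Omega>) p" and "continuous_on (closure \<Omega>) q"
    and "\<forall>x\<in>closure \<Omega>. p x > 1" and "\<forall>x\<in>closure \<Omega>. q x > 1"
    and "max_on \<Omega> p < min_on \<Omega> q" and "max_on \<Omega> q < real CARD('n)"
    and "nonneg_L_infinity \<Omega> \<mu>"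
    and "caratheodory \<Omega> f"
    and "c1 \<ge> 0" and "c2 \<ge> 0"
    and "continuous_on (closure \<Omega>) s"
    and "\<forall>x\<in>closure \<Omega>. 1 < s x \<and> s x < critical_exponent CARD('n) p x"
    and "\<forall>x\<in>\<Omega>. \<forall>t. \<bar>f x t\<bar> \<le> c1 + c2 * \<bar>t\<bar> powr (s x - 1)"
  shows "(\<forall>u\<in>V. set_integrable lebesgue \<Omega> (\<lambda>x. primitive f x (u x)))
    \<and> (\<forall>u\<in>V. \<forall>\<phi>\<in>V. set_integrable lebesgue \<Omega> (\<lambda>x. f x (u x) * \<phi> x))
    \<and> continuously_gateaux_differentiable V n (energy \<Omega> f) (energy_derivative \<Omega> V f)
    \<and> compact_to_dual V n (energy_derivative \<Omega> V f)"
proof -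
  let ?N = "real CARD('n)"
  have \<Omega>: "open \<Omega>" "\<Omega> \<noteq> {}" "bounded \<Omega>"
    using assms(4) by (auto simp: bounded_lipschitz_domain_def)
  note p_cont = assms(5) and q_cont = assms(6) and s_cont = assms(15)
  note bdd = bdd_image_closure[OF \<Omega>(3)]
  have p_le: "p x \<le> max_on \<Omega> p" and q_ge: "min_on \<Omega> q \<le> q x" and q_le: "q x \<le> max_on \<Omega> q"
    and s_le: "s x \<le> max_on \<Omega> s" if "x \<in> closure \<Omega>" for x
    unfolding max_on_def min_on_def
    by (rule cSUP_upper cINF_lower; intro that bdd p_cont q_cont s_cont)+
  have pq: "p x \<le> max_on \<Omega> q" "p x < ?N" if "x \<in> closure \<Omega>" for x
    using p_le[OF that] q_ge[OF that] q_le[OF that] assms(9,10) by linarith+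
  obtain \<epsilon> where \<epsilon>: "0 < \<epsilon>" "\<And>x. x \<in> closure \<Omega> \<Longrightarrow> (s x + \<epsilon>) * (?N - p x) < ?N * p x"
  proof (rule subcritical_gap[OF \<Omega>(3,2) p_cont s_cont, of ?N])
    show "0 < p x \<and> p x < ?N" if "x \<in> closure \<Omega>" for x
      using assms(7) pq(2)[OF that] that by force
    show "s x < ?N * p x / (?N - p x)" if "x \<in> closure \<Omega>" for x
      using assms(16) that by (simp add: critical_exponent_def)
  qed blast
  have meas: "h \<in> borel_measurable (lebesgue_on \<Omega>)" if "continuous_on (closure \<Omega>) h" for h :: "real ^ 'n \<Rightarrow> real"
    using \<Omega>(1) by (intro continuous_imp_measurable_on_sets_lebesgue continuous_on_subset[OF that closure_subset]) (simp add: borel_open)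
  have sub: "x \<in> \<Omega> \<Longrightarrow> x \<in> closure \<Omega>" for x using closure_subset by blast
  \<comment> \<open>The maximum of \<open>q\<close> bounds both exponents because \<open>p\<close> stays below the minimum of \<open>q\<close>.\<close>
  interpret superposition \<Omega> p q \<mu> "max_on \<Omega> q" "\<lambda>x. s x + \<epsilon>" f s c1 c2 \<epsilon> "max_on \<Omega> s + \<epsilon>"
  proof unfold_locales
    show "AE x in lebesgue_on \<Omega>. 0 \<le> \<mu> x" "\<mu> \<in> borel_measurable (lebesgue_on \<Omega>)"
      using assms(11) by (auto simp: nonneg_L_infinity_def elim: eventually_mono)
    show "continuous_on (closure \<Omega>) (\<lambda>x. s x + \<epsilon>)" by (intro continuous_intros s_cont)
    show "1 \<le> p x \<and> p x \<le> max_on \<Omega> q" if "x \<in> \<Omega>" for x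
      using assms(7) pq(1) sub[OF that] by force
    show "1 \<le> q x \<and> q x \<le> max_on \<Omega> q" if "x \<in> \<Omega>" for x
      using assms(8) q_le sub[OF that] by force
    show "1 < p x \<and> p x < real DIM(real ^ 'n)" if "x \<in> closure \<Omega>" for x
      using assms(7) pq(2) that by simp
    show "0 < s x + \<epsilon>" if "x \<in> closure \<Omega>" for x
      using assms(16) \<epsilon>(1) that by force
    show "(s x + \<epsilon>) * (real DIM(real ^ 'n) - p x) < real DIM(real ^ 'n) * p x" if "x \<in> closure \<Omega>" for x
      using \<epsilon>(2)[OF that] by simp
  qed (use \<Omega> meas p_cont q_cont assms sub s_le \<epsilon>(1) in auto)
  show ?thesis
    unfolding V_def n_def continuously_gateaux_differentiable_def set_integrable_domain
    using integrable_primitive integrable_f_mult V_subset_Lt energy_gateaux J'_continuous J'_compact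
    by blast
qed

end
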